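(* Let $G$ be a supersimple group of rank $1$ and let $X$ be a definable subset of $G$. If $X$ has generically distinct squares, then for every definable subgroup $H$ of $G$ of finite index, the set of bad initial points \[ \mathrm{B}(X)=\left\{x \in X \ \middle|\ \text{there are only finitely many } g \in H \text{ with } x,\ x\cdot g \text{ and } g\cdot x\cdot g \text{ all in } X\right\} \] is finite.
   Context: Let $T$ be a complete first-order theory and $\mathbb U$ a sufficiently saturated model of $T$. A formula $\varphi(x,b)$ divides over a set $C$ if there is a $C$-indiscernible sequence $(b_n)_{n\in\mathbb N}$ with $b_0=b$ such that $\{\varphi(x,b_n)\}_{n\in\mathbb N}$ is inconsistent; it forks over $C$ if it implies a finite disjunction of formulas each of which divides over $C$. $T$ is supersimple of rank $1$ if every formula $\varphi(x,b)$ with $x$ a single variable that divides over $\emptyset$ is algebraic (has finitely many realizations). For small sets $A,B,C$, $A$ is independent from $B$ over $C$, written $A \mathop{\perp\!\!\!\perp}_C B$, if $\mathrm{tp}(A/B\cup C)$ contains no formula forking over $C$. An element $g$ is generic over a set $A$ if $\mathrm{tp}(g/A)$ is not algebraic. A supersimple group of rank $1$ is a group $G$ whose underlying set is the universe of a sufficiently saturated model of a supersimple theory of rank $1$, with group law and inverse definable without parameters. "Definable" means definable with parameters. A subset $X$ of $G$ definable over a parameter set $A$ has generically distinct squares if $x^2\neq y^2$ for every two elements $x,y\in X$ that are each generic over $A$ and satisfy $x\mathop{\perp\!\!\!\perp}_A y$. *)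

theory Defs
  imports "HOL-Algebra.Coset"
begin

unbundle cardinal_syntax

section \<open>First-order logic\<close>

text \<open>
  A language is given by its function and relation symbols together with their arities;
  constants are function symbols of arity 0. Equality is a logical symbol.
\<close>

record ('f, 'r) language =
  Funs :: "('f \<times> nat) set"
  Rels :: "('r \<times> nat) set"

datatype 'f tm = Var nat | Fn 'f "'f tm list"

datatype ('f, 'r) fm =
    Eql "'f tm" "'f tm"
  | Rel 'r "'f tm list"
  | Neg "('f, 'r) fm"
  | Conj "('f, 'r) fm" "('f, 'r) fm"
  | Exi nat "('f, 'r) fm"

primrec tm_vars :: "'f tm \<Rightarrow> nat set" where
  "tm_vars (Var i) = {i}"
| "tm_vars (Fn f ts) = \<Union> (set (map tm_vars ts))"

primrec free_vars :: "('f, 'r) fm \<Rightarrow> nat set" where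
  "free_vars (Eql s t) = tm_vars s \<union> tm_vars t"
| "free_vars (Rel r ts) = \<Union> (set (map tm_vars ts))"
| "free_vars (Neg \<phi>) = free_vars \<phi>"
| "free_vars (Conj \<phi> \<psi>) = free_vars \<phi> \<union> free_vars \<psi>"
| "free_vars (Exi i \<phi>) = free_vars \<phi> - {i}"

primrec wf_tm :: "('f, 'r) language \<Rightarrow> 'f tm \<Rightarrow> bool" where
  "wf_tm L (Var i) = True"
| "wf_tm L (Fn f ts) = ((f, length ts) \<in> Funs L \<and> list_all id (map (wf_tm L) ts))"

primrec wf_fm :: "('f, 'r) language \<Rightarrow> ('f, 'r) fm \<Rightarrow> bool" where
  "wf_fm L (Eql s t) = (wf_tm L s \<and> wf_tm L t)"
| "wf_fm L (Rel r ts) = ((r, length ts) \<in> Rels L \<and> (\<forall>t \<in> set ts. wf_tm L t))"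
| "wf_fm L (Neg \<phi>) = wf_fm L \<phi>"
| "wf_fm L (Conj \<phi> \<psi>) = (wf_fm L \<phi> \<and> wf_fm L \<psi>)"
| "wf_fm L (Exi i \<phi>) = wf_fm L \<phi>"

definition formulas :: "('f, 'r) language \<Rightarrow> nat \<Rightarrow> ('f, 'r) fm set" where
  "formulas L n = {\<phi>. wf_fm L \<phi> \<and> free_vars \<phi> \<subseteq> {..<n}}"

record ('a, 'f, 'r) struct =
  Univ :: "'a set"
  FunI :: "'f \<Rightarrow> 'a list \<Rightarrow> 'a"
  RelI :: "'r \<Rightarrow> 'a list \<Rightarrow> bool"

definition tuples :: "'a set \<Rightarrow> nat \<Rightarrow> 'a list set" where
  "tuples A n = {as. set as \<subseteq> A \<and> length as = n}"

definition is_structure :: "('f, 'r) language \<Rightarrow> ('a, 'f, 'r) struct \<Rightarrow> bool" where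
  "is_structure L M \<longleftrightarrow> Univ M \<noteq> {} \<and>
     (\<forall>(f, n) \<in> Funs L. \<forall>as \<in> tuples (Univ M) n. FunI M f as \<in> Univ M)"

primrec eval_tm :: "('a, 'f, 'r) struct \<Rightarrow> (nat \<Rightarrow> 'a) \<Rightarrow> 'f tm \<Rightarrow> 'a" where
  "eval_tm M e (Var i) = e i"
| "eval_tm M e (Fn f ts) = FunI M f (map (eval_tm M e) ts)"

primrec sat :: "('a, 'f, 'r) struct \<Rightarrow> (nat \<Rightarrow> 'a) \<Rightarrow> ('f, 'r) fm \<Rightarrow> bool" where
  "sat M e (Eql s t) = (eval_tm M e s = eval_tm M e t)"
| "sat M e (Rel r ts) = RelI M r (map (eval_tm M e) ts)"
| "sat M e (Neg \<phi>) = (\<not> sat M e \<phi>)"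
| "sat M e (Conj \<phi> \<psi>) = (sat M e \<phi> \<and> sat M e \<psi>)"
| "sat M e (Exi i \<phi>) = (\<exists>a \<in> Univ M. sat M (e(i := a)) \<phi>)"

text \<open>
  \<open>holds M \<phi> as\<close> is truth of \<open>\<phi>(as)\<close> in \<open>M\<close>. It is only used for
  \<open>\<phi> \<in> formulas L (length as)\<close>, so the values of \<open>(!) as\<close> beyond the
  length of \<open>as\<close> play no role.
\<close>

definition holds :: "('a, 'f, 'r) struct \<Rightarrow> ('f, 'r) fm \<Rightarrow> 'a list \<Rightarrow> bool" where
  "holds M \<phi> as \<longleftrightarrow> sat M ((!) as) \<phi>"

text \<open>Theories are taken to be deductively closed, so a complete theory decides every
  sentence by membership.\<close>

definition complete_theory :: "('f, 'r) language \<Rightarrow> ('f, 'r) fm set \<Rightarrow> bool" where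
  "complete_theory L T \<longleftrightarrow> T \<subseteq> formulas L 0 \<and> (\<forall>\<sigma> \<in> formulas L 0. \<sigma> \<in> T \<or> Neg \<sigma> \<in> T)"

definition is_model ::
    "('f, 'r) language \<Rightarrow> ('f, 'r) fm set \<Rightarrow> ('a, 'f, 'r) struct \<Rightarrow> bool" where
  "is_model L T M \<longleftrightarrow> is_structure L M \<and> (\<forall>\<sigma> \<in> T. holds M \<sigma> [])"


section \<open>Formulas with parameters, types, saturation\<close>

text \<open>
  A formula \<open>\<phi>(x,b)\<close>, with \<open>x\<close> an \<open>n\<close>-tuple of variables, is the pair of a
  parameter-free formula and the tuple \<open>b\<close>: the variables below \<open>n\<close> stand for
  \<open>x\<close>, the next \<open>length b\<close> ones are evaluated at \<open>b\<close>.
\<close>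

type_synonym ('a, 'f, 'r) pfm = "('f, 'r) fm \<times> 'a list"

definition pformulas :: "('f, 'r) language \<Rightarrow> 'a set \<Rightarrow> nat \<Rightarrow> ('a, 'f, 'r) pfm set" where
  "pformulas L B n = {(\<phi>, bs). set bs \<subseteq> B \<and> \<phi> \<in> formulas L (n + length bs)}"

definition realizations ::
    "('a, 'f, 'r) struct \<Rightarrow> nat \<Rightarrow> ('a, 'f, 'r) pfm \<Rightarrow> 'a list set" where
  "realizations M n \<theta> = {as \<in> tuples (Univ M) n. holds M (fst \<theta>) (as @ snd \<theta>)}"

definition tp ::
    "('f, 'r) language \<Rightarrow> ('a, 'f, 'r) struct \<Rightarrow> 'a list \<Rightarrow> 'a set \<Rightarrow> ('a, 'f, 'r) pfm set" where
  "tp L M as B = {\<theta> \<in> pformulas L B (length as). as \<in> realizations M (length as) \<theta>}"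

definition definable_over ::
    "('f, 'r) language \<Rightarrow> ('a, 'f, 'r) struct \<Rightarrow> 'a set \<Rightarrow> nat \<Rightarrow> 'a list set \<Rightarrow> bool" where
  "definable_over L M A n D \<longleftrightarrow> (\<exists>\<theta> \<in> pformulas L A n. D = realizations M n \<theta>)"

definition definable_set_over ::
    "('f, 'r) language \<Rightarrow> ('a, 'f, 'r) struct \<Rightarrow> 'a set \<Rightarrow> 'a set \<Rightarrow> bool" where
  "definable_set_over L M A X \<longleftrightarrow> definable_over L M A 1 ((\<lambda>x. [x]) ` X)"

definition saturated ::
    "'k rel \<Rightarrow> ('f, 'r) language \<Rightarrow> ('a, 'f, 'r) struct \<Rightarrow> bool" where
  "saturated \<kappa> L M \<longleftrightarrow>
     (\<forall>A p. A \<subseteq> Univ M \<and> |A| <o \<kappa> \<and> p \<subseteq> pformulas L A 1 \<and>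
        (\<forall>q. finite q \<and> q \<subseteq> p \<longrightarrow> (\<exists>a \<in> Univ M. \<forall>\<theta> \<in> q. [a] \<in> realizations M 1 \<theta>)) \<longrightarrow>
        (\<exists>a \<in> Univ M. \<forall>\<theta> \<in> p. [a] \<in> realizations M 1 \<theta>))"

text \<open>
  ``Sufficiently saturated'' means \<open>\<kappa>\<close>-saturated for a cardinal \<open>\<kappa>\<close>
  exceeding the number of formulas of the language (hence uncountable); a set of parameters is
  small if it has fewer than \<open>\<kappa>\<close> elements.
\<close>

definition sufficiently_saturated ::
    "'k rel \<Rightarrow> ('f, 'r) language \<Rightarrow> ('a, 'f, 'r) struct \<Rightarrow> bool" where
  "sufficiently_saturated \<kappa> L M \<longleftrightarrow>
     Card_order \<kappa> \<and> |{\<phi>. wf_fm L \<phi>}| <o \<kappa> \<and> saturated \<kappa> L M"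

definition small :: "'k rel \<Rightarrow> ('a, 'f, 'r) struct \<Rightarrow> 'a set \<Rightarrow> bool" where
  "small \<kappa> M A \<longleftrightarrow> A \<subseteq> Univ M \<and> |A| <o \<kappa>"


section \<open>Dividing, forking, independence\<close>

definition indiscernible ::
    "('f, 'r) language \<Rightarrow> ('a, 'f, 'r) struct \<Rightarrow> 'a set \<Rightarrow> nat \<Rightarrow> (nat \<Rightarrow> 'a list) \<Rightarrow> bool" where
  "indiscernible L M C m b \<longleftrightarrow>
     (\<forall>k. b k \<in> tuples (Univ M) m) \<and>
     (\<forall>is js. sorted_wrt (<) is \<and> sorted_wrt (<) js \<and> length is = length js \<longrightarrow>
        tp L M (concat (map b is)) C = tp L M (concat (map b js)) C)"

definition divides ::
    "('f, 'r) language \<Rightarrow> ('a, 'f, 'r) struct \<Rightarrow> 'a set \<Rightarrow> nat \<Rightarrow> ('a, 'f, 'r) pfm \<Rightarrow> bool" where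
  "divides L M C n \<theta> \<longleftrightarrow>
     (\<exists>b. indiscernible L M C (length (snd \<theta>)) b \<and> b 0 = snd \<theta> \<and>
        (\<Inter>k. realizations M n (fst \<theta>, b k)) = {})"

definition forks ::
    "('f, 'r) language \<Rightarrow> ('a, 'f, 'r) struct \<Rightarrow> 'a set \<Rightarrow> nat \<Rightarrow> ('a, 'f, 'r) pfm \<Rightarrow> bool" where
  "forks L M C n \<theta> \<longleftrightarrow>
     (\<exists>\<Psi>. finite \<Psi> \<and> \<Psi> \<subseteq> pformulas L (Univ M) n \<and> (\<forall>\<psi> \<in> \<Psi>. divides L M C n \<psi>) \<and>
        realizations M n \<theta> \<subseteq> (\<Union>\<psi> \<in> \<Psi>. realizations M n \<psi>))"

text \<open>
  For an arbitrary set \<open>A\<close>, each formula of \<open>tp(A/B\<union>C)\<close> involves only a finite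
  tuple of elements of \<open>A\<close>.
\<close>

definition independent ::
    "('f, 'r) language \<Rightarrow> ('a, 'f, 'r) struct \<Rightarrow> 'a set \<Rightarrow> 'a set \<Rightarrow> 'a set \<Rightarrow> bool" where
  "independent L M A C B \<longleftrightarrow>
     (\<forall>as. set as \<subseteq> A \<longrightarrow> (\<forall>\<theta> \<in> tp L M as (B \<union> C). \<not> forks L M C (length as) \<theta>))"

text \<open>A type is algebraic if it contains an algebraic formula.\<close>

definition generic ::
    "('f, 'r) language \<Rightarrow> ('a, 'f, 'r) struct \<Rightarrow> 'a set \<Rightarrow> 'a \<Rightarrow> bool" where
  "generic L M A g \<longleftrightarrow> (\<forall>\<theta> \<in> tp L M [g] A. infinite (realizations M 1 \<theta>))"

text \<open>Evaluated in a sufficiently saturated model \<open>M\<close> of the complete theory in question.\<close>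

definition supersimple_rank_1 :: "('f, 'r) language \<Rightarrow> ('a, 'f, 'r) struct \<Rightarrow> bool" where
  "supersimple_rank_1 L M \<longleftrightarrow>
     (\<forall>\<theta> \<in> pformulas L (Univ M) 1. divides L M {} 1 \<theta> \<longrightarrow> finite (realizations M 1 \<theta>))"


section \<open>Supersimple groups of rank 1\<close>

definition supersimple_group_rank_1 ::
    "'k rel \<Rightarrow> ('f, 'r) language \<Rightarrow> ('f, 'r) fm set \<Rightarrow> ('a, 'f, 'r) struct \<Rightarrow> ('a, 'b) monoid_scheme
      \<Rightarrow> bool" where
  "supersimple_group_rank_1 \<kappa> L T M G \<longleftrightarrow>
     complete_theory L T \<and> is_model L T M \<and> sufficiently_saturated \<kappa> L M \<and>
     supersimple_rank_1 L M \<and>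
     group G \<and> carrier G = Univ M \<and>
     definable_over L M {} 3 {[x, y, x \<otimes>\<^bsub>G\<^esub> y] | x y. x \<in> carrier G \<and> y \<in> carrier G} \<and>
     definable_over L M {} 2 {[x, inv\<^bsub>G\<^esub> x] | x. x \<in> carrier G}"

definition generically_distinct_squares ::
    "('f, 'r) language \<Rightarrow> ('a, 'f, 'r) struct \<Rightarrow> ('a, 'b) monoid_scheme \<Rightarrow> 'a set \<Rightarrow> 'a set \<Rightarrow> bool"
  where
  "generically_distinct_squares L M G A X \<longleftrightarrow>
     (\<forall>x \<in> X. \<forall>y \<in> X. generic L M A x \<and> generic L M A y \<and> independent L M {x} A {y} \<longrightarrow>
        x [^]\<^bsub>G\<^esub> (2::nat) \<noteq> y [^]\<^bsub>G\<^esub> (2::nat))"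

definition bad_initial_points :: "('a, 'b) monoid_scheme \<Rightarrow> 'a set \<Rightarrow> 'a set \<Rightarrow> 'a set" where
  "bad_initial_points G H X =
     {x \<in> X. finite {g \<in> H. x \<in> X \<and> x \<otimes>\<^bsub>G\<^esub> g \<in> X \<and> g \<otimes>\<^bsub>G\<^esub> x \<otimes>\<^bsub>G\<^esub> g \<in> X}}"

end

theory Submission
  imports Defs "HOL-Library.Ramsey"
begin

text \<open>
  For \<open>x \<in> X\<close> in a coset \<open>cH\<close>, put \<open>D = X \<inter> cH\<close> and let \<open>E\<close> be the set of
  squares of elements of \<open>D\<close>. The elements \<open>g = x\<^sup>-\<^sup>1y\<close> with \<open>y \<in> D\<close> and
  \<open>y\<^sup>2 \<in> xD\<close> witness that \<open>x\<close> is not bad, so it suffices that \<open>xD \<inter> E\<close> is infinite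
  for all but finitely many \<open>x \<in> D\<close>. The hypothesis on \<open>X\<close> makes squaring finite-to-one.

  Rank one yields that large members of a uniformly definable family of sets cannot be \<open>k\<close>-inconsistent. Hence the relation
  ``\<open>uD \<inter> aE\<close> is infinite'' between \<open>u\<close> and \<open>a\<close> is stable and invariant under left translation.
  Suppose that the set \<open>D\<^sub>0\<close> of all \<open>x \<in> D\<close> with \<open>xD \<inter> E\<close> finite is infinite. Take an
  ultrafilter \<open>r\<close> of generic elements of \<open>G\<close>; by stability, the set \<open>T\<close> of all \<open>u\<close> that
  are related to \<open>r\<close>-almost all \<open>a\<close> is definable. For \<open>r\<close>-almost all \<open>g\<close>, either
  \<open>gD\<^sub>0 \<inter> T\<close> is infinite, although no \<open>u \<in> gD\<^sub>0\<close> is related to \<open>g\<close>; or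
  infinitely many \<open>u = gx\<close> with \<open>x \<in> D\<^sub>0\<close> lie outside \<open>T\<close>. In the second case one keeps
  \<open>h = gx\<^sup>2\<close> fixed and chooses \<open>u = hz\<^sup>-\<^sup>1\<close> outside \<open>T\<close>, with \<open>z \<in>
  D\<^sub>0\<close>, generic over \<open>g\<close> and \<open>h\<close>; then \<open>u\<close> is related to \<open>g\<close>. Both cases
  contradict stability once they are realised for many \<open>g\<close> and the same \<open>u\<close>.
\<close>

section \<open>Definable predicates\<close>

text \<open>Rank one enters the group argument only as a finitary statement: among enough large
  enough members of a uniform family, \<open>k\<close> share a point. In place of a calculus of
  independence, each genericity argument there is an exchange by counting: a point common to many
  sets with distinct indices yields many distinct elements of a set attached to that point, and a
  uniform bound makes that set infinite. Only uniformly definable families can be treated this way,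
  hence the need for \<open>T\<close> to be definable.

  That \<open>u = gx\<close> lies outside \<open>T\<close> contradicts nothing by itself, since
  \<open>x\<close> is bad and \<open>u\<close> is indeed unrelated to \<open>g\<close>. Squares
  break the tie. With \<open>h = gx\<^sup>2\<close> and \<open>u = hz\<^sup>-\<^sup>1\<close>, the
  element \<open>g\<^sup>-\<^sup>1u = x\<^sup>2z\<^sup>-\<^sup>1\<close> translates \<open>D\<close>
  to a set containing the square \<open>x\<^sup>2\<close>; for all but finitely many squares and
  then almost every \<open>z\<close>, the translate contains infinitely many squares. Moreover
  \<open>gx = hx\<^sup>-\<^sup>1\<close>, so \<open>h\<close> remembers that products with inverses
  of bad elements fall outside \<open>T\<close>. This allows \<open>x\<close> to be exchanged for
  another bad \<open>z\<close>.\<close>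

primrec ren_tm :: "(nat \<Rightarrow> nat) \<Rightarrow> 'f tm \<Rightarrow> 'f tm" where
  "ren_tm f (Var i) = Var (f i)"
| "ren_tm f (Fn g ts) = Fn g (map (ren_tm f) ts)"

text \<open>Bound variables are renamed together with free ones. Capture is excluded only for
  injective \<open>f\<close>; arbitrary substitutions are handled semantically in
  \<open>dpred_subst\<close>.\<close>

primrec ren_fm :: "(nat \<Rightarrow> nat) \<Rightarrow> ('f, 'r) fm \<Rightarrow> ('f, 'r) fm" where
  "ren_fm f (Eql s t) = Eql (ren_tm f s) (ren_tm f t)"
| "ren_fm f (Rel r ts) = Rel r (map (ren_tm f) ts)"
| "ren_fm f (Neg \<phi>) = Neg (ren_fm f \<phi>)"
| "ren_fm f (Conj \<phi> \<psi>) = Conj (ren_fm f \<phi>) (ren_fm f \<psi>)"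
| "ren_fm f (Exi i \<phi>) = Exi (f i) (ren_fm f \<phi>)"

lemma wf_ren_tm: "wf_tm L (ren_tm f t) = wf_tm L t"
  by (induction t) (auto simp: list_all_iff)

lemma wf_ren_fm: "wf_fm L (ren_fm f \<phi>) = wf_fm L \<phi>"
  by (induction \<phi>) (auto simp: wf_ren_tm)

lemma eval_ren_tm: "eval_tm M e (ren_tm f t) = eval_tm M (e \<circ> f) t"
  by (induction t) (auto simp: comp_def intro!: arg_cong[where f = "FunI M _"])

lemma sat_ren_fm: "inj f \<Longrightarrow> sat M e (ren_fm f \<phi>) = sat M (e \<circ> f) \<phi>"
proof (induction \<phi> arbitrary: e)
  case (Exi i \<phi>)
  have "e(f i := a) \<circ> f = (e \<circ> f)(i := a)" for a
    using Exi.prems by (auto simp: inj_eq)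
  then show ?case using Exi by (simp del: fun_upd_apply o_apply)
qed (auto simp: eval_ren_tm comp_def)

lemma eval_tm_cong: "(\<And>i. i \<in> tm_vars t \<Longrightarrow> e i = e' i) \<Longrightarrow> eval_tm M e t = eval_tm M e' t"
proof (induction t)
  case (Fn f ts)
  have "eval_tm M e t = eval_tm M e' t" if "t \<in> set ts" for t
    by (rule Fn.IH) (use that Fn.prems in auto)
  then show ?case by (simp cong: map_cong)
qed simp

lemma sat_cong: "(\<And>i. i \<in> free_vars \<phi> \<Longrightarrow> e i = e' i) \<Longrightarrow> sat M e \<phi> = sat M e' \<phi>"
proof (induction \<phi> arbitrary: e e')
  case (Eql s t)
  then show ?case using eval_tm_cong[of s e e' M] eval_tm_cong[of t e e' M] by auto
next
  case (Rel r ts)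
  then have "map (eval_tm M e) ts = map (eval_tm M e') ts"
    by (auto intro!: eval_tm_cong)
  then show ?case by (simp only: sat.simps)
next
  case (Exi i \<phi>)
  have "sat M (e(i := a)) \<phi> = sat M (e'(i := a)) \<phi>" for a
    by (rule Exi.IH) (use Exi.prems in auto)
  then show ?case by simp
next
  case (Neg \<phi>)
  have "sat M e \<phi> = sat M e' \<phi>"
    by (rule Neg.IH) (use Neg.prems in auto)
  then show ?case by simp
next
  case (Conj \<phi> \<psi>)
  have "sat M e \<phi> = sat M e' \<phi>" "sat M e \<psi> = sat M e' \<psi>"
    by (rule Conj.IH; use Conj.prems in auto)+
  then show ?case by simp
qed

section \<open>Quantifying out finitely many variables\<close>

lemma finite_tm_vars: "finite (tm_vars t)"
  by (induction t) auto

lemma finite_free_vars: "finite (free_vars \<phi>)"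
  by (induction \<phi>) (auto simp: finite_tm_vars)

text \<open>Iterates \<open>Exi\<close> over \<open>J\<close>. Speaking of a changed assignment
  \<open>e'\<close> avoids nested updates, and the exact set of free variables makes it possible to
  remove stray variables later.\<close>

lemma exists_closure:
  assumes "finite J" and "wf_fm L \<phi>"
  shows "\<exists>\<psi>. wf_fm L \<psi> \<and> free_vars \<psi> = free_vars \<phi> - J \<and>
    (\<forall>e. range e \<subseteq> Univ M \<longrightarrow>
      sat M e \<psi> = (\<exists>e'. range e' \<subseteq> Univ M \<and> (\<forall>i. i \<notin> J \<longrightarrow> e' i = e i) \<and> sat M e' \<phi>))"
  using assms(1)
proof (induction J)
  case empty
  have "(\<exists>e'. range e' \<subseteq> Univ M \<and> (\<forall>i. i \<notin> {} \<longrightarrow> e' i = e i) \<and> sat M e' \<phi>) = sat M e \<phi>"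
    if "range e \<subseteq> Univ M" for e
    using that by (metis empty_iff ext)
  then show ?case using assms(2) by (intro exI[of _ \<phi>]) auto
next
  case (insert j J)
  then obtain \<psi> where \<psi>: "wf_fm L \<psi>" "free_vars \<psi> = free_vars \<phi> - J"
    "\<And>e. range e \<subseteq> Univ M \<Longrightarrow>
      sat M e \<psi> = (\<exists>e'. range e' \<subseteq> Univ M \<and> (\<forall>i. i \<notin> J \<longrightarrow> e' i = e i) \<and> sat M e' \<phi>)"
    by blast
  have "sat M e (Exi j \<psi>) =
      (\<exists>e'. range e' \<subseteq> Univ M \<and> (\<forall>i. i \<notin> insert j J \<longrightarrow> e' i = e i) \<and> sat M e' \<phi>)"
    (is "?l = ?r") if e: "range e \<subseteq> Univ M" for e
  proof
    assume ?l
    then obtain a where a: "a \<in> Univ M" "sat M (e(j := a)) \<psi>" by auto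
    have "range (e(j := a)) \<subseteq> Univ M" using a e by auto
    then obtain e' where e': "range e' \<subseteq> Univ M" "\<forall>i. i \<notin> J \<longrightarrow> e' i = (e(j := a)) i" "sat M e' \<phi>"
      using \<psi>(3) a(2) by blast
    have "\<forall>i. i \<notin> insert j J \<longrightarrow> e' i = e i" using e'(2) by auto
    then show ?r using e'(1,3) by blast
  next
    assume ?r
    then obtain e' where e': "range e' \<subseteq> Univ M" "\<forall>i. i \<notin> insert j J \<longrightarrow> e' i = e i" "sat M e' \<phi>"
      by blast
    have "range (e(j := e' j)) \<subseteq> Univ M" using e e'(1) by auto
    moreover have "\<forall>i. i \<notin> J \<longrightarrow> e' i = (e(j := e' j)) i" using e'(2) by auto
    ultimately have "sat M (e(j := e' j)) \<psi>" using \<psi>(3) e'(1,3) by blast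
    then show ?l using e'(1) by auto
  qed
  then show ?case using \<psi>(1,2) by (intro exI[of _ "Exi j \<psi>"]) auto
qed

text \<open>Definability in semantic form, so that it can be proved by closure properties instead of
  by writing formulas. Parameters are simply further values of the assignment.\<close>

definition dpred :: "('f, 'r) language \<Rightarrow> ('a, 'f, 'r) struct \<Rightarrow> ((nat \<Rightarrow> 'a) \<Rightarrow> bool) \<Rightarrow> bool" where
  "dpred L M P \<longleftrightarrow> (\<exists>\<phi>. wf_fm L \<phi> \<and> (\<forall>e. range e \<subseteq> Univ M \<longrightarrow> sat M e \<phi> = P e))"

lemma dpred_cong:
  "dpred L M P \<Longrightarrow> (\<And>e. range e \<subseteq> Univ M \<Longrightarrow> P e = Q e) \<Longrightarrow> dpred L M Q"
  unfolding dpred_def by metis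

lemma dpred_sat: "wf_fm L \<phi> \<Longrightarrow> dpred L M (\<lambda>e. sat M e \<phi>)"
  unfolding dpred_def by auto

lemma dpred_eq: "dpred L M (\<lambda>e. e i = e j)"
  unfolding dpred_def by (rule exI[of _ "Eql (Var i) (Var j)"]) simp

lemma dpred_True: "dpred L M (\<lambda>e. True)"
  using dpred_eq[of L M 0 0] by simp

lemma dpred_neg: "dpred L M P \<Longrightarrow> dpred L M (\<lambda>e. \<not> P e)"
  unfolding dpred_def by (metis sat.simps(3) wf_fm.simps(3))

lemma dpred_conj: "dpred L M P \<Longrightarrow> dpred L M Q \<Longrightarrow> dpred L M (\<lambda>e. P e \<and> Q e)"
  unfolding dpred_def by (metis sat.simps(4) wf_fm.simps(4))

lemma dpred_iff: "dpred L M P \<Longrightarrow> dpred L M Q \<Longrightarrow> dpred L M (\<lambda>e. P e \<longleftrightarrow> Q e)"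
  by (rule dpred_cong[OF dpred_conj[OF
        dpred_neg[OF dpred_conj[of L M P "\<lambda>e. \<not> Q e"]] dpred_neg[OF dpred_conj[of L M Q "\<lambda>e. \<not> P e"]]]])
     (auto intro: dpred_neg)

lemma dpred_ex: "dpred L M P \<Longrightarrow> dpred L M (\<lambda>e. \<exists>a\<in>Univ M. P (e(i := a)))"
proof -
  assume "dpred L M P"
  then obtain \<phi> where \<phi>: "wf_fm L \<phi>" "\<And>e. range e \<subseteq> Univ M \<Longrightarrow> sat M e \<phi> = P e"
    unfolding dpred_def by auto
  have "sat M (e(i := a)) \<phi> = P (e(i := a))" if "range e \<subseteq> Univ M" "a \<in> Univ M" for e a
    by (rule \<phi>(2)) (use that in auto)
  then have "sat M e (Exi i \<phi>) = (\<exists>a\<in>Univ M. P (e(i := a)))" if "range e \<subseteq> Univ M" for e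
    using that by auto
  then show ?thesis unfolding dpred_def using \<phi>(1) by (intro exI[of _ "Exi i \<phi>"]) simp
qed

lemma dpred_ball_finite:
  "finite I \<Longrightarrow> (\<And>i. i \<in> I \<Longrightarrow> dpred L M (P i)) \<Longrightarrow> dpred L M (\<lambda>e. \<forall>i\<in>I. P i e)"
proof (induction I rule: finite_induct)
  case empty
  then show ?case using dpred_True by simp
next
  case (insert i I)
  then have "dpred L M (\<lambda>e. P i e \<and> (\<forall>i\<in>I. P i e))" by (intro dpred_conj) auto
  then show ?case by simp
qed

lemma dpred_inj: "dpred L M P \<Longrightarrow> inj f \<Longrightarrow> dpred L M (\<lambda>e. P (e \<circ> f))"
proof -
  assume "dpred L M P" "inj f"
  then obtain \<phi> where \<phi>: "wf_fm L \<phi>" "\<And>e. range e \<subseteq> Univ M \<Longrightarrow> sat M e \<phi> = P e"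
    unfolding dpred_def by auto
  have "sat M e (ren_fm f \<phi>) = P (e \<circ> f)" if "range e \<subseteq> Univ M" for e
    unfolding sat_ren_fm[OF \<open>inj f\<close>] by (rule \<phi>(2)) (use that in auto)
  then show ?thesis unfolding dpred_def using \<phi>(1) wf_ren_fm by blast
qed

text \<open>Semantic counterpart of having all free variables below \<open>n\<close>;
  \<open>dpred_formula\<close> turns it back into the syntactic condition.\<close>

definition depends :: "('a, 'f, 'r) struct \<Rightarrow> nat \<Rightarrow> ((nat \<Rightarrow> 'a) \<Rightarrow> bool) \<Rightarrow> bool" where
  "depends M n P \<longleftrightarrow> (\<forall>e e'. range e \<subseteq> Univ M \<longrightarrow> range e' \<subseteq> Univ M \<longrightarrow> (\<forall>i<n. e i = e' i) \<longrightarrow> P e = P e')"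

lemma dependsD:
  "depends M n P \<Longrightarrow> range e \<subseteq> Univ M \<Longrightarrow> range e' \<subseteq> Univ M \<Longrightarrow> (\<And>i. i < n \<Longrightarrow> e i = e' i) \<Longrightarrow> P e = P e'"
  unfolding depends_def by blast

lemma depends_mono: "depends M n P \<Longrightarrow> n \<le> m \<Longrightarrow> depends M m P"
  unfolding depends_def by (meson order_less_le_trans)

lemma free_vars_bound: "\<exists>n. free_vars \<phi> \<subseteq> {..<n}"
  using finite_nat_iff_bounded finite_free_vars by blast

lemma depends_sat: "free_vars \<phi> \<subseteq> {..<n} \<Longrightarrow> depends M n (\<lambda>e. sat M e \<phi>)"
  unfolding depends_def by (metis sat_cong lessThan_iff subsetD)

lemma dpred_depends:
  assumes "dpred L M P"
  obtains n where "depends M n P"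
proof -
  obtain \<phi> where \<phi>: "wf_fm L \<phi>" "\<And>e. range e \<subseteq> Univ M \<Longrightarrow> sat M e \<phi> = P e"
    using assms unfolding dpred_def by auto
  obtain n where "free_vars \<phi> \<subseteq> {..<n}" using free_vars_bound by blast
  then have "depends M n (\<lambda>e. sat M e \<phi>)" by (rule depends_sat)
  then have "depends M n P" using \<phi>(2) unfolding depends_def by blast
  then show thesis by (rule that)
qed

text \<open>Although infinitely many coordinates are quantified, \<open>P\<close> reads only those
  below some \<open>m\<close>, so quantifying over \<open>{n..<m}\<close> suffices.\<close>

lemma dpred_exs:
  assumes "dpred L M P"
  shows "dpred L M (\<lambda>e. \<exists>e'. range e' \<subseteq> Univ M \<and> (\<forall>i<n. e' i = e i) \<and> P e')"
proof -
  obtain \<phi> where \<phi>: "wf_fm L \<phi>" "\<And>e. range e \<subseteq> Univ M \<Longrightarrow> sat M e \<phi> = P e"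
    using assms unfolding dpred_def by auto
  obtain m where m: "depends M m P" using assms dpred_depends by blast
  obtain \<psi> where \<psi>: "wf_fm L \<psi>" "\<And>e. range e \<subseteq> Univ M \<Longrightarrow>
      sat M e \<psi> = (\<exists>e'. range e' \<subseteq> Univ M \<and> (\<forall>i. i \<notin> {n..<m} \<longrightarrow> e' i = e i) \<and> sat M e' \<phi>)"
    using exists_closure[OF finite_atLeastLessThan \<phi>(1), of n m M] by blast
  have "sat M e \<psi> = (\<exists>e'. range e' \<subseteq> Univ M \<and> (\<forall>i<n. e' i = e i) \<and> P e')" (is "_ = ?r")
    if e: "range e \<subseteq> Univ M" for e
  proof
    assume "sat M e \<psi>"
    then show ?r using \<psi>(2)[OF e] \<phi>(2) by (metis atLeastLessThan_iff not_le)
  next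
    assume ?r
    then obtain e' where e': "range e' \<subseteq> Univ M" "\<forall>i<n. e' i = e i" "P e'" by blast
    define e'' where "e'' = (\<lambda>i. if i \<in> {n..<m} then e' i else e i)"
    have r: "range e'' \<subseteq> Univ M" using e e'(1) unfolding e''_def by auto
    have "P e''"
    proof -
      have "e' i = e'' i" if "i < m" for i using e'(2) that unfolding e''_def by auto
      then show ?thesis using dependsD[OF m e'(1) r] e'(3) by blast
    qed
    moreover have "\<forall>i. i \<notin> {n..<m} \<longrightarrow> e'' i = e i" unfolding e''_def by simp
    ultimately show "sat M e \<psi>" using \<psi>(2)[OF e] \<phi>(2)[OF r] r by blast
  qed
  then show ?thesis unfolding dpred_def using \<psi>(1) by blast
qed

text \<open>Stray free variables from \<open>n\<close> on are bound existentially; this changes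
  nothing, because the truth value does not depend on them.\<close>

lemma dpred_formula:
  assumes "dpred L M P" and dep: "depends M n P"
  obtains \<phi> where "\<phi> \<in> formulas L n" "\<And>e. range e \<subseteq> Univ M \<Longrightarrow> sat M e \<phi> = P e"
proof -
  obtain \<phi> where \<phi>: "wf_fm L \<phi>" "\<And>e. range e \<subseteq> Univ M \<Longrightarrow> sat M e \<phi> = P e"
    using assms unfolding dpred_def by auto
  have "finite (free_vars \<phi> - {..<n})" by (simp add: finite_free_vars)
  from exists_closure[OF this \<phi>(1), of M] obtain \<psi> where \<psi>: "wf_fm L \<psi>"
      "free_vars \<psi> = free_vars \<phi> - (free_vars \<phi> - {..<n})"
      "\<And>e. range e \<subseteq> Univ M \<Longrightarrow>
      sat M e \<psi> = (\<exists>e'. range e' \<subseteq> Univ M \<and> (\<forall>i. i \<notin> free_vars \<phi> - {..<n} \<longrightarrow> e' i = e i) \<and> sat M e' \<phi>)"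
    by blast
  have "\<psi> \<in> formulas L n" using \<psi>(1,2) unfolding formulas_def by auto
  moreover have "sat M e \<psi> = P e" if e: "range e \<subseteq> Univ M" for e
  proof
    assume "sat M e \<psi>"
    then obtain e' where e': "range e' \<subseteq> Univ M" "\<forall>i. i \<notin> free_vars \<phi> - {..<n} \<longrightarrow> e' i = e i" "sat M e' \<phi>"
      using \<psi>(3)[OF e] by blast
    then have "P e'" "\<And>i. i < n \<Longrightarrow> e' i = e i" using \<phi>(2) by auto
    then show "P e" using dependsD[OF dep e'(1) e] by blast
  next
    assume "P e"
    then show "sat M e \<psi>" using \<psi>(3)[OF e] \<phi>(2)[OF e] e by blast
  qed
  ultimately show thesis by (rule that)
qed

text \<open>As \<open>f\<close> may identify variables, formulas are not renamed along it. The
  variables of \<open>P\<close> get copies shifted beyond all relevant values of \<open>f\<close>,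
  the copies are equated with the variables they stand for, and then they are quantified
  away.\<close>

lemma dpred_subst:
  fixes P :: "(nat \<Rightarrow> 'a) \<Rightarrow> bool"
  assumes "dpred L M P"
  shows "dpred L M (\<lambda>e. P (e \<circ> f))"
proof -
  obtain n where n: "depends M n P" using assms dpred_depends by blast
  obtain K where K: "\<And>i. i < n \<Longrightarrow> f i < K"
    using finite_nat_set_iff_bounded[of "f ` {..<n}"] by auto
  have "dpred L M (\<lambda>e. P (e \<circ> (\<lambda>i. i + K)))"
    using assms by (rule dpred_inj) (auto simp: inj_def)
  moreover have "dpred L M (\<lambda>e. \<forall>i\<in>{..<n}. e (i + K) = e (f i))"
    by (intro dpred_ball_finite dpred_eq) auto
  ultimately have D: "dpred L M (\<lambda>e. \<exists>e'. range e' \<subseteq> Univ M \<and> (\<forall>i<K. e' i = e i) \<and>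
      (\<forall>i\<in>{..<n}. e' (i + K) = e' (f i)) \<and> P (e' \<circ> (\<lambda>i. i + K)))"
    by (intro dpred_exs dpred_conj)
  show ?thesis
  proof (rule dpred_cong[OF D])
    fix e :: "nat \<Rightarrow> 'a"
    assume e: "range e \<subseteq> Univ M"
    then have ef: "range (e \<circ> f) \<subseteq> Univ M" by auto
    show "(\<exists>e'. range e' \<subseteq> Univ M \<and> (\<forall>i<K. e' i = e i) \<and>
      (\<forall>i\<in>{..<n}. e' (i + K) = e' (f i)) \<and> P (e' \<circ> (\<lambda>i. i + K))) = P (e \<circ> f)" (is "?l = ?r")
    proof
      assume ?l
      then obtain e' where e': "range e' \<subseteq> Univ M" "\<forall>i<K. e' i = e i"
        "\<forall>i\<in>{..<n}. e' (i + K) = e' (f i)" "P (e' \<circ> (\<lambda>i. i + K))" by blast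
      have r: "range (e' \<circ> (\<lambda>i. i + K)) \<subseteq> Univ M" using e'(1) by auto
      have "(e' \<circ> (\<lambda>i. i + K)) i = (e \<circ> f) i" if "i < n" for i
        using e'(2,3) K that by auto
      then show ?r using dependsD[OF n r ef] e'(4) by blast
    next
      assume p: ?r
      define e' where "e' = (\<lambda>i. if i < K then e i else e (f (i - K)))"
      have r: "range e' \<subseteq> Univ M" using e unfolding e'_def by auto
      have "e' \<circ> (\<lambda>i. i + K) = e \<circ> f" unfolding e'_def by auto
      then have "P (e' \<circ> (\<lambda>i. i + K))" using p by simp
      moreover have "\<forall>i\<in>{..<n}. e' (i + K) = e' (f i)" using K unfolding e'_def by auto
      moreover have "\<forall>i<K. e' i = e i" unfolding e'_def by auto
      ultimately show ?l using r by blast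
    qed
  qed
qed

lemma dpred_count:
  fixes P :: "(nat \<Rightarrow> 'a) \<Rightarrow> bool"
  shows "dpred L M P \<Longrightarrow>
   dpred L M (\<lambda>e. \<exists>S\<subseteq>Univ M. finite S \<and> card S = n \<and> (\<forall>a\<in>S. P (e(i := a))))"
proof (induction n arbitrary: P)
  case 0
  show ?case by (rule dpred_cong[OF dpred_True]) (auto intro: exI[of _ "{}"])
next
  case (Suc n)
  obtain m where m: "depends M m P" using Suc.prems dpred_depends by blast
  \<comment> \<open>A variable that \<open>P\<close> does not read: it holds one element of the set,
    and the other \<open>n\<close> elements are those counted for \<open>P\<close> and distinctness
    from it.\<close>
  define j where "j = Suc (max i m)"
  have j: "j \<noteq> i" "m < j" unfolding j_def by auto
  have 1: "dpred L M (\<lambda>e. P e \<and> e i \<noteq> e j)"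
    by (intro dpred_conj dpred_neg dpred_eq Suc.prems)
  have 2: "dpred L M (\<lambda>e. P (e \<circ> id(i := j)))"
    using Suc.prems by (rule dpred_subst)
  note D = dpred_ex[OF dpred_conj[OF 2 Suc.IH[OF 1]], of j]
  show ?case
  proof (rule dpred_cong[OF D])
    fix e :: "nat \<Rightarrow> 'a"
    assume e: "range e \<subseteq> Univ M"
    have P1: "P (e(j := b) \<circ> id(i := j)) = P (e(i := b))" if "b \<in> Univ M" for b
    proof (rule dependsD[OF m])
      fix k assume "k < m"
      then show "(e(j := b) \<circ> id(i := j)) k = (e(i := b)) k" using j by auto
    qed (use e that in auto)
    have P2: "P (e(j := b, i := a)) = P (e(i := a))" if "a \<in> Univ M" "b \<in> Univ M" for a b
    proof (rule dependsD[OF m])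
      fix k assume "k < m"
      then show "(e(j := b, i := a)) k = (e(i := a)) k" using j by auto
    qed (use e that in auto)
    have "(\<exists>b\<in>Univ M. P (e(j := b) \<circ> id(i := j)) \<and> (\<exists>S\<subseteq>Univ M. finite S \<and> card S = n \<and>
        (\<forall>a\<in>S. P (e(j := b, i := a)) \<and> (e(j := b, i := a)) i \<noteq> (e(j := b, i := a)) j)))
      = (\<exists>b\<in>Univ M. P (e(i := b)) \<and> (\<exists>S\<subseteq>Univ M. finite S \<and> card S = n \<and>
        (\<forall>a\<in>S. P (e(i := a)) \<and> a \<noteq> b)))"
      using j(1) P1 P2 by (intro bex_cong conj_cong ex_cong1 ball_cong refl) (auto simp: subset_iff)
    also have "\<dots> = (\<exists>S\<subseteq>Univ M. finite S \<and> card S = Suc n \<and> (\<forall>a\<in>S. P (e(i := a))))"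
      (is "?l = ?r")
    proof
      assume ?l
      then obtain b S where "b \<in> Univ M" "P (e(i := b))" "S \<subseteq> Univ M" "finite S" "card S = n"
        "\<forall>a\<in>S. P (e(i := a)) \<and> a \<noteq> b" by blast
      then show ?r by (intro exI[of _ "insert b S"]) (auto simp: card_insert_if)
    next
      assume ?r
      then obtain S where S: "S \<subseteq> Univ M" "finite S" "card S = Suc n" "\<forall>a\<in>S. P (e(i := a))" by blast
      then obtain b where b: "b \<in> S" by fastforce
      then show ?l using S
        by (intro bexI[of _ b] conjI exI[of _ "S - {b}"]) auto
    qed
    finally show "(\<exists>b\<in>Univ M. P (e(j := b) \<circ> id(i := j)) \<and> (\<exists>S\<subseteq>Univ M. finite S \<and> card S = n \<and>
        (\<forall>a\<in>S. P (e(j := b, i := a)) \<and> (e(j := b, i := a)) i \<noteq> (e(j := b, i := a)) j))) = ?r" .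
  qed
qed

section \<open>Compactness in a saturated structure\<close>

lemma range_case_nat: "x \<in> U \<Longrightarrow> range e \<subseteq> U \<Longrightarrow> range (case_nat x e) \<subseteq> U"
  by (force split: nat.splits)

text \<open>The prefixed value is stored at a position that \<open>P\<close> does not reach, so it
  can be quantified or counted there while the other values keep their places.\<close>

lemma dpred_case_nat:
  fixes P :: "(nat \<Rightarrow> 'a) \<Rightarrow> bool"
  assumes "dpred L M P"
  obtains Q K where "dpred L M Q"
    "\<And>e x. range e \<subseteq> Univ M \<Longrightarrow> x \<in> Univ M \<Longrightarrow> Q (e(K := x)) = P (case_nat x e)"
proof -
  obtain n where n: "depends M n P" using assms dpred_depends by blast
  have "dpred L M (\<lambda>e. P (e \<circ> case_nat n id))" using assms by (rule dpred_subst)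
  moreover have "P (e(n := x) \<circ> case_nat n id) = P (case_nat x e)"
    if "range e \<subseteq> Univ M" "x \<in> Univ M" for e :: "nat \<Rightarrow> 'a" and x
  proof (rule dependsD[OF n])
    fix i assume "i < n"
    then show "(e(n := x) \<circ> case_nat n id) i = case_nat x e i" by (auto split: nat.split)
  next
    show "range (e(n := x) \<circ> case_nat n id) \<subseteq> Univ M" using that by auto
  next
    show "range (case_nat x e) \<subseteq> Univ M" using that(2,1) by (rule range_case_nat)
  qed
  ultimately show thesis by (rule that)
qed

lemma dpred_ex_case:
  assumes "dpred L M P"
  shows "dpred L M (\<lambda>e. \<exists>x\<in>Univ M. P (case_nat x e))"
proof -
  obtain Q K where QK: "dpred L M Q"
    "\<And>e x. range e \<subseteq> Univ M \<Longrightarrow> x \<in> Univ M \<Longrightarrow> Q (e(K := x)) = P (case_nat x e)"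
    using dpred_case_nat[OF assms] by blast
  show ?thesis
    by (rule dpred_cong[OF dpred_ex[OF QK(1), of K]]) (intro bex_cong refl QK(2))
qed

definition at_least :: "nat \<Rightarrow> 'a set \<Rightarrow> bool" where
  "at_least n C \<longleftrightarrow> (\<exists>S\<subseteq>C. finite S \<and> card S = n)"

lemma at_least_iff: "at_least n C \<longleftrightarrow> infinite C \<or> n \<le> card C"
  unfolding at_least_def
  by (metis card_mono infinite_arbitrarily_large obtain_subset_with_card_n)

lemma dpred_at_least_case:
  fixes P :: "(nat \<Rightarrow> 'a) \<Rightarrow> bool"
  assumes "dpred L M P"
  shows "dpred L M (\<lambda>e. at_least n {x \<in> Univ M. P (case_nat x e)})"
proof -
  obtain Q K where KQ: "dpred L M Q"
    "\<And>e x. range e \<subseteq> Univ M \<Longrightarrow> x \<in> Univ M \<Longrightarrow> Q (e(K := x)) = P (case_nat x e)"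
    using dpred_case_nat[OF assms] by blast
  show ?thesis
  proof (rule dpred_cong[OF dpred_count[OF KQ(1), of n K]])
    fix e :: "nat \<Rightarrow> 'a" assume e: "range e \<subseteq> Univ M"
    show "(\<exists>S\<subseteq>Univ M. finite S \<and> card S = n \<and> (\<forall>a\<in>S. Q (e(K := a)))) =
        at_least n {x \<in> Univ M. P (case_nat x e)}"
      unfolding at_least_def using KQ(2)[OF e]
      by (intro ex_cong1) (auto simp: subset_iff)
  qed
qed

text \<open>Position \<open>0\<close> holds an element and \<open>f\<close> selects its parameters;
  a single assignment can thus store the parameters of many sets.\<close>

lemma dpred_block:
  assumes "dpred L M P"
  shows "dpred L M (\<lambda>e. P (case_nat (e 0) (\<lambda>j. e (Suc (f j)))))"
proof -
  have "P (e \<circ> case_nat 0 (\<lambda>j. Suc (f j))) = P (case_nat (e 0) (\<lambda>j. e (Suc (f j))))" for e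
    by (rule arg_cong[where f = P]) (auto split: nat.split)
  with dpred_subst[OF assms, of "case_nat 0 (\<lambda>j. Suc (f j))"] show ?thesis
    by (rule dpred_cong)
qed

lemma holds_eq_sat:
  assumes "\<phi> \<in> formulas L (length as)" "\<And>i. i < length as \<Longrightarrow> e i = as ! i"
  shows "holds M \<phi> as = sat M e \<phi>"
  unfolding holds_def by (rule sat_cong) (use assms in \<open>auto simp: formulas_def\<close>)

lemma concat_nth_uniform:
  assumes "\<And>x. length (b x) = m" "v < m * length xs"
  shows "concat (map b xs) ! v = b (xs ! (v div m)) ! (v mod m)"
  using assms(2)
proof (induction xs arbitrary: v)
  case (Cons x xs)
  show ?case
  proof (cases "v < m")
    case True
    then show ?thesis using assms(1) by (simp add: nth_append)
  next
    case False
    moreover have "0 < m" using Cons.prems by (cases m) auto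
    ultimately have "0 < m" "m \<le> v" "v - m < m * length xs" using Cons.prems by auto
    then show ?thesis using assms(1) Cons.IH[of "v - m"]
      by (simp add: nth_append le_div_geq le_mod_geq)
  qed
qed simp

section \<open>Ramsey's theorem for increasing index lists\<close>

definition homogeneous :: "(nat list \<Rightarrow> bool) \<Rightarrow> nat \<Rightarrow> nat set \<Rightarrow> bool" where
  "homogeneous c r Y \<longleftrightarrow> (\<forall>is js. sorted_wrt (<) is \<longrightarrow> sorted_wrt (<) js \<longrightarrow>
    set is \<subseteq> Y \<longrightarrow> set js \<subseteq> Y \<longrightarrow> length is = r \<longrightarrow> length js = r \<longrightarrow> c is = c js)"

lemma homogeneous_mono: "homogeneous c r Y \<Longrightarrow> Z \<subseteq> Y \<Longrightarrow> homogeneous c r Z"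
  unfolding homogeneous_def by (intro allI impI) (metis (no_types) subset_trans)

lemma Ramsey_lists:
  assumes "infinite Y"
  shows "\<exists>Z\<subseteq>Y. infinite Z \<and> homogeneous c r Z"
proof -
  let ?f = "\<lambda>X. if c (sorted_list_of_set X) then 1 else (0::nat)"
  have "\<forall>X. X \<subseteq> Y \<and> finite X \<and> card X = r \<longrightarrow> ?f X < 2" by simp
  from Ramsey[OF assms this] obtain Z q where
    Z: "Z \<subseteq> Y" "infinite Z" "\<forall>X. X \<subseteq> Z \<and> finite X \<and> card X = r \<longrightarrow> ?f X = q"
    by blast
  have "c is = c js" if "sorted_wrt (<) is" "sorted_wrt (<) js" "set is \<subseteq> Z" "set js \<subseteq> Z"
    "length is = r" "length js = r" for "is" js
  proof -
    have *: "?f (set ks) = q \<and> sorted_list_of_set (set ks) = ks"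
      if "sorted_wrt (<) ks" "set ks \<subseteq> Z" "length ks = r" for ks
    proof
      have "card (set ks) = r" using that by (simp add: strict_sorted_iff distinct_card)
      then show "?f (set ks) = q" using Z(3) that(2) by blast
      show "sorted_list_of_set (set ks) = ks"
        using that(1) by (simp add: strict_sorted_iff sorted_list_of_set.idem_if_sorted_distinct)
    qed
    have "?f (set is) = ?f (set js)" using * that by (metis (no_types, lifting))
    then have "c (sorted_list_of_set (set is)) = c (sorted_list_of_set (set js))"
      by (auto split: if_splits)
    then show ?thesis using * that by metis
  qed
  then have "homogeneous c r Z" unfolding homogeneous_def by blast
  then show ?thesis using Z(1,2) by blast
qed

lemma Ramsey_lists_finite:
  assumes "finite T"
  shows "\<exists>Y. infinite Y \<and> (\<forall>t\<in>T. homogeneous (c t) (r t) Y)"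
  using assms
proof (induction T)
  case empty
  show ?case using infinite_UNIV_nat by blast
next
  case (insert t T)
  then obtain Y where Y: "infinite Y" "\<forall>t\<in>T. homogeneous (c t) (r t) Y" by blast
  obtain Z where "Z \<subseteq> Y" "infinite Z" "homogeneous (c t) (r t) Z"
    using Ramsey_lists[OF Y(1)] by blast
  then show ?case using Y(2) homogeneous_mono by (metis insert_iff)
qed

locale saturated_structure =
  fixes \<kappa> :: "'k rel" and L :: "('f, 'r) language" and M :: "('a, 'f, 'r) struct"
  assumes Univ_nonempty: "Univ M \<noteq> {}"
    and saturation: "sufficiently_saturated \<kappa> L M"
begin

lemma infinite_formulas: "infinite {\<phi>. wf_fm L \<phi>}"
proof
  assume "finite {\<phi>. wf_fm L \<phi>}"
  moreover have "range (\<lambda>i. Eql (Var i) (Var i)) \<subseteq> {\<phi>. wf_fm L \<phi>}" by auto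
  ultimately have "finite (range (\<lambda>i. Eql (Var i) (Var i) :: ('f, 'r) fm))" using finite_subset by blast
  then show False by (rule notE[rotated], intro range_inj_infinite) (auto simp: inj_def)
qed

lemma finite_less_infinite: "finite A \<Longrightarrow> infinite B \<Longrightarrow> |A| <o |B|"
  using finite_ordLess_infinite[OF card_of_Well_order card_of_Well_order] by (simp add: Field_card_of)

lemma Card_order_bound: "Card_order \<kappa>"
  using saturation unfolding sufficiently_saturated_def by blast

lemma infinite_Field: "infinite (Field \<kappa>)"
proof
  assume "finite (Field \<kappa>)"
  then have "|Field \<kappa>| <o |{\<phi>. wf_fm L \<phi>}|" using infinite_formulas by (rule finite_less_infinite)
  moreover have "|{\<phi>. wf_fm L \<phi>}| <o |Field \<kappa>|"
    using saturation ordLess_ordIso_trans ordIso_symmetric[OF card_of_Field_ordIso]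
    unfolding sufficiently_saturated_def by blast
  ultimately show False using ordLess_transitive ordLess_irreflexive by blast
qed

lemma finite_small: "finite A \<Longrightarrow> |A| <o \<kappa>"
  using finite_less_infinite[OF _ infinite_Field] card_of_Field_ordIso[OF Card_order_bound]
    ordLess_ordIso_trans by blast

lemma small_union_finite: "|A| <o \<kappa> \<Longrightarrow> finite B \<Longrightarrow> |A \<union> B| <o \<kappa>"
  using card_of_Un_ordLess_infinite_Field[OF infinite_Field Card_order_bound] finite_small by blast

text \<open>Saturation speaks about one variable and fewer than \<open>\<kappa>\<close> parameters; choosing the
  values one after the other gives compactness for countably many variables.\<close>

lemma countable_compactness:
  fixes \<Gamma> :: "'t \<Rightarrow> ((nat \<Rightarrow> 'a) \<Rightarrow> bool) set"
  assumes dp: "\<And>t P. t \<in> T \<Longrightarrow> P \<in> \<Gamma> t \<Longrightarrow> dpred L M P"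
    and fin: "\<And>T0. finite T0 \<Longrightarrow> T0 \<subseteq> T \<Longrightarrow>
      \<exists>e. range e \<subseteq> Univ M \<and> (\<forall>t\<in>T0. \<forall>P\<in>\<Gamma> t. P e)"
  obtains e where "range e \<subseteq> Univ M" "\<And>t P. t \<in> T \<Longrightarrow> P \<in> \<Gamma> t \<Longrightarrow> P e"
proof -
  \<comment> \<open>Conditions come in packages \<open>\<Gamma> t\<close>, possibly infinite, of
    which finitely many are assumed to be jointly satisfiable. This suits Ramsey's theorem, where
    one homogeneous set settles infinitely many conditions at once.\<close>
  define \<Delta> where "\<Delta> = (\<Union>t\<in>T. \<Gamma> t)"
  define ext where "ext F n e \<longleftrightarrow> (\<exists>e'. range e' \<subseteq> Univ M \<and> (\<forall>i<n. e' i = e i) \<and> (\<forall>P\<in>F. P e'))"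
    for F n and e :: "nat \<Rightarrow> 'a"
  define good where "good n e \<longleftrightarrow> range e \<subseteq> Univ M \<and> (\<forall>F. finite F \<longrightarrow> F \<subseteq> \<Delta> \<longrightarrow> ext F n e)"
    for n and e :: "nat \<Rightarrow> 'a"
  have good0: "\<exists>e. good 0 e"
  proof -
    have "ext F 0 e" if F: "finite F" "F \<subseteq> \<Delta>" for F and e :: "nat \<Rightarrow> 'a"
    proof -
      have "\<forall>P\<in>F. \<exists>t\<in>T. P \<in> \<Gamma> t" using F(2) unfolding \<Delta>_def by auto
      then obtain t where t: "\<And>P. P \<in> F \<Longrightarrow> t P \<in> T \<and> P \<in> \<Gamma> (t P)" by metis
      then have "t ` F \<subseteq> T" by auto
      with fin[of "t ` F"] F(1) obtain e' where e': "range e' \<subseteq> Univ M" "\<forall>s\<in>t ` F. \<forall>P\<in>\<Gamma> s. P e'"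
        by auto
      then have "\<forall>P\<in>F. P e'" using t by auto
      with e'(1) show ?thesis unfolding ext_def by auto
    qed
    moreover obtain u where "u \<in> Univ M" using Univ_nonempty by blast
    ultimately show ?thesis unfolding good_def by (intro exI[of _ "\<lambda>_. u"]) auto
  qed
  have step: "\<exists>e'. good (Suc n) e' \<and> (\<forall>i<n. e' i = e i)" if g: "good n e" for n e
  proof -
    have e: "range e \<subseteq> Univ M" using g unfolding good_def by blast
    let ?params = "map e [0..<n]"
    \<comment> \<open>A unary formula reads its variable at position \<open>0\<close> and the
      parameters after it; here the variable is the value at position \<open>n\<close> and the
      parameters are the earlier ones.\<close>
    let ?\<pi> = "\<lambda>i. if i < n then Suc i else 0"
    have formula: "\<exists>\<phi>. (\<phi>, ?params) \<in> pformulas L (set ?params) 1 \<and>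
        (\<forall>a\<in>Univ M. [a] \<in> realizations M 1 (\<phi>, ?params) \<longleftrightarrow> ext F (Suc n) (e(n := a)))"
      if F: "finite F" "F \<subseteq> \<Delta>" for F
    proof -
      have "dpred L M (\<lambda>e. \<forall>P\<in>F. P e)"
        using F dp unfolding \<Delta>_def by (intro dpred_ball_finite) auto
      then have dF: "dpred L M (ext F (Suc n))" unfolding ext_def by (rule dpred_exs)
      then have "dpred L M (\<lambda>e. ext F (Suc n) (e \<circ> ?\<pi>))" by (rule dpred_subst)
      moreover have "depends M (Suc n) (\<lambda>e. ext F (Suc n) (e \<circ> ?\<pi>))"
        unfolding depends_def ext_def by auto
      ultimately obtain \<phi> where \<phi>: "\<phi> \<in> formulas L (Suc n)"
        "\<And>e. range e \<subseteq> Univ M \<Longrightarrow> sat M e \<phi> = ext F (Suc n) (e \<circ> ?\<pi>)"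
        using dpred_formula by blast
      have "[a] \<in> realizations M 1 (\<phi>, ?params) \<longleftrightarrow> ext F (Suc n) (e(n := a))"
        if a: "a \<in> Univ M" for a
      proof -
        have "holds M \<phi> ([a] @ ?params) = sat M (case_nat a e) \<phi>"
          using \<phi>(1) by (intro holds_eq_sat[of _ L]) (auto simp: nth_Cons split: nat.split)
        also have "\<dots> = ext F (Suc n) (case_nat a e \<circ> ?\<pi>)"
          using \<phi>(2) range_case_nat[OF a e] by simp
        also have "\<dots> = ext F (Suc n) (e(n := a))"
          unfolding ext_def by (intro ex_cong1) (auto simp: less_Suc_eq)
        finally show ?thesis using a by (simp add: realizations_def tuples_def)
      qed
      moreover have "(\<phi>, ?params) \<in> pformulas L (set ?params) 1"
        using \<phi>(1) by (simp add: pformulas_def)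
      ultimately show ?thesis by blast
    qed
    define fml where "fml F = (SOME \<phi>. (\<phi>, ?params) \<in> pformulas L (set ?params) 1 \<and>
        (\<forall>a\<in>Univ M. [a] \<in> realizations M 1 (\<phi>, ?params) \<longleftrightarrow> ext F (Suc n) (e(n := a))))" for F
    have fml: "(fml F, ?params) \<in> pformulas L (set ?params) 1"
      "\<And>a. a \<in> Univ M \<Longrightarrow> [a] \<in> realizations M 1 (fml F, ?params) \<longleftrightarrow> ext F (Suc n) (e(n := a))"
      if F: "finite F" "F \<subseteq> \<Delta>" for F
      using someI_ex[OF formula[OF F]] unfolding fml_def by blast+
    \<comment> \<open>The type of a next value that keeps every finite part of
      \<open>\<Delta>\<close> satisfiable. Finitely many of its formulas are realised together,
      since \<open>good n e\<close> applies to the union of the parts involved.\<close>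
    define p where "p = (\<lambda>F. (fml F, ?params)) ` {F. finite F \<and> F \<subseteq> \<Delta>}"
    have "\<exists>a\<in>Univ M. \<forall>\<theta>\<in>q. [a] \<in> realizations M 1 \<theta>" if q: "finite q" "q \<subseteq> p" for q
    proof -
      obtain FF where FF: "FF \<subseteq> {F. finite F \<and> F \<subseteq> \<Delta>}" "finite FF" "q = (\<lambda>F. (fml F, ?params)) ` FF"
        using finite_subset_image[OF q(1) q(2)[unfolded p_def]] by blast
      have "ext (\<Union>FF) n e" using g FF unfolding good_def by blast
      then obtain e' where e': "range e' \<subseteq> Univ M" "\<forall>i<n. e' i = e i" "\<forall>P\<in>\<Union>FF. P e'"
        unfolding ext_def by blast
      have "ext F (Suc n) (e(n := e' n))" if "F \<in> FF" for F
        unfolding ext_def using e' that by (intro exI[of _ e']) (auto simp: less_Suc_eq)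
      moreover have "e' n \<in> Univ M" using e'(1) by auto
      ultimately show ?thesis using FF fml(2) by (intro bexI[of _ "e' n"]) auto
    qed
    moreover have "p \<subseteq> pformulas L (set ?params) 1" unfolding p_def using fml(1) by blast
    moreover have "set ?params \<subseteq> Univ M" using e by auto
    moreover have "|set ?params| <o \<kappa>" by (rule finite_small) simp
    ultimately have "\<exists>a\<in>Univ M. \<forall>\<theta>\<in>p. [a] \<in> realizations M 1 \<theta>"
      using saturation unfolding sufficiently_saturated_def saturated_def by blast
    then obtain a where a: "a \<in> Univ M" "\<And>\<theta>. \<theta> \<in> p \<Longrightarrow> [a] \<in> realizations M 1 \<theta>" by blast
    have "good (Suc n) (e(n := a))"
      unfolding good_def
    proof (intro conjI allI impI)
      show "range (e(n := a)) \<subseteq> Univ M" using e a(1) by auto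
      fix F assume F: "finite F" "F \<subseteq> \<Delta>"
      then show "ext F (Suc n) (e(n := a))" using a fml(2)[OF F] unfolding p_def by blast
    qed
    then show ?thesis by (intro exI[of _ "e(n := a)"]) auto
  qed
  obtain f where f: "\<And>n. good n (f n)" "\<And>n i. i < n \<Longrightarrow> f (Suc n) i = f n i"
    using dependent_nat_choice[of good "\<lambda>n e e'. \<forall>i<n. e' i = e i"] good0 step by metis
  \<comment> \<open>Value \<open>i\<close> is fixed from stage \<open>Suc i\<close> on, so the
    diagonal is the limit of the stages.\<close>
  define e where "e i = f (Suc i) i" for i
  have stable: "f n i = e i" if "i < n" for n i
    using that
  proof (induction n)
    case (Suc n)
    then show ?case using f(2) unfolding e_def by (metis less_SucE)
  qed simp
  have r: "range e \<subseteq> Univ M" using f(1) unfolding e_def good_def by blast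
  moreover have "P e" if P: "t \<in> T" "P \<in> \<Gamma> t" for t P
  proof -
    obtain n where n: "depends M n P" using dpred_depends[OF dp[OF P]] by blast
    have "{P} \<subseteq> \<Delta>" using P unfolding \<Delta>_def by auto
    then have "ext {P} n (f n)" using f(1)[of n] unfolding good_def by simp
    then obtain e' where e': "range e' \<subseteq> Univ M" "\<forall>i<n. e' i = f n i" "P e'" unfolding ext_def by blast
    have "e' i = e i" if "i < n" for i using e'(2) stable that by simp
    then show "P e" using dependsD[OF n e'(1) r] e'(3) by simp
  qed
  ultimately show thesis by (rule that)
qed

end

section \<open>Rank one\<close>

text \<open>With \<open>P\<close> fixed and the parameters \<open>e\<close> varying, these sets are
  the members of a uniformly definable family.\<close>

definition fiber :: "('a, 'f, 'r) struct \<Rightarrow> ((nat \<Rightarrow> 'a) \<Rightarrow> bool) \<Rightarrow> (nat \<Rightarrow> 'a) \<Rightarrow> 'a set" where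
  "fiber M P e = {x \<in> Univ M. P (case_nat x e)}"

lemma fiber_cong:
  assumes "depends M (Suc m) P" "range e \<subseteq> Univ M" "range e' \<subseteq> Univ M" "\<And>j. j < m \<Longrightarrow> e j = e' j"
  shows "fiber M P e = fiber M P e'"
proof -
  have "P (case_nat x e) = P (case_nat x e')" if "x \<in> Univ M" for x
  proof (rule dependsD[OF assms(1)])
    show "range (case_nat x e) \<subseteq> Univ M" "range (case_nat x e') \<subseteq> Univ M"
      using range_case_nat[OF that] assms(2,3) by blast+
    fix i assume "i < Suc m"
    then show "case_nat x e i = case_nat x e' i" using assms(4) by (auto split: nat.split)
  qed
  then show ?thesis unfolding fiber_def by blast
qed

lemma at_least_mono: "at_least n C \<Longrightarrow> k \<le> n \<Longrightarrow> at_least k C"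
  by (auto simp: at_least_iff)

lemma dpred_block_at_least:
  assumes "dpred L M P"
  shows "dpred L M (\<lambda>e. at_least n (fiber M P (\<lambda>j. e (f j))))"
  using dpred_at_least_case[OF dpred_block[OF assms, of f], of n] unfolding fiber_def by simp

lemma dpred_block_disjoint:
  assumes "dpred L M P" "finite I"
  shows "dpred L M (\<lambda>e. \<forall>x\<in>Univ M. \<exists>i\<in>I. x \<notin> fiber M P (\<lambda>j. e (f i j)))"
proof -
  have "dpred L M (\<lambda>e. \<forall>i\<in>I. P (case_nat (e 0) (\<lambda>j. e (Suc (f i j)))))"
    using assms by (intro dpred_ball_finite dpred_block)
  from dpred_neg[OF dpred_ex_case[OF this]] show ?thesis
    by (rule dpred_cong) (auto simp: fiber_def)
qed

lemma singleton_list_image: "[x] \<in> (\<lambda>x. [x]) ` A \<longleftrightarrow> x \<in> A"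
  by auto

locale rank_one_structure = saturated_structure \<kappa> L M
  for \<kappa> :: "'k rel" and L :: "('f, 'r) language" and M :: "('a, 'f, 'r) struct" +
  assumes rank_one: "supersimple_rank_1 L M"
begin

text \<open>Compactness passes from arbitrarily long finite families of large,
  \<open>k\<close>-inconsistent fibers to an infinite family with infinite fibers. One assignment
  stores all parameter tuples, the \<open>i\<close>-th from position \<open>i * m\<close>
  on.\<close>

lemma inconsistent_blocks:
  assumes P: "dpred L M P" "depends M (Suc m) P" and m: "0 < m"
    and bad: "\<And>N. \<exists>E. \<forall>i<N. range (E i) \<subseteq> Univ M \<and> at_least N (fiber M P (E i)) \<and>
      (\<forall>I\<subseteq>{..<N}. card I = k \<longrightarrow> (\<forall>x\<in>Univ M. \<exists>i\<in>I. x \<notin> fiber M P (E i)))"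
  obtains e where "range e \<subseteq> Univ M" "\<And>n i. at_least n (fiber M P (\<lambda>j. e (i * m + j)))"
    "\<And>I x. finite I \<Longrightarrow> card I = k \<Longrightarrow> x \<in> Univ M \<Longrightarrow> I \<noteq> {} \<Longrightarrow>
      \<exists>i\<in>I. x \<notin> fiber M P (\<lambda>j. e (i * m + j))"
proof -
  define \<Gamma> where "\<Gamma> N = {\<lambda>e. at_least n (fiber M P (\<lambda>j. e (i * m + j))) | n i. n \<le> N \<and> i < N} \<union>
    {\<lambda>e. \<forall>x\<in>Univ M. \<exists>i\<in>I. x \<notin> fiber M P (\<lambda>j. e (i * m + j)) | I. I \<subseteq> {..<N} \<and> card I = k \<and> I \<noteq> {}}" for N
  have dp: "dpred L M Q" if "Q \<in> \<Gamma> N" for N Q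
    using that P(1) finite_subset[OF _ finite_lessThan] unfolding \<Gamma>_def
    by (auto intro: dpred_block_at_least dpred_block_disjoint)
  have fin: "\<exists>e. range e \<subseteq> Univ M \<and> (\<forall>N\<in>T. \<forall>Q\<in>\<Gamma> N. Q e)" if "finite T" for T
  proof -
    have "\<exists>N. \<forall>n\<in>T. n < N" using \<open>finite T\<close> by (simp add: finite_nat_set_iff_bounded)
    then obtain N where N: "\<And>n. n \<in> T \<Longrightarrow> n < N" by blast
    obtain E where E0: "\<forall>i<N. range (E i) \<subseteq> Univ M \<and> at_least N (fiber M P (E i)) \<and>
      (\<forall>I\<subseteq>{..<N}. card I = k \<longrightarrow> (\<forall>x\<in>Univ M. \<exists>i\<in>I. x \<notin> fiber M P (E i)))"
      using bad[of N] by (elim exE)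
    have E: "range (E i) \<subseteq> Univ M" "at_least N (fiber M P (E i))"
      "I \<subseteq> {..<N} \<Longrightarrow> card I = k \<Longrightarrow> x \<in> Univ M \<Longrightarrow> \<exists>i\<in>I. x \<notin> fiber M P (E i)"
      if "i < N" for i I x
      using E0[rule_format, OF that] by blast+
    obtain u where u: "u \<in> Univ M" using Univ_nonempty by blast
    \<comment> \<open>Writes the tuples of \<open>E\<close> one after the other; \<open>u\<close>
      fills the blocks from \<open>N\<close> on, which no condition under consideration
      mentions.\<close>
    define e where "e v = (if v div m < N then E (v div m) (v mod m) else u)" for v
    have r: "range e \<subseteq> Univ M" using E(1) u unfolding e_def by auto
    have eq: "fiber M P (\<lambda>j. e (i * m + j)) = fiber M P (E i)" if "i < N" for i
    proof (rule fiber_cong[OF P(2)])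
      show "range (\<lambda>j. e (i * m + j)) \<subseteq> Univ M" using r by auto
      show "range (E i) \<subseteq> Univ M" using E(1) that by blast
      fix j assume "j < m"
      then show "e (i * m + j) = E i j" using that unfolding e_def by simp
    qed
    have "Q e" if "n \<in> T" "Q \<in> \<Gamma> n" for n Q
    proof -
      have "n < N" using N that(1) by blast
      from that(2) consider (a) l i where "l \<le> n" "i < n" "Q = (\<lambda>e. at_least l (fiber M P (\<lambda>j. e (i * m + j))))"
        | (b) I where "I \<subseteq> {..<n}" "card I = k" "I \<noteq> {}"
          "Q = (\<lambda>e. \<forall>x\<in>Univ M. \<exists>i\<in>I. x \<notin> fiber M P (\<lambda>j. e (i * m + j)))"
        unfolding \<Gamma>_def by blast
      then show ?thesis
      proof cases
        case a
        then show ?thesis using eq[of i] at_least_mono[OF E(2)[of i], of l] \<open>n < N\<close> by simp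
      next
        case b
        have "I \<subseteq> {..<N}" using b(1) \<open>n < N\<close> by auto
        then have "\<exists>i\<in>I. x \<notin> fiber M P (E i)" if "x \<in> Univ M" for x
          using E(3)[OF \<open>n < N\<close>] b(2) that by blast
        then show ?thesis unfolding b(4) using eq \<open>I \<subseteq> {..<N}\<close> by (metis lessThan_iff subsetD)
      qed
    qed
    then show ?thesis using r by blast
  qed
  obtain e where e: "range e \<subseteq> Univ M" "\<And>N Q. Q \<in> \<Gamma> N \<Longrightarrow> Q e"
    using countable_compactness[of UNIV \<Gamma>] dp fin by (metis UNIV_I)
  show thesis
  proof (rule that[OF e(1)])
    fix n i
    have "(\<lambda>e. at_least n (fiber M P (\<lambda>j. e (i * m + j)))) \<in> \<Gamma> (Suc (max n i))"
      unfolding \<Gamma>_def by (rule UnI1, rule CollectI, rule exI[of _ n], rule exI[of _ i]) auto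
    from e(2)[OF this] show "at_least n (fiber M P (\<lambda>j. e (i * m + j)))" .
  next
    fix I :: "nat set" and x assume I: "finite I" "card I = k" "x \<in> Univ M" "I \<noteq> {}"
    from I(1) have "\<exists>N. I \<subseteq> {..<N}" by (simp add: finite_nat_iff_bounded)
    then obtain N where N: "I \<subseteq> {..<N}" by blast
    have "(\<lambda>e. \<forall>x\<in>Univ M. \<exists>i\<in>I. x \<notin> fiber M P (\<lambda>j. e (i * m + j))) \<in> \<Gamma> N"
      unfolding \<Gamma>_def by (rule UnI2, rule CollectI, rule exI[of _ I]) (use N I in blast)
    from e(2)[OF this] show "\<exists>i\<in>I. x \<notin> fiber M P (\<lambda>j. e (i * m + j))" using I(3) by blast
  qed
qed

text \<open>Finitely many predicates \<open>Q\<close> have constant truth value along a subsequence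
  of the blocks, by Ramsey's theorem. Size and \<open>k\<close>-inconsistency pass to subsequences,
  and compactness then treats all \<open>Q\<close> together.\<close>

lemma indiscernible_blocks:
  assumes P: "dpred L M P" "depends M (Suc m) P" and m: "0 < m"
    and e0: "range e0 \<subseteq> Univ M" "\<And>n i. at_least n (fiber M P (\<lambda>j. e0 (i * m + j)))"
    "\<And>I x. finite I \<Longrightarrow> card I = k \<Longrightarrow> x \<in> Univ M \<Longrightarrow> I \<noteq> {} \<Longrightarrow>
      \<exists>i\<in>I. x \<notin> fiber M P (\<lambda>j. e0 (i * m + j))"
  obtains e where "range e \<subseteq> Univ M" "\<And>n i. at_least n (fiber M P (\<lambda>j. e (i * m + j)))"
    "\<And>I x. finite I \<Longrightarrow> card I = k \<Longrightarrow> x \<in> Univ M \<Longrightarrow> I \<noteq> {} \<Longrightarrow>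
      \<exists>i\<in>I. x \<notin> fiber M P (\<lambda>j. e (i * m + j))"
    "\<And>Q is js. dpred L M Q \<Longrightarrow> depends M (m * length is) Q \<Longrightarrow> sorted_wrt (<) is \<Longrightarrow>
      sorted_wrt (<) js \<Longrightarrow> length is = length js \<Longrightarrow>
      Q (\<lambda>v. e (is ! (v div m) * m + v mod m)) = Q (\<lambda>v. e (js ! (v div m) * m + v mod m))"
proof -
  define \<Gamma>0 where "\<Gamma>0 = {\<lambda>e. at_least n (fiber M P (\<lambda>j. e (i * m + j))) | n i. True} \<union>
    {\<lambda>e. \<forall>x\<in>Univ M. \<exists>i\<in>I. x \<notin> fiber M P (\<lambda>j. e (i * m + j)) | I. finite I \<and> card I = k \<and> I \<noteq> {}}"
  \<comment> \<open>Joins the blocks with indices \<open>is\<close>, matching the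
    \<open>concat\<close> in the definition of indiscernibility.\<close>
  define ev where "ev is e = (\<lambda>v. e (is ! (v div m) * m + v mod m))" for "is" and e :: "nat \<Rightarrow> 'a"
  define \<Gamma> where "\<Gamma> t = \<Gamma>0 \<union> {\<lambda>e. fst t (ev is e) = fst t (ev js e) | is js.
    sorted_wrt (<) is \<and> sorted_wrt (<) js \<and> length is = snd t \<and> length js = snd t}"
    for t :: "((nat \<Rightarrow> 'a) \<Rightarrow> bool) \<times> nat"
  define T where "T = {(Q, r). dpred L M Q \<and> depends M (m * r) Q}"
  have dT: "dpred L M (\<lambda>e. fst t (ev is e))" if "t \<in> T" for t "is"
    using that dpred_subst[of L M "fst t" "\<lambda>v. is ! (v div m) * m + v mod m"]
    unfolding T_def ev_def comp_def by auto
  have d0: "dpred L M Q" if "Q \<in> \<Gamma>0" for Q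
    using that P(1) unfolding \<Gamma>0_def
    by (auto intro: dpred_block_at_least dpred_block_disjoint)
  have dp: "dpred L M Q" if t: "t \<in> T" "Q \<in> \<Gamma> t" for t Q
  proof (cases "Q \<in> \<Gamma>0")
    case False
    then obtain "is" js where "Q = (\<lambda>e. fst t (ev is e) = fst t (ev js e))"
      using t(2) unfolding \<Gamma>_def by blast
    then show ?thesis using dpred_iff[OF dT[OF t(1)] dT[OF t(1)]] by simp
  qed (rule d0)
  have fin: "\<exists>e. range e \<subseteq> Univ M \<and> (\<forall>t\<in>T0. \<forall>Q\<in>\<Gamma> t. Q e)" if T0: "finite T0" "T0 \<subseteq> T" for T0
  proof -
    obtain Y where Y: "infinite Y" "\<And>t. t \<in> T0 \<Longrightarrow> homogeneous (\<lambda>is. fst t (ev is e0)) (snd t) Y"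
      using Ramsey_lists_finite[OF T0(1), of "\<lambda>t is. fst t (ev is e0)" snd] by blast
    define h where "h = enumerate Y"
    have h: "strict_mono h" "\<And>i. h i \<in> Y"
      using Y(1) strict_mono_enumerate enumerate_in_set unfolding h_def by blast+
    define e where "e v = e0 (h (v div m) * m + v mod m)" for v
    have r: "range e \<subseteq> Univ M" using e0(1) unfolding e_def by auto
    have eq: "fiber M P (\<lambda>j. e (i * m + j)) = fiber M P (\<lambda>j. e0 (h i * m + j))" for i
      by (rule fiber_cong[OF P(2)]) (use r e0(1) in \<open>auto simp: e_def\<close>)
    have "Q e" if t: "t \<in> T0" "Q \<in> \<Gamma> t" for t Q
    proof -
      from t(2) consider (a) l i where "Q = (\<lambda>e. at_least l (fiber M P (\<lambda>j. e (i * m + j))))"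
        | (b) I where "finite I" "card I = k" "I \<noteq> {}"
          "Q = (\<lambda>e. \<forall>x\<in>Univ M. \<exists>i\<in>I. x \<notin> fiber M P (\<lambda>j. e (i * m + j)))"
        | (c) "is" js where "sorted_wrt (<) is" "sorted_wrt (<) js" "length is = snd t"
          "length js = snd t" "Q = (\<lambda>e. fst t (ev is e) = fst t (ev js e))"
        unfolding \<Gamma>_def \<Gamma>0_def by blast
      then show ?thesis
      proof cases
        case a
        then show ?thesis using eq[of i] e0(2) by simp
      next
        case b
        have "inj_on h I" using h(1) strict_mono_imp_inj_on inj_on_subset by blast
        then have "card (h ` I) = k" using b(2) card_image by blast
        then have "\<exists>i\<in>h ` I. x \<notin> fiber M P (\<lambda>j. e0 (i * m + j))" if "x \<in> Univ M" for x
          using e0(3)[of "h ` I"] that b(1,3) by blast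
        then show ?thesis unfolding b(4) eq by auto
      next
        case c
        have dep: "depends M (m * snd t) (fst t)" using t(1) T0(2) unfolding T_def by auto
        have *: "fst t (ev ks e) = fst t (ev (map h ks) e0)" if "length ks = snd t" for ks
        proof (rule dependsD[OF dep])
          show "range (ev ks e) \<subseteq> Univ M" "range (ev (map h ks) e0) \<subseteq> Univ M"
            using r e0(1) unfolding ev_def by auto
          fix v assume "v < m * snd t"
          then have "v div m < length ks" using that m by (simp add: less_mult_imp_div_less mult.commute)
          then show "ev ks e v = ev (map h ks) e0 v" unfolding ev_def e_def using m by simp
        qed
        have **: "sorted_wrt (<) (map h ks)" if "sorted_wrt (<) ks" for ks
          using that h(1) by (simp add: sorted_wrt_map strict_mono_def sorted_wrt_mono_rel[of ks "(<)"])
        have "fst t (ev (map h is) e0) = fst t (ev (map h js) e0)"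
          using Y(2)[OF t(1), unfolded homogeneous_def, rule_format, of "map h is" "map h js"]
            ** c h(2) by auto
        then show ?thesis using c * by simp
      qed
    qed
    then show ?thesis using r by blast
  qed
  obtain e where e: "range e \<subseteq> Univ M" "\<And>t Q. t \<in> T \<Longrightarrow> Q \<in> \<Gamma> t \<Longrightarrow> Q e"
    using countable_compactness[of T \<Gamma>] dp fin by blast
  have T0: "(\<lambda>_. True, 0) \<in> T" unfolding T_def using dpred_True by (auto simp: depends_def)
  then have e\<Gamma>0: "Q e" if "Q \<in> \<Gamma>0" for Q using e(2)[OF T0, of Q] that unfolding \<Gamma>_def by blast
  show thesis
  proof (rule that[OF e(1)])
    fix n i
    have "(\<lambda>e. at_least n (fiber M P (\<lambda>j. e (i * m + j)))) \<in> \<Gamma>0" unfolding \<Gamma>0_def by blast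
    from e\<Gamma>0[OF this] show "at_least n (fiber M P (\<lambda>j. e (i * m + j)))" .
  next
    fix I :: "nat set" and x assume I: "finite I" "card I = k" "x \<in> Univ M" "I \<noteq> {}"
    then have "(\<lambda>e. \<forall>x\<in>Univ M. \<exists>i\<in>I. x \<notin> fiber M P (\<lambda>j. e (i * m + j))) \<in> \<Gamma>0"
      unfolding \<Gamma>0_def by blast
    from e\<Gamma>0[OF this] show "\<exists>i\<in>I. x \<notin> fiber M P (\<lambda>j. e (i * m + j))" using I(3) by blast
  next
    fix Q and "is" js :: "nat list"
    assume Q: "dpred L M Q" "depends M (m * length is) Q" and s: "sorted_wrt (<) is"
      "sorted_wrt (<) js" "length is = length js"
    have "(Q, length is) \<in> T" using Q unfolding T_def by blast
    moreover have "(\<lambda>e. Q (ev is e) = Q (ev js e)) \<in> \<Gamma> (Q, length is)"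
      unfolding \<Gamma>_def using s by force
    ultimately have "Q (ev is e) = Q (ev js e)" by (rule e(2))
    then show "Q (\<lambda>v. e (is ! (v div m) * m + v mod m)) = Q (\<lambda>v. e (js ! (v div m) * m + v mod m))"
      unfolding ev_def .
  qed
qed

text \<open>Otherwise compactness and Ramsey's theorem would produce a dividing formula with infinitely
  many realizations.\<close>

lemma fibers_meet:
  assumes P: "dpred L M P"
  shows "\<exists>N. \<forall>E. (\<forall>i<N. range (E i) \<subseteq> Univ M \<and> at_least N (fiber M P (E i))) \<longrightarrow>
    (\<exists>x\<in>Univ M. k \<le> card {i\<in>{..<N}. x \<in> fiber M P (E i)})"
proof (rule ccontr)
  assume contra: "\<not> ?thesis"
  have k: "0 < k" using contra Univ_nonempty by (metis ex_in_conv le0 not_gr_zero)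
  obtain m where "depends M m P" using dpred_depends[OF P] by blast
  then have dep: "depends M (Suc (Suc m)) P" by (rule depends_mono) simp
  \<comment> \<open>The extra parameter keeps the block length positive, as division into blocks
    requires.\<close>
  define l where "l = Suc m"
  have l: "0 < l" "depends M (Suc l) P" unfolding l_def using dep by simp_all
  have bad: "\<exists>E. \<forall>i<N. range (E i) \<subseteq> Univ M \<and> at_least N (fiber M P (E i)) \<and>
      (\<forall>I\<subseteq>{..<N}. card I = k \<longrightarrow> (\<forall>x\<in>Univ M. \<exists>i\<in>I. x \<notin> fiber M P (E i)))" for N
  proof -
    obtain E where E: "\<And>i. i < N \<Longrightarrow> range (E i) \<subseteq> Univ M \<and> at_least N (fiber M P (E i))"
      "\<And>x. x \<in> Univ M \<Longrightarrow> card {i\<in>{..<N}. x \<in> fiber M P (E i)} < k"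
      using contra by (meson not_le)
    have "\<exists>i\<in>I. x \<notin> fiber M P (E i)" if "I \<subseteq> {..<N}" "card I = k" "x \<in> Univ M" for I x
    proof (rule ccontr)
      assume "\<not> ?thesis"
      then have "I \<subseteq> {i\<in>{..<N}. x \<in> fiber M P (E i)}" using that(1) by blast
      then have "k \<le> card {i\<in>{..<N}. x \<in> fiber M P (E i)}"
        using card_mono that(2) by (metis finite_Collect_conjI finite_lessThan Collect_mem_eq)
      then show False using E(2)[OF that(3)] by simp
    qed
    then show ?thesis using E(1) by blast
  qed
  obtain e0 where e0: "range e0 \<subseteq> Univ M" "\<And>n i. at_least n (fiber M P (\<lambda>j. e0 (i * l + j)))"
    "\<And>I x. finite I \<Longrightarrow> card I = k \<Longrightarrow> x \<in> Univ M \<Longrightarrow> I \<noteq> {} \<Longrightarrow>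
      \<exists>i\<in>I. x \<notin> fiber M P (\<lambda>j. e0 (i * l + j))"
    using inconsistent_blocks[OF P l(2,1) bad] by blast
  obtain e where e: "range e \<subseteq> Univ M" "\<And>n i. at_least n (fiber M P (\<lambda>j. e (i * l + j)))"
    "\<And>I x. finite I \<Longrightarrow> card I = k \<Longrightarrow> x \<in> Univ M \<Longrightarrow> I \<noteq> {} \<Longrightarrow>
      \<exists>i\<in>I. x \<notin> fiber M P (\<lambda>j. e (i * l + j))"
    "\<And>Q is js. dpred L M Q \<Longrightarrow> depends M (l * length is) Q \<Longrightarrow> sorted_wrt (<) is \<Longrightarrow>
      sorted_wrt (<) js \<Longrightarrow> length is = length js \<Longrightarrow>
      Q (\<lambda>v. e (is ! (v div l) * l + v mod l)) = Q (\<lambda>v. e (js ! (v div l) * l + v mod l))"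
    using indiscernible_blocks[OF P l(2,1) e0] by blast
  define b where "b i = map (\<lambda>j. e (i * l + j)) [0..<l]" for i
  have lb: "length (b i) = l" for i unfolding b_def by simp
  have lc: "length (concat (map b is)) = l * length is" for "is"
    by (induction "is") (auto simp: lb)
  have bU: "set (b i) \<subseteq> Univ M" for i unfolding b_def using e(1) by auto
  have ev: "concat (map b is) ! v = e (is ! (v div l) * l + v mod l)" if "v < l * length is" for "is" v
    using concat_nth_uniform[of b, OF lb that] l(1) unfolding b_def by simp
  have "indiscernible L M {} l b"
    unfolding indiscernible_def
  proof (intro conjI allI impI)
    show "b i \<in> tuples (Univ M) l" for i using lb bU by (simp add: tuples_def)
    fix "is" js :: "nat list"
    assume s: "sorted_wrt (<) is \<and> sorted_wrt (<) js \<and> length is = length js"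
    have "\<theta> \<in> tp L M (concat (map b is)) {} \<longleftrightarrow> \<theta> \<in> tp L M (concat (map b js)) {}" for \<theta>
    proof (cases "snd \<theta> = [] \<and> fst \<theta> \<in> formulas L (l * length is)")
      case True
      have h: "holds M (fst \<theta>) (concat (map b ks)) = sat M (\<lambda>v. e (ks ! (v div l) * l + v mod l)) (fst \<theta>)"
        if "length ks = length is" for ks
        using True that by (intro holds_eq_sat[of _ L]) (auto simp: lc ev)
      have "wf_fm L (fst \<theta>)" "depends M (l * length is) (\<lambda>e. sat M e (fst \<theta>))"
        using True unfolding formulas_def by (auto intro: depends_sat)
      then have "sat M (\<lambda>v. e (is ! (v div l) * l + v mod l)) (fst \<theta>) =
          sat M (\<lambda>v. e (js ! (v div l) * l + v mod l)) (fst \<theta>)"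
        using e(4)[OF dpred_sat] s by blast
      then show ?thesis using True s h[of "is"] h[of js] bU
        by (auto simp: tp_def pformulas_def realizations_def tuples_def lc)
    next
      case False
      then show ?thesis using s by (auto simp: tp_def pformulas_def lc)
    qed
    then show "tp L M (concat (map b is)) {} = tp L M (concat (map b js)) {}" by blast
  qed
  moreover obtain \<phi> where \<phi>: "\<phi> \<in> formulas L (Suc l)" "\<And>e. range e \<subseteq> Univ M \<Longrightarrow> sat M e \<phi> = P e"
    using dpred_formula[OF P l(2)] by blast
  have R: "realizations M 1 (\<phi>, b i) = (\<lambda>x. [x]) ` fiber M P (\<lambda>j. e (i * l + j))" for i
  proof -
    have "holds M \<phi> (x # b i) = P (case_nat x (\<lambda>j. e (i * l + j)))" if x: "x \<in> Univ M" for x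
    proof -
      have r: "range (\<lambda>j. e (i * l + j)) \<subseteq> Univ M" using e(1) by auto
      have "holds M \<phi> (x # b i) = sat M (case_nat x (\<lambda>j. e (i * l + j))) \<phi>"
        using \<phi>(1) by (intro holds_eq_sat[of _ L]) (auto simp: lb b_def nth_Cons split: nat.split)
      also have "\<dots> = P (case_nat x (\<lambda>j. e (i * l + j)))"
        using \<phi>(2)[OF range_case_nat[OF x r]] .
      finally show ?thesis .
    qed
    then show ?thesis
      by (auto simp: realizations_def tuples_def fiber_def length_Suc_conv)
  qed
  have "(\<Inter>i. realizations M 1 (\<phi>, b i)) = {}"
  proof (rule ccontr)
    assume "\<not> ?thesis"
    then obtain y where "y \<in> (\<Inter>i. realizations M 1 (\<phi>, b i))" by (metis all_not_in_conv)
    then have y: "y \<in> (\<lambda>x. [x]) ` fiber M P (\<lambda>j. e (i * l + j))" for i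
      using R[of i] by (metis INT_E UNIV_I)
    obtain x where x: "y = [x]" using imageE[OF y[of 0]] by metis
    have *: "x \<in> fiber M P (\<lambda>j. e (i * l + j))" for i using y[of i] unfolding x by (simp only: singleton_list_image)
    then have "x \<in> Univ M" unfolding fiber_def by blast
    moreover have "{..<k} \<noteq> {}" using k by auto
    ultimately show False using e(3)[of "{..<k}" x] * by simp
  qed
  ultimately have "divides L M {} 1 (\<phi>, b 0)"
    unfolding divides_def by (intro exI[of _ b]) (simp add: lb)
  moreover have "(\<phi>, b 0) \<in> pformulas L (Univ M) 1"
    using \<phi>(1) bU unfolding pformulas_def by (auto simp: lb)
  ultimately have "finite (realizations M 1 (\<phi>, b 0))"
    using rank_one unfolding supersimple_rank_1_def by blast
  then have "finite (fiber M P (\<lambda>j. e (0 * l + j)))" unfolding R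
    by (rule finite_imageD) (auto simp: inj_on_def)
  then show False using e(2)[of "Suc (card (fiber M P (\<lambda>j. e (0 * l + j))))" 0] by (simp add: at_least_iff)
qed

end

section \<open>Ultrafilters and stable relations\<close>

text \<open>Zorn's lemma for minimal proper filters below \<open>F\<close>: the infimum of a chain
  of proper filters is proper. Minimality decides each \<open>P\<close>, because restricting to
  \<open>P\<close> gives a smaller filter that is proper unless \<open>P\<close> fails almost
  everywhere.\<close>

lemma ultrafilter_exists:
  fixes F :: "'a filter"
  assumes "F \<noteq> bot"
  obtains U where "U \<le> F" "U \<noteq> bot" "\<And>P. eventually P U \<or> eventually (\<lambda>x. \<not> P x) U"
proof -
  let ?A = "{U. U \<le> F \<and> U \<noteq> bot}"
  have "\<exists>m\<in>?A. \<forall>a\<in>?A. a \<le> m \<longrightarrow> a = m"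
  proof (rule predicate_Zorn)
    show "partial_order_on ?A (relation_of (\<lambda>a b. b \<le> a) ?A)"
      by (rule partial_order_on_relation_ofI) auto
    fix C assume C: "C \<in> Chains (relation_of (\<lambda>a b. b \<le> a) ?A)"
    then have CA: "C \<subseteq> ?A" by (rule Chains_relation_of)
    show "\<exists>u\<in>?A. \<forall>a\<in>C. u \<le> a"
    proof (cases "C = {}")
      case True
      then show ?thesis using assms by (intro bexI[of _ F]) auto
    next
      case False
      have lin: "a \<le> b \<or> b \<le> a" if "a \<in> C" "b \<in> C" for a b
        using C that unfolding Chains_def relation_of_def by blast
      have "\<not> eventually (\<lambda>_. False) (Inf C)"
      proof (subst eventually_Inf_base[OF False])
        show "\<exists>x\<in>C. x \<le> inf a b" if "a \<in> C" "b \<in> C" for a b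
          using lin[OF that] that by (metis inf.orderE inf_commute order_refl)
        show "\<not> (\<exists>b\<in>C. eventually (\<lambda>_. False) b)" using CA by (auto simp: eventually_False)
      qed
      then have "Inf C \<noteq> bot" by auto
      moreover obtain c where "c \<in> C" using False by blast
      then have "Inf C \<le> F" using CA Inf_lower[of c C] by (metis (mono_tags, lifting) mem_Collect_eq order_trans subsetD)
      ultimately show ?thesis using Inf_lower by blast
    qed
  qed
  then obtain U where "U \<in> ?A" "\<forall>a\<in>?A. a \<le> U \<longrightarrow> a = U" by (elim bexE)
  then have U: "U \<le> F" "U \<noteq> bot" "V \<le> F \<Longrightarrow> V \<noteq> bot \<Longrightarrow> V \<le> U \<Longrightarrow> V = U" for V
    by simp_all
  have "eventually P U" if "\<not> eventually (\<lambda>x. \<not> P x) U" for P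
  proof -
    let ?V = "inf U (principal {x. P x})"
    have "?V \<noteq> bot"
      using that by (simp add: trivial_limit_def eventually_inf_principal)
    moreover have "?V \<le> F" "?V \<le> U" using U(1) by (auto intro: le_infI1)
    ultimately have "?V = U" by (intro U(3))
    moreover have "eventually P ?V" by (simp add: eventually_inf_principal)
    ultimately show ?thesis by simp
  qed
  then show thesis using that U(1,2) by blast
qed

lemma finite_history_choice:
  fixes P :: "'a set \<Rightarrow> 'a \<Rightarrow> bool"
  assumes "\<And>S. finite S \<Longrightarrow> \<exists>a. P S a"
  shows "\<exists>f::nat \<Rightarrow> 'a. \<forall>n. P (f ` {..<n}) (f n)"
proof (rule dependent_wellorder_choice[where P = "\<lambda>f n a. P (f ` {..<n}) a"])
  show "P (f ` {..<n}) a = P (g ` {..<n}) a" if "\<And>m. m < n \<Longrightarrow> f m = g m"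
    for a and f g :: "nat \<Rightarrow> 'a" and n
  proof -
    have "f ` {..<n} = g ` {..<n}" using that by (intro image_cong) auto
    then show ?thesis by simp
  qed
  show "\<exists>a. P (f ` {..<n}) a" for n and f :: "nat \<Rightarrow> 'a" by (rule assms) simp
qed

lemma inj_into_finite:
  assumes "finite I" "K \<le> card I"
  obtains h :: "nat \<Rightarrow> 'i" where "inj_on h {..<K}" "h ` {..<K} \<subseteq> I"
proof -
  obtain h where h: "bij_betw h {0..<card I} I" using ex_bij_betw_nat_finite[OF assms(1)] by blast
  then have "inj_on h {..<K}" "h ` {..<K} \<subseteq> I"
    using assms(2) unfolding bij_betw_def by (auto intro: inj_on_subset)
  then show thesis by (rule that)
qed

lemma card_ge_two: "2 \<le> card A \<Longrightarrow> \<exists>a\<in>A. \<exists>b\<in>A. a \<noteq> b"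
proof (rule ccontr)
  assume "2 \<le> card A" "\<not> (\<exists>a\<in>A. \<exists>b\<in>A. a \<noteq> b)"
  moreover from this have "finite A" by (metis card.infinite not_numeral_le_zero)
  ultimately show False using card_le_Suc0_iff_eq[of A] by auto
qed

text \<open>An ultrafilter \<open>r\<close> assigns to each \<open>u\<close> the truth value of \<open>R u a\<close> for
  \<open>r\<close>-almost all \<open>a\<close>. For stable \<open>R\<close> this value is computed by a majority
  vote along a sequence chosen generically over witnesses of earlier errors: the witnesses of a
  large set of errors would form a half graph.\<close>

lemma stable_majority:
  fixes R :: "'a \<Rightarrow> 'a \<Rightarrow> bool" and r :: "'a filter"
  assumes r: "r \<noteq> bot" "\<And>P. eventually P r \<or> eventually (\<lambda>x. \<not> P x) r"
    and nonprincipal: "\<And>x. eventually (\<lambda>a. a \<noteq> x) r"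
    and G: "eventually (\<lambda>a. a \<in> G) r"
    and stable: "\<And>u a. (\<And>i. i < K \<Longrightarrow> u i \<in> G \<and> a i \<in> G \<and> R (u i) (a i)) \<Longrightarrow>
      \<exists>i<K. \<exists>j<K. i \<noteq> j \<and> R (u i) (a j) \<and> R (u j) (a i)"
    and W: "eventually W r"
  obtains c :: "nat \<Rightarrow> 'a" where "inj c" "\<And>n. c n \<in> G \<and> W (c n)"
    "\<And>N u. u \<in> G \<Longrightarrow> eventually (\<lambda>a. R u a) r \<Longrightarrow> card {i\<in>{..<N}. \<not> R u (c i)} < K"
    "\<And>N u. u \<in> G \<Longrightarrow> \<not> eventually (\<lambda>a. R u a) r \<Longrightarrow> card {i\<in>{..<N}. R u (c i)} < K"
proof -
  define Tp where "Tp = {u \<in> G. eventually (\<lambda>a. R u a) r}"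
  define Tm where "Tm = {u \<in> G. \<not> eventually (\<lambda>a. R u a) r}"
  define wp where "wp J = (SOME w. w \<in> Tp \<and> (\<forall>a\<in>J. \<not> R w a))" for J
  define wm where "wm J = (SOME w. w \<in> Tm \<and> (\<forall>a\<in>J. R w a))" for J
  have wp: "wp J \<in> Tp \<and> (\<forall>a\<in>J. \<not> R (wp J) a)" if "w \<in> Tp" "\<forall>a\<in>J. \<not> R w a" for J w
    unfolding wp_def by (rule someI[of _ w]) (use that in blast)
  have wm: "wm J \<in> Tm \<and> (\<forall>a\<in>J. R (wm J) a)" if "w \<in> Tm" "\<forall>a\<in>J. R w a" for J w
    unfolding wm_def by (rule someI[of _ w]) (use that in blast)
  \<comment> \<open>A new term must behave as \<open>r\<close> predicts towards every witness
    attached to a set of earlier terms. These are finitely many conditions, each valid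
    \<open>r\<close>-almost everywhere.\<close>
  define ok where "ok S a \<longleftrightarrow> a \<in> G \<and> W a \<and> (\<forall>x\<in>S. a \<noteq> x) \<and>
    (\<forall>J\<in>Pow S. wp J \<in> Tp \<longrightarrow> R (wp J) a) \<and> (\<forall>J\<in>Pow S. wm J \<in> Tm \<longrightarrow> \<not> R (wm J) a)" for S a
  have "\<exists>a. ok S a" if "finite S" for S
  proof -
    have "eventually (\<lambda>a. wp J \<in> Tp \<longrightarrow> R (wp J) a) r" for J
      by (cases "wp J \<in> Tp") (auto simp: Tp_def)
    moreover have "eventually (\<lambda>a. wm J \<in> Tm \<longrightarrow> \<not> R (wm J) a) r" for J
      using r(2)[of "\<lambda>a. R (wm J) a"] by (cases "wm J \<in> Tm") (auto simp: Tm_def)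
    ultimately have "eventually (ok S) r"
      unfolding ok_def using that G W nonprincipal
      by (intro eventually_conj eventually_ball_finite) auto
    then show ?thesis using eventually_happens'[OF r(1)] by blast
  qed
  then have "\<exists>c::nat \<Rightarrow> 'a. \<forall>n. ok (c ` {..<n}) (c n)" by (rule finite_history_choice)
  then obtain c :: "nat \<Rightarrow> 'a" where "\<forall>n. ok (c ` {..<n}) (c n)" ..
  then have c: "ok (c ` {..<n}) (c n)" for n by simp
  have cG: "c n \<in> G \<and> W (c n)" for n using c[of n] unfolding ok_def by simp
  have c_new: "c j \<noteq> c i" if "i < j" for i j using c[of j] that unfolding ok_def by simp
  have cp: "R (wp J) (c n)" if "J \<subseteq> c ` {..<n}" "wp J \<in> Tp" for J n
    using c[of n] that unfolding ok_def by simp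
  have cm: "\<not> R (wm J) (c n)" if "J \<subseteq> c ` {..<n}" "wm J \<in> Tm" for J n
    using c[of n] that unfolding ok_def by simp
  show thesis
  proof (rule that)
    show "inj c"
    proof (rule linorder_injI)
      fix i j :: nat assume "i < j"
      then show "c i \<noteq> c j" using c_new by metis
    qed
    show "c n \<in> G \<and> W (c n)" for n by (rule cG)
  next
    fix N u assume u: "u \<in> G" "eventually (\<lambda>a. R u a) r"
    define I where "I = {i\<in>{..<N}. \<not> R u (c i)}"
    have uT: "u \<in> Tp" using u unfolding Tp_def by blast
    show "card {i\<in>{..<N}. \<not> R u (c i)} < K"
    proof (rule ccontr)
      assume "\<not> ?thesis"
      then have "finite I" "K \<le> card I" unfolding I_def by simp_all
      then obtain h where h: "inj_on h {..<K}" "h ` {..<K} \<subseteq> I" by (rule inj_into_finite)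
      \<comment> \<open>Strictly below \<open>k\<close>: the witness errs on the earlier terms,
        while \<open>c k\<close>, chosen after it, is related to it.\<close>
      define J where "J k = c ` {l\<in>I. l < k}" for k
      have wJ: "wp (J k) \<in> Tp" "\<And>a. a \<in> J k \<Longrightarrow> \<not> R (wp (J k)) a" for k
        using wp[OF uT, of "J k"] unfolding J_def I_def by auto
      have R: "R (wp (J k)) (c k)" for k
        by (rule cp) (use wJ(1) in \<open>auto simp: J_def\<close>)
      have "\<exists>i<K. \<exists>j<K. i \<noteq> j \<and> R (wp (J (h i))) (c (h j)) \<and> R (wp (J (h j))) (c (h i))"
        by (rule stable) (use R wJ(1) cG in \<open>simp add: Tp_def\<close>)
      then obtain i j where ij: "i < K" "j < K" "i \<noteq> j" "R (wp (J (h i))) (c (h j))"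
        "R (wp (J (h j))) (c (h i))" by blast
      have "h i \<noteq> h j" using h(1) ij(1-3) by (auto simp: inj_on_def)
      then have "c (h i) \<in> J (h j) \<or> c (h j) \<in> J (h i)"
        using h(2) ij(1,2) unfolding J_def by (auto simp: neq_iff)
      then show False using wJ(2) ij(4,5) by blast
    qed
  next
    fix N u assume u: "u \<in> G" "\<not> eventually (\<lambda>a. R u a) r"
    define I where "I = {i\<in>{..<N}. R u (c i)}"
    have uT: "u \<in> Tm" using u unfolding Tm_def by blast
    show "card {i\<in>{..<N}. R u (c i)} < K"
    proof (rule ccontr)
      assume "\<not> ?thesis"
      then have "finite I" "K \<le> card I" unfolding I_def by simp_all
      then obtain h where h: "inj_on h {..<K}" "h ` {..<K} \<subseteq> I" by (rule inj_into_finite)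
      \<comment> \<open>Here \<open>c k\<close> is included: the witness is related to it by choice
        and unrelated to all later terms, so the half graph runs in the other direction.\<close>
      define J where "J k = c ` {l\<in>I. l \<le> k}" for k
      have wJ: "wm (J k) \<in> Tm" "\<And>a. a \<in> J k \<Longrightarrow> R (wm (J k)) a" for k
        using wm[OF uT, of "J k"] unfolding J_def I_def by auto
      have R: "\<not> R (wm (J k)) (c l)" if "k < l" for k l
      proof -
        have "J k \<subseteq> c ` {..<l}" using that unfolding J_def by auto
        then show ?thesis using cm wJ(1) by blast
      qed
      have "\<exists>i<K. \<exists>j<K. i \<noteq> j \<and> R (wm (J (h i))) (c (h j)) \<and> R (wm (J (h j))) (c (h i))"
      proof (rule stable)
        fix i assume "i < K"
        then have "c (h i) \<in> J (h i)" using h(2) unfolding J_def by auto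
        then show "wm (J (h i)) \<in> G \<and> c (h i) \<in> G \<and> R (wm (J (h i))) (c (h i))"
          using wJ cG by (simp add: Tm_def)
      qed
      then obtain i j where ij: "i < K" "j < K" "i \<noteq> j" "R (wm (J (h i))) (c (h j))"
        "R (wm (J (h j))) (c (h i))" by blast
      have "h i \<noteq> h j" using h(1) ij(1-3) by (auto simp: inj_on_def)
      then show False using R ij(4,5) by (metis neq_iff)
    qed
  qed
qed

section \<open>Uniformly definable families in a group\<close>

text \<open>Everything the group argument needs from logic: closure properties of uniformly
  definable families, and rank one in the form \<open>unif_meet\<close>. A single set
  \<open>C\<close> is definable when \<open>unif {C}\<close> holds.\<close>

locale definable_group = group G for G (structure) +
  fixes unif :: "'a set set \<Rightarrow> bool"
  assumes infinite_carrier: "infinite (carrier G)"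
    and unif_subset: "unif \<D> \<Longrightarrow> \<E> \<subseteq> \<D> \<Longrightarrow> unif \<E>"
    and unif_carrier: "unif \<D> \<Longrightarrow> C \<in> \<D> \<Longrightarrow> C \<subseteq> carrier G"
    and unif_inter: "unif \<D> \<Longrightarrow> unif \<E> \<Longrightarrow> unif {C \<inter> D | C D. C \<in> \<D> \<and> D \<in> \<E>}"
    and unif_compl: "unif \<D> \<Longrightarrow> unif {carrier G - C | C. C \<in> \<D>}"
    and unif_mult: "unif \<D> \<Longrightarrow> unif \<E> \<Longrightarrow> unif {C <#> D | C D. C \<in> \<D> \<and> D \<in> \<E>}"
    and unif_singletons: "unif {{g} | g. g \<in> carrier G}"
    and unif_inv: "unif \<D> \<Longrightarrow> unif {(\<lambda>x. inv x) ` C | C. C \<in> \<D>}"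
    and unif_square: "unif \<D> \<Longrightarrow> unif {(\<lambda>x. x \<otimes> x) ` C | C. C \<in> \<D>}"
    and unif_count: "unif {C} \<Longrightarrow> unif {D} \<Longrightarrow> unif {{h \<in> carrier G. at_least n ((h <# C) \<inter> D)}}"
    and unif_meet: "unif \<D> \<Longrightarrow> \<exists>N. \<forall>F::nat \<Rightarrow> 'a set. (\<forall>i<N. F i \<in> \<D> \<and> at_least N (F i)) \<longrightarrow>
      (\<exists>x\<in>carrier G. k \<le> card {i\<in>{..<N}. x \<in> F i})"
begin

section \<open>Translates and Boolean combinations of definable sets\<close>

lemma mem_l_coset:
  assumes "C \<subseteq> carrier G" "g \<in> carrier G" "x \<in> carrier G"
  shows "x \<in> g <# C \<longleftrightarrow> inv g \<otimes> x \<in> C"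
proof
  assume "x \<in> g <# C"
  then obtain c where c: "c \<in> C" "x = g \<otimes> c" unfolding l_coset_def by blast
  then have "inv g \<otimes> x = c" using assms by (simp add: inv_solve_left' subset_iff)
  then show "inv g \<otimes> x \<in> C" using c(1) by simp
next
  assume "inv g \<otimes> x \<in> C"
  moreover have "x = g \<otimes> (inv g \<otimes> x)" using assms(2,3) by (simp add: m_assoc[symmetric])
  ultimately show "x \<in> g <# C" unfolding l_coset_def by blast
qed

lemma l_coset_carrier: "C \<subseteq> carrier G \<Longrightarrow> g \<in> carrier G \<Longrightarrow> g <# C \<subseteq> carrier G"
  unfolding l_coset_def by auto

lemma bij_l_coset: "C \<subseteq> carrier G \<Longrightarrow> g \<in> carrier G \<Longrightarrow> bij_betw (\<lambda>x. g \<otimes> x) C (g <# C)"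
  unfolding bij_betw_def l_coset_def by (auto simp: inj_on_def subset_iff)

lemma infinite_l_coset:
  "C \<subseteq> carrier G \<Longrightarrow> g \<in> carrier G \<Longrightarrow> infinite (g <# C) = infinite C"
  using bij_betw_finite[OF bij_l_coset] by blast

lemma at_least_l_coset:
  "C \<subseteq> carrier G \<Longrightarrow> g \<in> carrier G \<Longrightarrow> at_least n (g <# C) = at_least n C"
  using bij_betw_finite[OF bij_l_coset] bij_betw_same_card[OF bij_l_coset] by (simp add: at_least_iff)

lemma unif_translates: "unif \<D> \<Longrightarrow> unif {g <# C | g C. g \<in> carrier G \<and> C \<in> \<D>}"
  by (rule unif_subset[OF unif_mult[OF unif_singletons]]) (auto simp: l_coset_eq_set_mult)

lemma unif_diff: "unif \<D> \<Longrightarrow> unif \<E> \<Longrightarrow> unif {C - D | C D. C \<in> \<D> \<and> D \<in> \<E>}"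
proof -
  assume u: "unif \<D>" "unif \<E>"
  show ?thesis
  proof (rule unif_subset[OF unif_inter[OF u(1) unif_compl[OF u(2)]]], rule subsetI)
    fix B assume "B \<in> {C - D | C D. C \<in> \<D> \<and> D \<in> \<E>}"
    then obtain C D where CD: "B = C - D" "C \<in> \<D>" "D \<in> \<E>" by blast
    then have "B = C \<inter> (carrier G - D)" using unif_carrier[OF u(1) CD(2)] by blast
    then show "B \<in> {C \<inter> D | C D. C \<in> \<D> \<and> D \<in> {carrier G - C | C. C \<in> \<E>}}" using CD(2,3) by blast
  qed
qed

lemma definable_inter: "unif {C} \<Longrightarrow> unif {D} \<Longrightarrow> unif {C \<inter> D}"
  using unif_inter[of "{C}" "{D}"] by simp

lemma definable_diff: "unif {C} \<Longrightarrow> unif {D} \<Longrightarrow> unif {C - D}"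
  using unif_diff[of "{C}" "{D}"] by simp

lemma definable_translate: "unif {C} \<Longrightarrow> g \<in> carrier G \<Longrightarrow> unif {g <# C}"
  by (rule unif_subset[OF unif_translates]) auto

lemma definable_square: "unif {C} \<Longrightarrow> unif {(\<lambda>x. x \<otimes> x) ` C}"
  by (rule unif_subset[OF unif_square]) auto

lemma definable_inv: "unif {C} \<Longrightarrow> unif {(\<lambda>x. inv x) ` C}"
  by (rule unif_subset[OF unif_inv]) auto

lemma definable_carrier: "unif {carrier G}"
proof -
  have "unif {{\<one>}}" by (rule unif_subset[OF unif_singletons]) auto
  from definable_diff[OF this this] have "unif {{} :: 'a set}" by simp
  from unif_compl[OF this] show ?thesis by simp
qed

lemma definable_Inter:
  assumes "finite I" "\<And>i. i \<in> I \<Longrightarrow> unif {C i}"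
  shows "unif {{x \<in> carrier G. \<forall>i\<in>I. x \<in> C i}}"
  using assms
proof (induction I)
  case empty
  then show ?case using definable_carrier by simp
next
  case (insert i I)
  then have "unif {C i \<inter> {x \<in> carrier G. \<forall>i\<in>I. x \<in> C i}}" by (intro definable_inter) auto
  moreover have "C i \<inter> {x \<in> carrier G. \<forall>i\<in>I. x \<in> C i} = {x \<in> carrier G. \<forall>i\<in>insert i I. x \<in> C i}" by auto
  ultimately show ?case by simp
qed

lemma definable_Union:
  assumes "finite I" "\<And>i. i \<in> I \<Longrightarrow> unif {C i}"
  shows "unif {{x \<in> carrier G. \<exists>i\<in>I. x \<in> C i}}"
proof -
  have "unif {{x \<in> carrier G. \<forall>i\<in>I. x \<in> carrier G - C i}}"
    using assms definable_diff[OF definable_carrier] by (intro definable_Inter) auto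
  from definable_diff[OF definable_carrier this]
  have "unif {carrier G - {x \<in> carrier G. \<forall>i\<in>I. x \<in> carrier G - C i}}" .
  moreover have "carrier G - {x \<in> carrier G. \<forall>i\<in>I. x \<in> carrier G - C i} = {x \<in> carrier G. \<exists>i\<in>I. x \<in> C i}"
    by auto
  ultimately show ?thesis by simp
qed

text \<open>A translate \<open>a <# C\<close> meets \<open>s <# C\<close> only if \<open>a\<close>
  is \<open>s \<otimes> c \<otimes> inv d\<close> with \<open>c\<close>, \<open>d\<close> in
  \<open>C\<close>. These are finitely many elements to avoid at each stage of a greedy
  choice.\<close>

lemma disjoint_translates:
  assumes "finite C" "C \<subseteq> carrier G"
  obtains g :: "nat \<Rightarrow> 'a" where "\<And>i. g i \<in> carrier G" "\<And>i j. i \<noteq> j \<Longrightarrow> (g i <# C) \<inter> (g j <# C) = {}"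
proof -
  define ok where "ok S a \<longleftrightarrow> a \<in> carrier G \<and> (\<forall>s\<in>S. s \<in> carrier G \<longrightarrow> (s <# C) \<inter> (a <# C) = {})" for S a
  have "\<exists>a. ok S a" if "finite S" for S
  proof -
    let ?B = "(\<lambda>(s, c, d). s \<otimes> c \<otimes> inv d) ` (S \<times> C \<times> C)"
    have "finite ?B" using that assms(1) by blast
    then obtain a where a: "a \<in> carrier G" "a \<notin> ?B"
      using infinite_carrier by (meson finite_subset subsetI)
    have "(s <# C) \<inter> (a <# C) = {}" if s: "s \<in> S" "s \<in> carrier G" for s
    proof (rule ccontr)
      assume "\<not> ?thesis"
      then obtain c d where cd: "c \<in> C" "d \<in> C" "s \<otimes> c = a \<otimes> d" unfolding l_coset_def by blast
      then have "a = s \<otimes> c \<otimes> inv d" using a(1) s(2) assms(2) by (simp add: inv_solve_right subset_iff)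
      then show False using a(2) s(1) cd(1,2) by force
    qed
    then show ?thesis using a(1) unfolding ok_def by blast
  qed
  then have "\<exists>g::nat \<Rightarrow> 'a. \<forall>n. ok (g ` {..<n}) (g n)" by (rule finite_history_choice)
  then obtain g :: "nat \<Rightarrow> 'a" where g: "\<forall>n. ok (g ` {..<n}) (g n)" ..
  have gG: "g i \<in> carrier G" for i using g unfolding ok_def by blast
  have "(g i <# C) \<inter> (g j <# C) = {}" if "i < j" for i j
    using spec[OF g, of j] gG that unfolding ok_def by simp
  then have "(g i <# C) \<inter> (g j <# C) = {}" if "i \<noteq> j" for i j
    using that by (metis inf_commute linorder_neq_iff)
  then show thesis using that gG by blast
qed

text \<open>Finite sets have arbitrarily many disjoint translates, large ones do not.\<close>

lemma threshold:
  assumes "unif \<D>"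
  shows "\<exists>n. \<forall>C\<in>\<D>. at_least n C \<longrightarrow> infinite C"
proof -
  obtain N where N: "\<forall>F::nat \<Rightarrow> 'a set. (\<forall>i<N. F i \<in> {g <# C | g C. g \<in> carrier G \<and> C \<in> \<D>} \<and> at_least N (F i)) \<longrightarrow>
      (\<exists>x\<in>carrier G. 2 \<le> card {i\<in>{..<N}. x \<in> F i})"
    using unif_meet[OF unif_translates[OF assms], of 2] ..
  have "infinite C" if C: "C \<in> \<D>" "at_least N C" for C
  proof
    assume "finite C"
    have CG: "C \<subseteq> carrier G" using unif_carrier[OF assms C(1)] .
    obtain g :: "nat \<Rightarrow> 'a" where g: "\<And>i. g i \<in> carrier G" "\<And>i j. i \<noteq> j \<Longrightarrow> (g i <# C) \<inter> (g j <# C) = {}"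
      using disjoint_translates[OF \<open>finite C\<close> CG] by blast
    have "\<exists>x\<in>carrier G. 2 \<le> card {i\<in>{..<N}. x \<in> g i <# C}"
      by (rule N[rule_format]) (use g(1) C at_least_l_coset[OF CG] in blast)
    then show False using card_ge_two g(2) by blast
  qed
  then show ?thesis by blast
qed

lemma infinite_at_least: "infinite C \<Longrightarrow> at_least n C"
  by (simp add: at_least_iff)

text \<open>Induction on \<open>n\<close>: many of the sets share a point \<open>x\<close>. Without
  \<open>x\<close> they are still infinite and form a uniform family, so two of them meet in
  \<open>n\<close> points, and \<open>x\<close> is one more.\<close>

lemma meet_at_least:
  "unif \<D> \<Longrightarrow> \<exists>N. \<forall>F::nat \<Rightarrow> 'a set. (\<forall>i<N. F i \<in> \<D> \<and> infinite (F i)) \<longrightarrow>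
    (\<exists>i<N. \<exists>j<N. i \<noteq> j \<and> at_least n (F i \<inter> F j))"
proof (induction n arbitrary: \<D>)
  case 0
  have *: "\<exists>i<2. \<exists>j<2. i \<noteq> j \<and> at_least 0 (F i \<inter> F j)" for F :: "nat \<Rightarrow> 'a set"
    by (rule exI[of _ 0], simp, rule exI[of _ 1], simp add: at_least_iff)
  show ?case by (rule exI[of _ 2]) (use * in blast)
next
  case (Suc n)
  let ?\<D>' = "{C - D | C D. C \<in> \<D> \<and> D \<in> {{g} | g. g \<in> carrier G}}"
  from Suc.IH[OF unif_diff[OF Suc.prems unif_singletons]] obtain N' where N': "\<forall>F::nat \<Rightarrow> 'a set. (\<forall>i<N'. F i \<in> ?\<D>' \<and> infinite (F i)) \<longrightarrow>
    (\<exists>i<N'. \<exists>j<N'. i \<noteq> j \<and> at_least n (F i \<inter> F j))" ..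
  obtain N where N: "\<forall>F::nat \<Rightarrow> 'a set. (\<forall>i<N. F i \<in> \<D> \<and> at_least N (F i)) \<longrightarrow>
      (\<exists>x\<in>carrier G. N' \<le> card {i\<in>{..<N}. x \<in> F i})"
    using unif_meet[OF Suc.prems, of N'] ..
  have "\<exists>i<N. \<exists>j<N. i \<noteq> j \<and> at_least (Suc n) (F i \<inter> F j)" if F: "\<forall>i<N. F i \<in> \<D> \<and> infinite (F i)" for F :: "nat \<Rightarrow> 'a set"
  proof -
    have "\<forall>i<N. F i \<in> \<D> \<and> at_least N (F i)" using F by (simp add: infinite_at_least)
    from mp[OF spec[OF N] this]
    obtain x where x: "x \<in> carrier G" "N' \<le> card {i\<in>{..<N}. x \<in> F i}" by (elim bexE)
    have "finite {i\<in>{..<N}. x \<in> F i}" by simp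
    then obtain h :: "nat \<Rightarrow> nat" where h: "inj_on h {..<N'}" "h ` {..<N'} \<subseteq> {i\<in>{..<N}. x \<in> F i}"
      using inj_into_finite[OF _ x(2)] by blast
    have hN: "h i < N \<and> x \<in> F (h i)" if "i < N'" for i using h(2) that by auto
    have "\<exists>i<N'. \<exists>j<N'. i \<noteq> j \<and> at_least n ((F (h i) - {x}) \<inter> (F (h j) - {x}))"
    proof (rule N'[rule_format], intro conjI)
      fix i assume "i < N'"
      then show "F (h i) - {x} \<in> ?\<D>'" "infinite (F (h i) - {x})" using F hN x(1) by auto
    qed
    then obtain i j where ij: "i < N'" "j < N'" "i \<noteq> j" "at_least n ((F (h i) - {x}) \<inter> (F (h j) - {x}))"
      by blast
    from ij(4) obtain S where S: "S \<subseteq> (F (h i) - {x}) \<inter> (F (h j) - {x})" "finite S" "card S = n"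
      unfolding at_least_def by blast
    have "insert x S \<subseteq> F (h i) \<inter> F (h j)" using S(1) hN ij(1,2) by auto
    moreover have "card (insert x S) = Suc n" using S by (subst card_insert_disjoint) auto
    ultimately have "at_least (Suc n) (F (h i) \<inter> F (h j))"
      unfolding at_least_def using S(2) by (metis finite_insert)
    moreover have "h i \<noteq> h j" using h(1) ij by (auto simp: inj_on_def)
    ultimately show ?thesis using hN ij(1,2) by blast
  qed
  then show ?case by blast
qed

text \<open>The pairwise intersections form a uniform family, so \<open>threshold\<close> makes a
  large enough intersection infinite.\<close>

lemma meet_infinite:
  assumes "unif \<D>"
  shows "\<exists>N. \<forall>F::nat \<Rightarrow> 'a set. (\<forall>i<N. F i \<in> \<D> \<and> infinite (F i)) \<longrightarrow>
    (\<exists>i<N. \<exists>j<N. i \<noteq> j \<and> infinite (F i \<inter> F j))"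
proof -
  obtain n where "\<forall>C\<in>{C \<inter> D | C D. C \<in> \<D> \<and> D \<in> \<D>}. at_least n C \<longrightarrow> infinite C"
    using threshold[OF unif_inter[OF assms assms]] ..
  then have n: "C \<in> {C \<inter> D | C D. C \<in> \<D> \<and> D \<in> \<D>} \<Longrightarrow> at_least n C \<Longrightarrow> infinite C" for C
    by blast
  obtain N where N: "\<forall>F::nat \<Rightarrow> 'a set. (\<forall>i<N. F i \<in> \<D> \<and> infinite (F i)) \<longrightarrow>
    (\<exists>i<N. \<exists>j<N. i \<noteq> j \<and> at_least n (F i \<inter> F j))" using meet_at_least[OF assms] ..
  have "\<exists>i<N. \<exists>j<N. i \<noteq> j \<and> infinite (F i \<inter> F j)" if F: "\<forall>i<N. F i \<in> \<D> \<and> infinite (F i)" for F :: "nat \<Rightarrow> 'a set"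
  proof -
    from mp[OF spec[OF N] F] obtain i j
      where ij: "i < N" "j < N" "i \<noteq> j" "at_least n (F i \<inter> F j)" by (elim exE conjE)
    have "F i \<in> \<D>" "F j \<in> \<D>" using F ij(1,2) by simp_all
    then have "F i \<inter> F j \<in> {C \<inter> D | C D. C \<in> \<D> \<and> D \<in> \<D>}" by blast
    then have "infinite (F i \<inter> F j)" using ij(4) by (rule n)
    then show ?thesis using ij by blast
  qed
  then show ?thesis by blast
qed

end

section \<open>Products of generic elements\<close>

locale square_set = definable_group G unif for G (structure) and unif :: "'a set set \<Rightarrow> bool" +
  fixes D :: "'a set"
  assumes definable_D: "unif {D}"
    and finite_roots: "finite {x \<in> D. x \<otimes> x = c}"
begin

definition squares :: "'a set" where
  "squares = (\<lambda>x. x \<otimes> x) ` D"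

definition good :: "'a set" where
  "good = {x \<in> carrier G. infinite ((x <# D) \<inter> squares)}"

text \<open>By \<open>adj_iff\<close> this is the relation of the overview. Written through
  \<open>good\<close> it is visibly invariant under left translation, and the elements related to
  \<open>a\<close> form the translate \<open>a <# good\<close>.\<close>

definition adj :: "'a \<Rightarrow> 'a \<Rightarrow> bool" where
  "adj u a \<longleftrightarrow> inv a \<otimes> u \<in> good"

lemma D_carrier: "D \<subseteq> carrier G"
  using unif_carrier[OF definable_D] by blast

lemma definable_squares: "unif {squares}"
  unfolding squares_def by (rule definable_square[OF definable_D])

lemma squares_carrier: "squares \<subseteq> carrier G"
  using unif_carrier[OF definable_squares] by blast

lemma good_carrier: "good \<subseteq> carrier G"
  unfolding good_def by blast

text \<open>Replaces infinity by a count with a uniform bound; this makes \<open>good\<close>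
  definable and lets membership be proved by exhibiting \<open>n\<close> points.\<close>

lemma good_threshold:
  obtains n where "good = {x \<in> carrier G. at_least n ((x <# D) \<inter> squares)}"
proof -
  let ?\<D> = "{C \<inter> E | C E. C \<in> {g <# C | g C. g \<in> carrier G \<and> C \<in> {D}} \<and> E \<in> {squares}}"
  obtain n where n: "\<forall>C\<in>?\<D>. at_least n C \<longrightarrow> infinite C"
    using threshold[OF unif_inter[OF unif_translates[OF definable_D] definable_squares]] ..
  have "infinite ((x <# D) \<inter> squares) \<longleftrightarrow> at_least n ((x <# D) \<inter> squares)" if "x \<in> carrier G" for x
  proof -
    have "(x <# D) \<inter> squares \<in> ?\<D>" using that by blast
    then show ?thesis using n infinite_at_least by blast
  qed
  then show thesis by (intro that) (auto simp: good_def)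
qed

lemma definable_good: "unif {good}"
proof -
  obtain n where "good = {x \<in> carrier G. at_least n ((x <# D) \<inter> squares)}" by (rule good_threshold)
  then show ?thesis using unif_count[OF definable_D definable_squares, of n] by simp
qed

lemma adj_iff:
  assumes "u \<in> carrier G" "a \<in> carrier G"
  shows "adj u a \<longleftrightarrow> infinite ((u <# D) \<inter> (a <# squares))"
proof -
  have S: "(inv a \<otimes> u <# D) \<inter> squares \<subseteq> carrier G" using squares_carrier by blast
  have "(u <# D) \<inter> (a <# squares) = a <# ((inv a \<otimes> u <# D) \<inter> squares)" (is "?l = ?r")
  proof (rule Set.set_eqI)
    fix x
    show "x \<in> ?l \<longleftrightarrow> x \<in> ?r"
    proof (cases "x \<in> carrier G")
      case True
      have "a \<otimes> (inv a \<otimes> x) = x" using assms True by (simp add: m_assoc[symmetric])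
      then have "inv (inv a \<otimes> u) \<otimes> (inv a \<otimes> x) = inv u \<otimes> x"
        using assms True by (simp add: inv_mult_group m_assoc)
      then show ?thesis using assms True S D_carrier squares_carrier
        by (simp add: mem_l_coset)
    next
      case False
      then have "x \<notin> ?l" using assms l_coset_carrier[OF D_carrier assms(1)] by blast
      moreover have "x \<notin> ?r" using False l_coset_carrier[OF S assms(2)] by blast
      ultimately show ?thesis by blast
    qed
  qed
  then have "infinite ((u <# D) \<inter> (a <# squares)) \<longleftrightarrow> infinite ((inv a \<otimes> u <# D) \<inter> squares)"
    using infinite_l_coset[OF S assms(2)] by simp
  then show ?thesis using assms unfolding adj_def good_def by simp
qed

text \<open>With \<open>E\<close> for \<open>squares\<close>: a half graph would give infinite sets \<open>u\<^sub>iD \<inter> a\<^sub>iE\<close> with pairwise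
  finite intersections.\<close>

lemma adj_stable:
  obtains K :: nat where "\<And>u a. (\<And>i. i < K \<Longrightarrow> u i \<in> carrier G \<and> a i \<in> carrier G \<and> adj (u i) (a i)) \<Longrightarrow>
      \<exists>i<K. \<exists>j<K. i \<noteq> j \<and> adj (u i) (a j) \<and> adj (u j) (a i)"
proof -
  let ?\<D> = "{C \<inter> E | C E. C \<in> {g <# C | g C. g \<in> carrier G \<and> C \<in> {D}} \<and>
    E \<in> {g <# C | g C. g \<in> carrier G \<and> C \<in> {squares}}}"
  obtain K where K: "\<forall>F::nat \<Rightarrow> 'a set. (\<forall>i<K. F i \<in> ?\<D> \<and> infinite (F i)) \<longrightarrow>
    (\<exists>i<K. \<exists>j<K. i \<noteq> j \<and> infinite (F i \<inter> F j))"
    using meet_infinite[OF unif_inter[OF unif_translates[OF definable_D] unif_translates[OF definable_squares]]] ..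
  show thesis
  proof (rule that)
    fix u a :: "nat \<Rightarrow> 'a"
    assume ua: "\<And>i. i < K \<Longrightarrow> u i \<in> carrier G \<and> a i \<in> carrier G \<and> adj (u i) (a i)"
    have "\<forall>i<K. (u i <# D) \<inter> (a i <# squares) \<in> ?\<D> \<and> infinite ((u i <# D) \<inter> (a i <# squares))"
      using ua adj_iff by blast
    from mp[OF spec[OF K] this] obtain i j where ij: "i < K" "j < K" "i \<noteq> j"
      "infinite (((u i <# D) \<inter> (a i <# squares)) \<inter> ((u j <# D) \<inter> (a j <# squares)))"
      by (elim exE conjE)
    \<comment> \<open>The fourfold intersection lies in both crosswise intersections.\<close>
    have "infinite ((u i <# D) \<inter> (a j <# squares))" "infinite ((u j <# D) \<inter> (a i <# squares))"
      using ij(4) by (auto elim!: contrapos_nn intro: finite_subset[rotated])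
    then have "adj (u i) (a j)" "adj (u j) (a i)" using adj_iff ua ij(1,2) by blast+
    then show "\<exists>i<K. \<exists>j<K. i \<noteq> j \<and> adj (u i) (a j) \<and> adj (u j) (a i)" using ij by blast
  qed
qed

lemma infinite_squares:
  assumes "S \<subseteq> D" "infinite S"
  shows "infinite ((\<lambda>x. x \<otimes> x) ` S)"
proof
  assume "finite ((\<lambda>x. x \<otimes> x) ` S)"
  then have "finite (\<Union>c\<in>(\<lambda>x. x \<otimes> x) ` S. {x \<in> D. x \<otimes> x = c})" using finite_roots by blast
  moreover have "S \<subseteq> (\<Union>c\<in>(\<lambda>x. x \<otimes> x) ` S. {x \<in> D. x \<otimes> x = c})" using assms(1) by auto
  ultimately show False using assms(2) finite_subset by blast
qed

text \<open>The idea is exchange: for independent generic \<open>s \<in> squares\<close> and \<open>z \<in> D\<close> the element \<open>s\<close> is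
  generic over \<open>x = s z\<^sup>-\<^sup>1\<close> and lies in \<open>xD \<inter> squares\<close>, so \<open>x\<close> is good.\<close>

lemma finite_exceptional_squares:
  "finite {s \<in> squares. infinite ((s <# ((\<lambda>x. inv x) ` D)) - good)}" (is "finite ?Z")
proof (rule ccontr)
  assume inf: "infinite ?Z"
  obtain n where n: "good = {x \<in> carrier G. at_least n ((x <# D) \<inter> squares)}" by (rule good_threshold)
  let ?\<D> = "{C - E | C E. C \<in> {g <# C | g C. g \<in> carrier G \<and> C \<in> {(\<lambda>x. inv x) ` D}} \<and> E \<in> {good}}"
  have inv_carrier: "(\<lambda>x. inv x) ` D \<subseteq> carrier G" using D_carrier by auto
  obtain N where N: "\<forall>F::nat \<Rightarrow> 'a set. (\<forall>i<N. F i \<in> ?\<D> \<and> at_least N (F i)) \<longrightarrow>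
      (\<exists>x\<in>carrier G. Suc n \<le> card {i\<in>{..<N}. x \<in> F i})"
    using unif_meet[OF unif_diff[OF unif_translates[OF definable_inv[OF definable_D]] definable_good], of "Suc n"] ..
  obtain s :: "nat \<Rightarrow> 'a" where s: "inj s" "range s \<subseteq> ?Z"
    using infinite_countable_subset[OF inf] by blast
  have sG: "s i \<in> carrier G" for i using s(2) squares_carrier by blast
  have "\<forall>i<N. (s i <# ((\<lambda>x. inv x) ` D)) - good \<in> ?\<D> \<and> at_least N ((s i <# ((\<lambda>x. inv x) ` D)) - good)"
  proof (intro allI impI conjI)
    fix i
    have "s i \<in> ?Z" using s(2) by blast
    then have "infinite ((s i <# ((\<lambda>x. inv x) ` D)) - good)" by blast
    then show "at_least N ((s i <# ((\<lambda>x. inv x) ` D)) - good)" by (rule infinite_at_least)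
    show "(s i <# ((\<lambda>x. inv x) ` D)) - good \<in> ?\<D>" using sG by blast
  qed
  from mp[OF spec[OF N] this] obtain x where
    x: "x \<in> carrier G" "Suc n \<le> card {i\<in>{..<N}. x \<in> (s i <# ((\<lambda>x. inv x) ` D)) - good}" (is "_ \<le> card ?I")
    by (elim bexE)
  \<comment> \<open>The equation \<open>x = s i \<otimes> inv d\<close> is solved for
    \<open>s i\<close>. Since the \<open>s i\<close> are distinct, \<open>x <# D\<close> contains
    enough squares to make \<open>x\<close> good.\<close>
  have sx: "s i \<in> (x <# D) \<inter> squares" if i: "i \<in> ?I" for i
  proof -
    obtain d where d: "d \<in> D" "x = s i \<otimes> inv d" using i unfolding l_coset_def by blast
    have dG: "d \<in> carrier G" using d(1) D_carrier by blast
    have "s i = x \<otimes> d" using sG[of i] dG by (simp add: d(2) m_assoc)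
    moreover have "s i \<in> squares" using s(2) by blast
    ultimately show ?thesis using d(1) unfolding l_coset_def by blast
  qed
  have "card (s ` ?I) = card ?I" by (rule card_image) (rule inj_on_subset[OF s(1)], simp)
  then have "n \<le> card (s ` ?I)" using x(2) by simp
  moreover have "s ` ?I \<subseteq> (x <# D) \<inter> squares" using sx by blast
  ultimately have "at_least n ((x <# D) \<inter> squares)"
    unfolding at_least_iff by (meson card_mono le_trans)
  then have "x \<in> good" using x(1) n by blast
  moreover have "?I \<noteq> {}" using x(2) by (metis card.empty not_less_eq_eq zero_le)
  ultimately show False by blast
qed

end

locale generic_ultrafilter = square_set G unif D
  for G (structure) and unif :: "'a set set \<Rightarrow> bool" and D :: "'a set" +
  fixes r :: "'a filter" and K :: nat
  assumes r_proper: "r \<noteq> bot"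
    and r_ultra: "eventually P r \<or> eventually (\<lambda>x. \<not> P x) r"
    and r_nonprincipal: "eventually (\<lambda>a. a \<noteq> x) r"
    and r_carrier: "eventually (\<lambda>a. a \<in> carrier G) r"
    and stable: "(\<And>i. i < K \<Longrightarrow> u i \<in> carrier G \<and> a i \<in> carrier G \<and> adj (u i) (a i)) \<Longrightarrow>
      \<exists>i<K. \<exists>j<K. i \<noteq> j \<and> adj (u i) (a j) \<and> adj (u j) (a i)"
begin

text \<open>The set \<open>T\<close> of the overview; \<open>Tm\<close> is its complement in the
  group.\<close>

definition Tp :: "'a set" where
  "Tp = {u \<in> carrier G. eventually (adj u) r}"

definition Tm :: "'a set" where
  "Tm = {u \<in> carrier G. \<not> eventually (adj u) r}"

text \<open>Typical points for \<open>r\<close>: voting along them decides membership in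
  \<open>Tp\<close> with fewer than \<open>K\<close> errors. They turn a statement \<open>W\<close>
  valid \<open>r\<close>-almost everywhere into a sequence of sets to which \<open>unif_meet\<close>
  applies.\<close>

definition majority_seq :: "('a \<Rightarrow> bool) \<Rightarrow> (nat \<Rightarrow> 'a) \<Rightarrow> bool" where
  "majority_seq W c \<longleftrightarrow> inj c \<and> (\<forall>n. c n \<in> carrier G \<and> W (c n)) \<and>
    (\<forall>N. \<forall>u\<in>Tp. card {i\<in>{..<N}. \<not> adj u (c i)} < K) \<and>
    (\<forall>N. \<forall>u\<in>Tm. card {i\<in>{..<N}. adj u (c i)} < K)"

lemma majority_seq_exists:
  assumes "eventually W r"
  shows "\<exists>c. majority_seq W c"
proof (rule stable_majority[OF r_proper r_ultra r_nonprincipal r_carrier stable assms])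
  fix c :: "nat \<Rightarrow> 'a"
  assume "inj c" "\<And>n. c n \<in> carrier G \<and> W (c n)"
    "\<And>N u. u \<in> carrier G \<Longrightarrow> eventually (\<lambda>a. adj u a) r \<Longrightarrow> card {i\<in>{..<N}. \<not> adj u (c i)} < K"
    "\<And>N u. u \<in> carrier G \<Longrightarrow> \<not> eventually (\<lambda>a. adj u a) r \<Longrightarrow> card {i\<in>{..<N}. adj u (c i)} < K"
  then have "majority_seq W c" unfolding majority_seq_def Tp_def Tm_def by blast
  then show "\<exists>c. majority_seq W c" by blast
qed

lemma majority_seqD:
  assumes "majority_seq W c"
  shows "inj c" "c n \<in> carrier G" "W (c n)"
    "u \<in> Tp \<Longrightarrow> card {i\<in>{..<N}. \<not> adj u (c i)} < K"
    "u \<in> Tm \<Longrightarrow> card {i\<in>{..<N}. adj u (c i)} < K"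
  using assms unfolding majority_seq_def by blast+

text \<open>Among \<open>2 * K\<close> votes an element of \<open>Tp\<close> has more than
  \<open>K\<close> in favour and an element of \<open>Tm\<close> fewer than \<open>K\<close>. So
  \<open>Tp\<close> is a finite union of finite intersections of translates of
  \<open>good\<close>.\<close>

lemma definable_Tp: "unif {Tp}"
proof -
  obtain c where c: "majority_seq (\<lambda>_. True) c"
    using majority_seq_exists[of "\<lambda>_. True"] by auto
  note cG = majority_seqD(2)[OF c]
  let ?JJ = "{J. J \<subseteq> {..<2 * K} \<and> K \<le> card J}"
  have "unif {{x \<in> carrier G. \<exists>J\<in>?JJ. x \<in> {x \<in> carrier G. \<forall>i\<in>J. x \<in> c i <# good}}}"
    using cG by (intro definable_Union definable_Inter definable_translate definable_good)
      (auto intro: finite_subset)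
  moreover have "u \<in> Tp \<longleftrightarrow> (\<exists>J\<in>?JJ. u \<in> {x \<in> carrier G. \<forall>i\<in>J. x \<in> c i <# good})"
    if u: "u \<in> carrier G" for u
  proof -
    have adj: "u \<in> c i <# good \<longleftrightarrow> adj u (c i)" for i
      using mem_l_coset[OF good_carrier cG u] unfolding adj_def by blast
    let ?I = "{i\<in>{..<2 * K}. adj u (c i)}"
    have "?I \<union> {i\<in>{..<2 * K}. \<not> adj u (c i)} = {..<2 * K}" by blast
    then have sum: "card ?I + card {i\<in>{..<2 * K}. \<not> adj u (c i)} = 2 * K"
      by (subst card_Un_disjoint[symmetric]) (auto simp del: Un_iff)
    show ?thesis
    proof
      assume "u \<in> Tp"
      then have "K \<le> card ?I" using majority_seqD(4)[OF c, of u "2 * K"] sum by linarith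
      then show "\<exists>J\<in>?JJ. u \<in> {x \<in> carrier G. \<forall>i\<in>J. x \<in> c i <# good}"
        using u adj by (intro bexI[of _ ?I]) auto
    next
      assume "\<exists>J\<in>?JJ. u \<in> {x \<in> carrier G. \<forall>i\<in>J. x \<in> c i <# good}"
      then obtain J where J: "J \<subseteq> {..<2 * K}" "K \<le> card J" "\<forall>i\<in>J. u \<in> c i <# good" by blast
      then have "J \<subseteq> ?I" using adj by blast
      then have "K \<le> card ?I" using J(2) card_mono[of ?I J] by simp
      then show "u \<in> Tp" using majority_seqD(5)[OF c, of u "2 * K"] u unfolding Tp_def Tm_def by force
    qed
  qed
  then have "{x \<in> carrier G. \<exists>J\<in>?JJ. x \<in> {x \<in> carrier G. \<forall>i\<in>J. x \<in> c i <# good}} = Tp"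
    unfolding Tp_def by blast
  ultimately show ?thesis by simp
qed

lemma definable_Tm: "unif {Tm}"
proof -
  have "Tm = carrier G - Tp" unfolding Tp_def Tm_def by blast
  then show ?thesis using definable_diff[OF definable_carrier definable_Tp] by simp
qed

lemma definable_bad: "unif {D - good}"
  by (rule definable_diff[OF definable_D definable_good])

lemma bad_carrier: "D - good \<subseteq> carrier G"
  using D_carrier by blast

lemma Tm_carrier: "Tm \<subseteq> carrier G"
  unfolding Tm_def by blast

text \<open>A point shared by \<open>Suc K\<close> of the sets
  \<open>(c i <# (D - good)) \<inter> Tp\<close> is unrelated to all those \<open>c i\<close>, which
  is more errors than an element of \<open>Tp\<close> may have.\<close>

lemma not_eventually_Tp: "\<not> eventually (\<lambda>g. infinite ((g <# (D - good)) \<inter> Tp)) r"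
proof
  assume ev: "eventually (\<lambda>g. infinite ((g <# (D - good)) \<inter> Tp)) r"
  obtain c where c: "majority_seq (\<lambda>g. infinite ((g <# (D - good)) \<inter> Tp)) c"
    using majority_seq_exists[OF ev] ..
  note cG = majority_seqD(2)[OF c]
  let ?\<D> = "{C \<inter> E | C E. C \<in> {g <# C | g C. g \<in> carrier G \<and> C \<in> {D - good}} \<and> E \<in> {Tp}}"
  obtain N where N: "\<forall>F::nat \<Rightarrow> 'a set. (\<forall>i<N. F i \<in> ?\<D> \<and> at_least N (F i)) \<longrightarrow>
      (\<exists>x\<in>carrier G. Suc K \<le> card {i\<in>{..<N}. x \<in> F i})"
    using unif_meet[OF unif_inter[OF unif_translates[OF definable_bad] definable_Tp], of "Suc K"] ..
  have "\<forall>i<N. (c i <# (D - good)) \<inter> Tp \<in> ?\<D> \<and> at_least N ((c i <# (D - good)) \<inter> Tp)"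
    using cG infinite_at_least[OF majority_seqD(3)[OF c]] by blast
  from mp[OF spec[OF N] this] obtain x where
    x: "x \<in> carrier G" "Suc K \<le> card {i\<in>{..<N}. x \<in> (c i <# (D - good)) \<inter> Tp}" (is "_ \<le> card ?I")
    by (elim bexE)
  then obtain i0 where "i0 \<in> ?I" by (metis card.empty ex_in_conv not_less_eq_eq zero_le)
  then have xT: "x \<in> Tp" by blast
  have "?I \<subseteq> {i\<in>{..<N}. \<not> adj x (c i)}"
    using mem_l_coset[OF bad_carrier cG x(1)] unfolding adj_def by blast
  then have "card ?I \<le> card {i\<in>{..<N}. \<not> adj x (c i)}" by (intro card_mono) auto
  then show False using x(2) majority_seqD(4)[OF c xT, of N] by simp
qed

text \<open>Candidates for the fixed element \<open>h = gx\<^sup>2\<close> of the overview.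
  Infinitely many bad \<open>z\<close> with \<open>hz\<^sup>-\<^sup>1\<close> outside
  \<open>T\<close> are required so that finitely many exceptions can be avoided later.\<close>

definition Y :: "'a set" where
  "Y = {h \<in> carrier G. infinite ((h <# ((\<lambda>x. inv x) ` (D - good))) \<inter> Tm)}"

lemma definable_inv_bad: "unif {(\<lambda>x. inv x) ` (D - good)}"
  by (rule definable_inv[OF definable_bad])

lemma Y_threshold:
  obtains n where "Y = {h \<in> carrier G. at_least n ((h <# ((\<lambda>x. inv x) ` (D - good))) \<inter> Tm)}"
proof -
  let ?B = "(\<lambda>x. inv x) ` (D - good)"
  let ?\<D> = "{C \<inter> E | C E. C \<in> {g <# C | g C. g \<in> carrier G \<and> C \<in> {?B}} \<and> E \<in> {Tm}}"
  obtain n where n: "\<forall>C\<in>?\<D>. at_least n C \<longrightarrow> infinite C"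
    using threshold[OF unif_inter[OF unif_translates[OF definable_inv_bad] definable_Tm]] ..
  have "infinite ((x <# ?B) \<inter> Tm) \<longleftrightarrow> at_least n ((x <# ?B) \<inter> Tm)" if "x \<in> carrier G" for x
  proof -
    have "(x <# ?B) \<inter> Tm \<in> ?\<D>" using that by blast
    then show ?thesis using n infinite_at_least by blast
  qed
  then show thesis by (intro that) (auto simp: Y_def)
qed

lemma definable_Y: "unif {Y}"
proof -
  obtain n where "Y = {h \<in> carrier G. at_least n ((h <# ((\<lambda>x. inv x) ` (D - good))) \<inter> Tm)}"
    by (rule Y_threshold)
  then show ?thesis using unif_count[OF definable_inv_bad definable_Tm, of n] by simp
qed

text \<open>For \<open>h = gx\<^sup>2\<close> the product \<open>gx\<close> equals
  \<open>hx\<^sup>-\<^sup>1\<close>. If one \<open>h\<close> outside \<open>Y\<close> arose in this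
  way from more than \<open>n\<close> terms \<open>g\<close>, the products \<open>gx\<close> would
  be too many elements of a set that the threshold for \<open>Y\<close> bounds.\<close>

lemma eventually_Y:
  assumes ev: "eventually (\<lambda>g. infinite ((g <# (D - good)) \<inter> Tm)) r"
  shows "eventually (\<lambda>g. infinite ((g <# squares) \<inter> Y)) r"
proof (rule ccontr)
  assume "\<not> ?thesis"
  then have "eventually (\<lambda>g. finite ((g <# squares) \<inter> Y)) r"
    using r_ultra[of "\<lambda>g. infinite ((g <# squares) \<inter> Y)"] by simp
  with ev have "eventually (\<lambda>g. infinite ((g <# (D - good)) \<inter> Tm) \<and> finite ((g <# squares) \<inter> Y)) r"
    by (rule eventually_conj)
  then obtain c where
    c: "majority_seq (\<lambda>g. infinite ((g <# (D - good)) \<inter> Tm) \<and> finite ((g <# squares) \<inter> Y)) c"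
    using majority_seq_exists by blast
  note cG = majority_seqD(2)[OF c]
  obtain n where n: "Y = {h \<in> carrier G. at_least n ((h <# ((\<lambda>x. inv x) ` (D - good))) \<inter> Tm)}"
    by (rule Y_threshold)
  define S where "S g = {x \<in> D - good. g \<otimes> x \<in> Tm}" for g
  \<comment> \<open>The values \<open>gx\<^sup>2\<close> that violate the claim. The families below
    record, operation by operation, that the sets \<open>V g\<close> are uniformly definable in
    \<open>g\<close>.\<close>
  define V where "V g = (g <# ((\<lambda>x. x \<otimes> x) ` S g)) - Y" for g
  let ?\<T> = "{g <# C | g C. g \<in> carrier G \<and> C \<in> {Tm}}"
  let ?\<S> = "{C \<inter> E | C E. C \<in> {D - good} \<and> E \<in> ?\<T>}"
  let ?\<Q> = "{(\<lambda>x. x \<otimes> x) ` C | C. C \<in> ?\<S>}"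
  let ?\<V> = "{C - E | C E. C \<in> {g <# C | g C. g \<in> carrier G \<and> C \<in> ?\<Q>} \<and> E \<in> {Y}}"
  have u: "unif ?\<V>"
    by (intro unif_diff unif_translates unif_square unif_inter definable_bad definable_Tm definable_Y)
  have S_eq: "S g = (D - good) \<inter> (inv g <# Tm)" if "g \<in> carrier G" for g
    using that mem_l_coset[OF Tm_carrier inv_closed[OF that]] D_carrier unfolding S_def by auto
  have V: "V g \<in> ?\<V>" if g: "g \<in> carrier G" for g
  proof -
    have 1: "inv g <# Tm \<in> ?\<T>" using g by blast
    have 2: "S g \<in> ?\<S>"
      by (rule CollectI, rule exI, rule exI, rule conjI[OF S_eq[OF g]], rule conjI[OF singletonI 1])
    have 3: "(\<lambda>x. x \<otimes> x) ` S g \<in> ?\<Q>"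
      by (rule CollectI, rule exI, rule conjI[OF refl 2])
    have 4: "g <# ((\<lambda>x. x \<otimes> x) ` S g) \<in> {g <# C | g C. g \<in> carrier G \<and> C \<in> ?\<Q>}"
      by (rule CollectI, rule exI, rule exI, rule conjI[OF refl], rule conjI[OF g 3])
    show ?thesis
      by (rule CollectI, rule exI, rule exI, rule conjI[OF V_def], rule conjI[OF 4 singletonI])
  qed
  have S_D: "S g \<subseteq> D" for g unfolding S_def by blast
  \<comment> \<open>Squaring is finite-to-one, so the infinite set \<open>S (c i)\<close> gives
    infinitely many values, and by the choice of \<open>c\<close> only finitely many of them lie in
    \<open>Y\<close>.\<close>
  have V_inf: "infinite (V (c i))" for i
  proof
    assume fin: "finite (V (c i))"
    have "(c i <# (D - good)) \<inter> Tm \<subseteq> (\<lambda>x. c i \<otimes> x) ` S (c i)"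
      unfolding S_def l_coset_def by blast
    then have "infinite (S (c i))" using majority_seqD(3)[OF c] finite_subset finite_imageI by metis
    then have "infinite ((\<lambda>x. x \<otimes> x) ` S (c i))" by (rule infinite_squares[OF S_D])
    moreover have sq: "(\<lambda>x. x \<otimes> x) ` S (c i) \<subseteq> squares" unfolding squares_def using S_D by blast
    ultimately have "infinite (c i <# ((\<lambda>x. x \<otimes> x) ` S (c i)))"
      using infinite_l_coset cG squares_carrier by (metis subset_trans)
    moreover have "c i <# ((\<lambda>x. x \<otimes> x) ` S (c i)) \<subseteq> V (c i) \<union> ((c i <# squares) \<inter> Y)"
      using sq unfolding V_def l_coset_def by blast
    ultimately show False using fin majority_seqD(3)[OF c] finite_subset by (metis finite_UnI)
  qed
  obtain N where N: "\<forall>F::nat \<Rightarrow> 'a set. (\<forall>i<N. F i \<in> ?\<V> \<and> at_least N (F i)) \<longrightarrow>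
      (\<exists>x\<in>carrier G. Suc n \<le> card {i\<in>{..<N}. x \<in> F i})"
    using unif_meet[OF u, of "Suc n"] ..
  have "\<forall>i<N. V (c i) \<in> ?\<V> \<and> at_least N (V (c i))"
    by (intro allI impI conjI V cG infinite_at_least V_inf)
  from mp[OF spec[OF N] this] obtain h where
    h: "h \<in> carrier G" "Suc n \<le> card {i\<in>{..<N}. h \<in> V (c i)}" (is "_ \<le> card ?I")
    by (elim bexE)
  then obtain i0 where "i0 \<in> ?I" by (metis card.empty ex_in_conv not_less_eq_eq zero_le)
  then have hY: "h \<notin> Y" unfolding V_def by blast
  have "\<exists>x. x \<in> S (c i) \<and> h = c i \<otimes> (x \<otimes> x)" if "i \<in> ?I" for i
    using that unfolding V_def l_coset_def by blast
  then obtain x where x: "\<And>i. i \<in> ?I \<Longrightarrow> x i \<in> S (c i) \<and> h = c i \<otimes> (x i \<otimes> x i)" by metis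
  have xG: "x i \<in> carrier G" if "i \<in> ?I" for i using x[OF that] S_D D_carrier by blast
  have cx: "c i \<otimes> x i = h \<otimes> inv (x i)" if "i \<in> ?I" for i
    using x[OF that] xG[OF that] cG by (simp add: m_assoc)
  \<comment> \<open>Equal products with the same \<open>h\<close> force equal \<open>x i\<close>,
    then equal \<open>c i\<close>, and \<open>c\<close> is injective.\<close>
  have "inj_on (\<lambda>i. c i \<otimes> x i) ?I"
  proof (rule inj_onI)
    fix i j assume ij: "i \<in> ?I" "j \<in> ?I" "c i \<otimes> x i = c j \<otimes> x j"
    then have "h \<otimes> inv (x i) = h \<otimes> inv (x j)" using cx by simp
    then have "x i = x j" using h(1) xG ij(1,2) by (simp add: inv_inj[THEN inj_on_eq_iff])
    then have "c i = c j" using ij xG cG by simp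
    then show "i = j" using majority_seqD(1)[OF c] by (simp add: inj_eq)
  qed
  then have "card ((\<lambda>i. c i \<otimes> x i) ` ?I) = card ?I" by (rule card_image)
  then have "n \<le> card ((\<lambda>i. c i \<otimes> x i) ` ?I)" using h(2) by simp
  moreover have "(\<lambda>i. c i \<otimes> x i) ` ?I \<subseteq> (h <# ((\<lambda>x. inv x) ` (D - good))) \<inter> Tm"
  proof
    fix y assume "y \<in> (\<lambda>i. c i \<otimes> x i) ` ?I"
    then obtain i where i: "i \<in> ?I" "y = c i \<otimes> x i" by blast
    then have "y \<in> Tm" "x i \<in> D - good" using x[OF i(1)] unfolding S_def by auto
    then show "y \<in> (h <# ((\<lambda>x. inv x) ` (D - good))) \<inter> Tm"
      using cx[OF i(1)] i(2) unfolding l_coset_def by blast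
  qed
  ultimately have "at_least n ((h <# ((\<lambda>x. inv x) ` (D - good))) \<inter> Tm)"
    unfolding at_least_iff by (meson card_mono le_trans)
  then show False using hY h(1) n by blast
qed

text \<open>Some \<open>h\<close> in \<open>Y\<close> has the form \<open>c i \<otimes> s\<close>
  with an unexceptional square \<open>s\<close> for \<open>Suc K\<close> indices \<open>i\<close>.
  For each of them all but finitely many \<open>u = hz\<^sup>-\<^sup>1\<close>, \<open>z\<close> in
  \<open>D\<close>, are related to \<open>c i\<close>. As infinitely many such \<open>u\<close> with
  bad \<open>z\<close> lie in \<open>Tm\<close>, one of them is related to all these
  \<open>c i\<close>, which is too many.\<close>

lemma not_eventually_Tm: "\<not> eventually (\<lambda>g. infinite ((g <# (D - good)) \<inter> Tm)) r"
proof
  assume "eventually (\<lambda>g. infinite ((g <# (D - good)) \<inter> Tm)) r"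
  then have ev: "eventually (\<lambda>g. infinite ((g <# squares) \<inter> Y)) r" by (rule eventually_Y)
  obtain c where c: "majority_seq (\<lambda>g. infinite ((g <# squares) \<inter> Y)) c"
    using majority_seq_exists[OF ev] ..
  note cG = majority_seqD(2)[OF c]
  let ?inv = "\<lambda>B. (\<lambda>x. inv x) ` B"
  define Z where "Z = {s \<in> squares. infinite ((s <# (?inv D)) - good)}"
  have Z: "finite Z" "Z \<subseteq> squares" unfolding Z_def using finite_exceptional_squares by blast+
  have "unif {{z} | z. z \<in> Z}" by (rule unif_subset[OF unif_singletons]) (use Z(2) squares_carrier in blast)
  then have "unif {{x \<in> carrier G. \<exists>z\<in>Z. x \<in> {z}}}"
    using Z(1) by (intro definable_Union) (auto elim: unif_subset)
  moreover have "{x \<in> carrier G. \<exists>z\<in>Z. x \<in> {z}} = Z" using Z(2) squares_carrier by auto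
  ultimately have "unif {Z}" by simp
  then have definable: "unif {squares - Z}" by (rule definable_diff[OF definable_squares])
  let ?\<D> = "{C \<inter> E | C E. C \<in> {g <# C | g C. g \<in> carrier G \<and> C \<in> {squares - Z}} \<and> E \<in> {Y}}"
  obtain N where N: "\<forall>F::nat \<Rightarrow> 'a set. (\<forall>i<N. F i \<in> ?\<D> \<and> at_least N (F i)) \<longrightarrow>
      (\<exists>x\<in>carrier G. Suc K \<le> card {i\<in>{..<N}. x \<in> F i})"
    using unif_meet[OF unif_inter[OF unif_translates[OF definable] definable_Y], of "Suc K"] ..
  \<comment> \<open>Only finitely many squares are exceptional, so leaving them out preserves
    infinity.\<close>
  have F_inf: "infinite ((c i <# (squares - Z)) \<inter> Y)" for i
  proof
    assume "finite ((c i <# (squares - Z)) \<inter> Y)"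
    moreover have "finite (c i <# Z)" using infinite_l_coset Z squares_carrier cG by (metis subset_trans)
    moreover have "(c i <# squares) \<inter> Y \<subseteq> ((c i <# (squares - Z)) \<inter> Y) \<union> (c i <# Z)"
      unfolding l_coset_def by blast
    ultimately show False using majority_seqD(3)[OF c] finite_subset by (metis finite_UnI)
  qed
  have "\<forall>i<N. (c i <# (squares - Z)) \<inter> Y \<in> ?\<D> \<and> at_least N ((c i <# (squares - Z)) \<inter> Y)"
    using cG infinite_at_least[OF F_inf] by blast
  from mp[OF spec[OF N] this] obtain h where
    h: "h \<in> carrier G" "Suc K \<le> card {i\<in>{..<N}. h \<in> (c i <# (squares - Z)) \<inter> Y}" (is "_ \<le> card ?I")
    by (elim bexE)
  then obtain i0 where "i0 \<in> ?I" by (metis card.empty ex_in_conv not_less_eq_eq zero_le)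
  then have "infinite ((h <# (?inv (D - good))) \<inter> Tm)" unfolding Y_def by blast
  moreover have fin: "finite {u \<in> h <# (?inv D). \<not> adj u (c i)}" if i: "i \<in> ?I" for i
  proof -
    let ?s = "inv (c i) \<otimes> h"
    have invD: "?inv D \<subseteq> carrier G" using D_carrier by auto
    have sub: "squares - Z \<subseteq> carrier G" using squares_carrier by blast
    have "?s \<in> squares - Z" using i mem_l_coset[OF sub cG h(1)] by blast
    then have "finite ((?s <# (?inv D)) - good)" unfolding Z_def by blast
    then have "finite ((\<lambda>y. c i \<otimes> y) ` ((?s <# (?inv D)) - good))" by simp
    moreover have "{u \<in> h <# (?inv D). \<not> adj u (c i)} \<subseteq> (\<lambda>y. c i \<otimes> y) ` ((?s <# (?inv D)) - good)"
    proof
      fix u assume u: "u \<in> {u \<in> h <# (?inv D). \<not> adj u (c i)}"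
      then obtain d where d: "d \<in> ?inv D" "u = h \<otimes> d" unfolding l_coset_def by blast
      have dG: "d \<in> carrier G" using d(1) invD by blast
      have "inv (c i) \<otimes> u = ?s \<otimes> d" using d dG h(1) cG by (simp add: m_assoc)
      then have "inv (c i) \<otimes> u \<in> (?s <# (?inv D)) - good"
        using u d(1) unfolding adj_def l_coset_def by blast
      moreover have "u = c i \<otimes> (inv (c i) \<otimes> u)"
        using d dG h(1) cG by (simp add: m_assoc[symmetric])
      ultimately show "u \<in> (\<lambda>y. c i \<otimes> y) ` ((?s <# (?inv D)) - good)" by blast
    qed
    ultimately show ?thesis by (rule finite_subset[rotated])
  qed
  moreover have "finite ?I" by simp
  then have "finite (\<Union>i\<in>?I. {u \<in> h <# (?inv D). \<not> adj u (c i)})" using fin by blast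
  ultimately have "infinite ((h <# (?inv (D - good))) \<inter> Tm - (\<Union>i\<in>?I. {u \<in> h <# (?inv D). \<not> adj u (c i)}))"
    using Diff_infinite_finite by blast
  from infinite_imp_nonempty[OF this] obtain u where u: "u \<in> h <# (?inv (D - good))" "u \<in> Tm"
    "u \<notin> (\<Union>i\<in>?I. {u \<in> h <# (?inv D). \<not> adj u (c i)})"
    by blast
  have "u \<in> h <# (?inv D)" using u(1) unfolding l_coset_def by blast
  then have "?I \<subseteq> {i\<in>{..<N}. adj u (c i)}" using u(3) by blast
  then have "card ?I \<le> card {i\<in>{..<N}. adj u (c i)}" by (intro card_mono) auto
  then show False using h(2) majority_seqD(5)[OF c u(2), of N] by simp
qed

lemma finite_bad: "finite (D - good)"
proof (rule ccontr)
  assume inf: "infinite (D - good)"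
  have "infinite ((g <# (D - good)) \<inter> Tp) \<or> infinite ((g <# (D - good)) \<inter> Tm)" if g: "g \<in> carrier G" for g
  proof -
    have "g <# (D - good) \<subseteq> carrier G" by (rule l_coset_carrier[OF bad_carrier g])
    then have "g <# (D - good) = ((g <# (D - good)) \<inter> Tp) \<union> ((g <# (D - good)) \<inter> Tm)"
      unfolding Tp_def Tm_def by blast
    moreover have "infinite (g <# (D - good))" using infinite_l_coset[OF bad_carrier g] inf by blast
    ultimately show ?thesis by (metis finite_UnI)
  qed
  then have "eventually (\<lambda>g. infinite ((g <# (D - good)) \<inter> Tp) \<or> infinite ((g <# (D - good)) \<inter> Tm)) r"
    using r_carrier by (rule eventually_mono[rotated])
  moreover have "eventually (\<lambda>g. \<not> infinite ((g <# (D - good)) \<inter> Tp)) r"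
    using r_ultra not_eventually_Tp by blast
  ultimately have "eventually (\<lambda>g. infinite ((g <# (D - good)) \<inter> Tm)) r"
    by eventually_elim blast
  then show False using not_eventually_Tm by blast
qed

end

section \<open>Existence of the generic ultrafilter\<close>

context square_set
begin

theorem finite_not_good: "finite (D - good)"
proof -
  have "inf cofinite (principal (carrier G)) \<noteq> bot"
    using infinite_carrier by (simp add: trivial_limit_def eventually_inf_principal eventually_cofinite)
  then obtain r where r: "r \<le> inf cofinite (principal (carrier G))" "r \<noteq> bot"
    "\<And>P. eventually P r \<or> eventually (\<lambda>x. \<not> P x) r" by (rule ultrafilter_exists) blast
  obtain K :: nat where K: "\<And>u a. (\<And>i. i < K \<Longrightarrow> u i \<in> carrier G \<and> a i \<in> carrier G \<and> adj (u i) (a i)) \<Longrightarrow>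
      \<exists>i<K. \<exists>j<K. i \<noteq> j \<and> adj (u i) (a j) \<and> adj (u j) (a i)" using adj_stable by blast
  have ev: "eventually P r" if "finite {x. \<not> (x \<in> carrier G \<longrightarrow> P x)}" for P
    using that r(1) by (auto simp: le_filter_def eventually_inf_principal eventually_cofinite)
  interpret generic_ultrafilter G unif D r K
    by unfold_locales (use r K in \<open>auto intro!: ev\<close>)
  show ?thesis by (rule finite_bad)
qed

end

section \<open>Generic elements and independence\<close>

lemma holds_Neg: "holds M (Neg \<phi>) as \<longleftrightarrow> \<not> holds M \<phi> as"
  by (simp add: holds_def)

lemma realizations_singleton:
  "realizations M 1 \<theta> = (\<lambda>a. [a]) ` {a \<in> Univ M. holds M (fst \<theta>) (a # snd \<theta>)}"
  by (auto simp: realizations_def tuples_def length_Suc_conv)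

text \<open>Rank one speaks of dividing over the empty set, whereas independence over
  \<open>A\<close> involves dividing over \<open>A\<close>; this connects the two.\<close>

lemma indiscernible_empty: "indiscernible L M A m b \<Longrightarrow> indiscernible L M {} m b"
proof -
  assume ind: "indiscernible L M A m b"
  have tp: "tp L M as {} = {\<theta> \<in> tp L M as A. snd \<theta> = []}" for as
    by (auto simp: tp_def pformulas_def)
  show ?thesis unfolding indiscernible_def tp
  proof (intro conjI allI impI)
    show "b k \<in> tuples (Univ M) m" for k using ind unfolding indiscernible_def by blast
    fix "is" js :: "nat list"
    assume "sorted_wrt (<) is \<and> sorted_wrt (<) js \<and> length is = length js"
    then have "tp L M (concat (map b is)) A = tp L M (concat (map b js)) A"
      using ind unfolding indiscernible_def by blast
    then show "{\<theta> \<in> tp L M (concat (map b is)) A. snd \<theta> = []} =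
        {\<theta> \<in> tp L M (concat (map b js)) A. snd \<theta> = []}" by simp
  qed
qed

context saturated_structure
begin

lemma fiber_params:
  assumes P: "dpred L M P" and e: "range e \<subseteq> Univ M"
  obtains \<theta> where "\<theta> \<in> pformulas L (set (snd \<theta>)) 1" "set (snd \<theta>) \<subseteq> Univ M"
    "realizations M 1 \<theta> = (\<lambda>a. [a]) ` fiber M P e"
proof -
  obtain m where "depends M m P" using dpred_depends[OF P] by blast
  then have m: "depends M (Suc m) P" by (rule depends_mono) simp
  obtain \<phi> where \<phi>: "\<phi> \<in> formulas L (Suc m)" "\<And>e. range e \<subseteq> Univ M \<Longrightarrow> sat M e \<phi> = P e"
    using dpred_formula[OF P m] by blast
  let ?\<theta> = "(\<phi>, map e [0..<m])"
  have "holds M \<phi> (a # map e [0..<m]) = P (case_nat a e)" if "a \<in> Univ M" for a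
  proof -
    have "holds M \<phi> (a # map e [0..<m]) = sat M (case_nat a e) \<phi>"
      using \<phi>(1) by (intro holds_eq_sat[of _ L]) (auto simp: nth_Cons split: nat.split)
    then show ?thesis using \<phi>(2)[OF range_case_nat[OF that e]] by simp
  qed
  then have "realizations M 1 ?\<theta> = (\<lambda>a. [a]) ` fiber M P e"
    unfolding realizations_singleton fiber_def by auto
  moreover have "?\<theta> \<in> pformulas L (set (snd ?\<theta>)) 1" using \<phi>(1) by (simp add: pformulas_def)
  moreover have "set (snd ?\<theta>) \<subseteq> Univ M" using e by auto
  ultimately show thesis using that by blast
qed

text \<open>Saturation realises membership in the fiber together with the negations of all algebraic
  formulas over \<open>C\<close>; finitely many finite sets cannot cover an infinite fiber.\<close>

lemma generic_exists:
  assumes C: "C \<subseteq> Univ M" "|C| <o \<kappa>" and P: "dpred L M P" "range e \<subseteq> Univ M"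
    and inf: "infinite (fiber M P e)"
  obtains x where "x \<in> fiber M P e" "generic L M C x"
proof -
  obtain \<theta>0 where \<theta>0: "\<theta>0 \<in> pformulas L (set (snd \<theta>0)) 1" "set (snd \<theta>0) \<subseteq> Univ M"
    "realizations M 1 \<theta>0 = (\<lambda>a. [a]) ` fiber M P e" using fiber_params[OF P] by blast
  define F where "F = {\<theta> \<in> pformulas L C 1. finite (realizations M 1 \<theta>)}"
  define p where "p = insert \<theta>0 ((\<lambda>\<theta>. (Neg (fst \<theta>), snd \<theta>)) ` F)"
  have neg: "[a] \<in> realizations M 1 (Neg (fst \<theta>), snd \<theta>) \<longleftrightarrow> [a] \<notin> realizations M 1 \<theta>"
    if "a \<in> Univ M" for a \<theta>
    using that unfolding realizations_singleton singleton_list_image by (simp add: holds_Neg)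
  let ?C = "C \<union> set (snd \<theta>0)"
  have "p \<subseteq> pformulas L ?C 1"
    using \<theta>0(1) unfolding p_def F_def pformulas_def formulas_def by auto
  moreover have "\<exists>a\<in>Univ M. \<forall>\<theta>\<in>q. [a] \<in> realizations M 1 \<theta>" if q: "finite q" "q \<subseteq> p" for q
  proof -
    have "q - {\<theta>0} \<subseteq> (\<lambda>\<theta>. (Neg (fst \<theta>), snd \<theta>)) ` F" using q(2) unfolding p_def by blast
    from finite_subset_image[OF finite_Diff[OF q(1)] this] obtain F0 where
      F0: "F0 \<subseteq> F" "finite F0" "q - {\<theta>0} = (\<lambda>\<theta>. (Neg (fst \<theta>), snd \<theta>)) ` F0"
      by (elim exE conjE)
    have "finite (\<Union>\<theta>\<in>F0. realizations M 1 \<theta>)" using F0(1,2) unfolding F_def by blast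
    moreover have "infinite ((\<lambda>a. [a]) ` fiber M P e)"
      using inf finite_imageD[of "\<lambda>a. [a]" "fiber M P e"] by (auto simp: inj_on_def)
    ultimately have "infinite ((\<lambda>a. [a]) ` fiber M P e - (\<Union>\<theta>\<in>F0. realizations M 1 \<theta>))"
      using Diff_infinite_finite by blast
    from infinite_imp_nonempty[OF this] obtain a where
      a: "a \<in> fiber M P e" "\<And>\<theta>. \<theta> \<in> F0 \<Longrightarrow> [a] \<notin> realizations M 1 \<theta>" by blast
    have aU: "a \<in> Univ M" using a(1) unfolding fiber_def by blast
    have "[a] \<in> realizations M 1 \<theta>" if "\<theta> \<in> q" for \<theta>
    proof (cases "\<theta> = \<theta>0")
      case True
      then show ?thesis using a(1) \<theta>0(3) by blast
    next
      case False
      then have "\<theta> \<in> q - {\<theta>0}" using that by simp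
      then have "\<theta> \<in> (\<lambda>\<theta>. (Neg (fst \<theta>), snd \<theta>)) ` F0" unfolding F0(3) .
      then obtain \<theta>' where "\<theta> = (Neg (fst \<theta>'), snd \<theta>')" "\<theta>' \<in> F0" by (rule imageE)
      then show ?thesis using neg[OF aU] a(2) by blast
    qed
    then show ?thesis using aU by blast
  qed
  moreover have "?C \<subseteq> Univ M" using C(1) \<theta>0(2) by blast
  moreover have "|?C| <o \<kappa>" by (rule small_union_finite[OF C(2)]) simp
  ultimately have "\<exists>a\<in>Univ M. \<forall>\<theta>\<in>p. [a] \<in> realizations M 1 \<theta>"
    using saturation unfolding sufficiently_saturated_def saturated_def by blast
  then obtain a where a: "a \<in> Univ M" "\<forall>\<theta>\<in>p. [a] \<in> realizations M 1 \<theta>" by blast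
  have "a \<in> fiber M P e" using a(2) \<theta>0(3) unfolding p_def by (simp add: singleton_list_image)
  moreover have "generic L M C a"
    unfolding generic_def
  proof (intro ballI notI)
    fix \<theta> assume "\<theta> \<in> tp L M [a] C" "finite (realizations M 1 \<theta>)"
    then have "\<theta> \<in> F" "[a] \<in> realizations M 1 \<theta>" unfolding F_def tp_def by simp_all
    moreover from this(1) have "[a] \<in> realizations M 1 (Neg (fst \<theta>), snd \<theta>)"
      using a(2) unfolding p_def by blast
    ultimately show False using neg[OF a(1)] by blast
  qed
  ultimately show thesis by (rule that)
qed

lemma generic_mono: "generic L M B x \<Longrightarrow> A \<subseteq> B \<Longrightarrow> generic L M A x"
  unfolding generic_def tp_def pformulas_def by fastforce

text \<open>Independence of \<open>{x}\<close> ranges over all tuples from \<open>{x}\<close>, which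
  are repetitions of \<open>x\<close>. Identifying the first \<open>n\<close> variables reduces them
  to one variable; for \<open>n = 0\<close> a dummy variable takes its place.\<close>

lemma diagonal_formula:
  assumes "\<phi> \<in> formulas L (n + l)"
  obtains \<phi>' where "\<phi>' \<in> formulas L (Suc l)"
    "\<And>a bs. a \<in> Univ M \<Longrightarrow> bs \<in> tuples (Univ M) l \<Longrightarrow>
      holds M \<phi>' (a # bs) = holds M \<phi> (replicate n a @ bs)"
proof -
  let ?f = "\<lambda>i. if i < n then 0 else Suc (i - n)"
  have wf: "wf_fm L \<phi>" "free_vars \<phi> \<subseteq> {..<n + l}" using assms unfolding formulas_def by auto
  have d: "dpred L M (\<lambda>e. sat M (e \<circ> ?f) \<phi>)" by (rule dpred_subst[OF dpred_sat[OF wf(1)]])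
  have "depends M (Suc l) (\<lambda>e. sat M (e \<circ> ?f) \<phi>)"
    unfolding depends_def by (intro allI impI sat_cong) (use wf(2) in auto)
  from dpred_formula[OF d this] obtain \<phi>' where \<phi>': "\<phi>' \<in> formulas L (Suc l)"
    "\<And>e. range e \<subseteq> Univ M \<Longrightarrow> sat M e \<phi>' = sat M (e \<circ> ?f) \<phi>" by blast
  have "holds M \<phi>' (a # bs) = holds M \<phi> (replicate n a @ bs)"
    if a: "a \<in> Univ M" and bs: "bs \<in> tuples (Univ M) l" for a bs
  proof -
    define e where "e i = (if i < Suc l then (a # bs) ! i else a)" for i
    have l: "length bs = l" "set bs \<subseteq> Univ M" using bs unfolding tuples_def by auto
    have "(a # bs) ! i \<in> Univ M" if "i < Suc l" for i
      using that a l nth_mem[of i "a # bs"] by auto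
    then have r: "range e \<subseteq> Univ M" using a unfolding e_def by auto
    have "holds M \<phi>' (a # bs) = sat M e \<phi>'"
      using \<phi>'(1) l by (intro holds_eq_sat[of _ L]) (auto simp: e_def)
    also have "\<dots> = sat M (e \<circ> ?f) \<phi>" by (rule \<phi>'(2)[OF r])
    also have "\<dots> = holds M \<phi> (replicate n a @ bs)"
      using assms l by (intro holds_eq_sat[of _ L, symmetric]) (auto simp: e_def nth_append)
    finally show ?thesis .
  qed
  then show thesis using that \<phi>'(1) by blast
qed

end

context rank_one_structure
begin

text \<open>On the diagonal the instances along the given indiscernible sequence remain
  inconsistent, so the one-variable formula divides over the empty set and rank one applies.\<close>

lemma dividing_diagonal_finite:
  assumes "\<psi> \<in> pformulas L (Univ M) n" "divides L M A n \<psi>"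
  shows "finite {a \<in> Univ M. replicate n a \<in> realizations M n \<psi>}"
proof -
  obtain \<phi> bs where \<psi>: "\<psi> = (\<phi>, bs)" by (cases \<psi>)
  obtain b where b: "indiscernible L M A (length bs) b" "b 0 = bs" "(\<Inter>k. realizations M n (\<phi>, b k)) = {}"
    using assms(2) unfolding divides_def \<psi> by auto
  have bk: "b k \<in> tuples (Univ M) (length bs)" for k using b(1) unfolding indiscernible_def by blast
  have "\<phi> \<in> formulas L (n + length bs)" using assms(1) unfolding \<psi> pformulas_def by simp
  from diagonal_formula[OF this] obtain \<phi>' where \<phi>': "\<phi>' \<in> formulas L (Suc (length bs))"
    "\<And>a cs. a \<in> Univ M \<Longrightarrow> cs \<in> tuples (Univ M) (length bs) \<Longrightarrow>
      holds M \<phi>' (a # cs) = holds M \<phi> (replicate n a @ cs)" by blast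
  have R: "realizations M 1 (\<phi>', b k) = (\<lambda>a. [a]) ` {a \<in> Univ M. replicate n a \<in> realizations M n (\<phi>, b k)}" for k
  proof -
    have "holds M \<phi>' (a # b k) \<longleftrightarrow> replicate n a \<in> realizations M n (\<phi>, b k)" if "a \<in> Univ M" for a
      using \<phi>'(2)[OF that bk[of k]] that by (auto simp: realizations_def tuples_def)
    then show ?thesis unfolding realizations_singleton by auto
  qed
  have "(\<Inter>k. realizations M 1 (\<phi>', b k)) = {}"
  proof (rule ccontr)
    assume "\<not> ?thesis"
    then obtain y where "y \<in> (\<Inter>k. realizations M 1 (\<phi>', b k))" by (metis all_not_in_conv)
    then have y: "y \<in> (\<lambda>a. [a]) ` {a \<in> Univ M. replicate n a \<in> realizations M n (\<phi>, b k)}" for k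
      using R[of k] by (metis INT_E UNIV_I)
    obtain a where "y = [a]" using imageE[OF y[of 0]] by metis
    then have "replicate n a \<in> realizations M n (\<phi>, b k)" for k
      using y[of k] singleton_list_image[of a] by simp
    then have "replicate n a \<in> (\<Inter>k. realizations M n (\<phi>, b k))" by (rule INT_I)
    then show False using b(3) by simp
  qed
  then have "divides L M {} 1 (\<phi>', bs)"
    unfolding divides_def using b(2) indiscernible_empty[OF b(1)] by (intro exI[of _ b]) simp
  moreover have "(\<phi>', bs) \<in> pformulas L (Univ M) 1"
    using assms(1) \<phi>'(1) unfolding \<psi> pformulas_def by simp
  ultimately have "finite (realizations M 1 (\<phi>', bs))"
    using rank_one unfolding supersimple_rank_1_def by blast
  then have "finite ((\<lambda>a. [a]) ` {a \<in> Univ M. replicate n a \<in> realizations M n \<psi>})"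
    using R[of 0] b(2) \<psi> by simp
  then show ?thesis by (rule finite_imageD) (auto simp: inj_on_def)
qed

text \<open>A forking formula is covered by finitely many dividing ones, so its diagonal is finite.
  If it held of repetitions of \<open>x\<close>, its diagonal formula would be an algebraic formula
  in the type of \<open>x\<close>.\<close>

lemma generic_independent:
  assumes A: "A \<subseteq> Univ M" "y \<in> Univ M" and x: "x \<in> Univ M" and gen: "generic L M (insert y A) x"
  shows "independent L M {x} A {y}"
  unfolding independent_def
proof (intro allI impI ballI notI)
  fix as \<theta>
  assume as: "set as \<subseteq> {x}" and \<theta>: "\<theta> \<in> tp L M as ({y} \<union> A)" and f: "forks L M A (length as) \<theta>"
  define n where "n = length as"
  have as_eq: "as = replicate n x" unfolding n_def using as by (intro replicate_eqI) auto
  obtain \<Psi> where \<Psi>: "finite \<Psi>" "\<Psi> \<subseteq> pformulas L (Univ M) n" "\<And>\<psi>. \<psi> \<in> \<Psi> \<Longrightarrow> divides L M A n \<psi>"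
    "realizations M n \<theta> \<subseteq> (\<Union>\<psi>\<in>\<Psi>. realizations M n \<psi>)"
    using f unfolding forks_def n_def by blast
  let ?diag = "\<lambda>\<psi>. {a \<in> Univ M. replicate n a \<in> realizations M n \<psi>}"
  have "finite (\<Union>\<psi>\<in>\<Psi>. ?diag \<psi>)"
    using \<Psi>(1,2,3) dividing_diagonal_finite by blast
  moreover have "?diag \<theta> \<subseteq> (\<Union>\<psi>\<in>\<Psi>. ?diag \<psi>)" using \<Psi>(4) by blast
  ultimately have fin: "finite (?diag \<theta>)" by (rule finite_subset[rotated])
  obtain \<phi> bs where \<theta>_eq: "\<theta> = (\<phi>, bs)" by (cases \<theta>)
  have \<phi>: "\<phi> \<in> formulas L (n + length bs)" "set bs \<subseteq> insert y A" "replicate n x \<in> realizations M n \<theta>"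
    using \<theta>[unfolded as_eq] unfolding \<theta>_eq tp_def pformulas_def by auto
  have bs: "bs \<in> tuples (Univ M) (length bs)" using \<phi>(2) A by (auto simp: tuples_def)
  obtain \<phi>' where \<phi>': "\<phi>' \<in> formulas L (Suc (length bs))"
    "\<And>a cs. a \<in> Univ M \<Longrightarrow> cs \<in> tuples (Univ M) (length bs) \<Longrightarrow>
      holds M \<phi>' (a # cs) = holds M \<phi> (replicate n a @ cs)" using diagonal_formula[OF \<phi>(1)] by blast
  have "holds M \<phi>' (a # bs) \<longleftrightarrow> replicate n a \<in> realizations M n \<theta>" if "a \<in> Univ M" for a
    using \<phi>'(2)[OF that bs] that unfolding \<theta>_eq by (auto simp: realizations_def tuples_def)
  then have R: "realizations M 1 (\<phi>', bs) = (\<lambda>a. [a]) ` ?diag \<theta>"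
    unfolding realizations_singleton by auto
  have "(\<phi>', bs) \<in> tp L M [x] (insert y A)"
    using R \<phi>(2,3) \<phi>'(1) x unfolding tp_def pformulas_def by auto
  then have "infinite (realizations M 1 (\<phi>', bs))" using gen unfolding generic_def by blast
  then show False using fin unfolding R by simp
qed

end

text \<open>The family need not contain every fiber of \<open>P\<close>, so subfamilies are again
  uniform; the parameters range over the whole structure.\<close>

definition uniformly_definable ::
    "('f, 'r) language \<Rightarrow> ('a, 'f, 'r) struct \<Rightarrow> 'a set set \<Rightarrow> bool" where
  "uniformly_definable L M \<D> \<longleftrightarrow>
     (\<exists>P. dpred L M P \<and> (\<forall>C\<in>\<D>. \<exists>e. range e \<subseteq> Univ M \<and> C = fiber M P e))"

lemma definable_set_over_uniform:
  assumes "definable_set_over L M A X" "A \<subseteq> Univ M" "Univ M \<noteq> {}"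
  shows "uniformly_definable L M {X}"
proof -
  obtain \<phi> bs where \<theta>: "(\<phi>, bs) \<in> pformulas L A 1" "(\<lambda>x. [x]) ` X = realizations M 1 (\<phi>, bs)"
    using assms(1) unfolding definable_set_over_def definable_over_def by auto
  obtain u where u: "u \<in> Univ M" using assms(3) by blast
  define e where "e i = (if i < length bs then bs ! i else u)" for i
  have bs: "set bs \<subseteq> Univ M" "\<phi> \<in> formulas L (Suc (length bs))"
    using \<theta>(1) assms(2) unfolding pformulas_def by auto
  have r: "range e \<subseteq> Univ M" using u bs(1) nth_mem unfolding e_def by auto
  have "holds M \<phi> (x # bs) = sat M (case_nat x e) \<phi>" for x
    using bs(2) by (intro holds_eq_sat[of _ L]) (auto simp: e_def nth_Cons split: nat.split)
  then have "(\<lambda>x. [x]) ` X = (\<lambda>x. [x]) ` fiber M (\<lambda>e. sat M e \<phi>) e"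
    unfolding \<theta>(2) realizations_singleton fiber_def by simp
  then have "X = fiber M (\<lambda>e. sat M e \<phi>) e" by (simp add: inj_image_eq_iff inj_def)
  moreover have "dpred L M (\<lambda>e. sat M e \<phi>)" using bs(2) by (intro dpred_sat) (simp add: formulas_def)
  ultimately show ?thesis using r unfolding uniformly_definable_def by blast
qed

text \<open>Interleaving two assignments, at even and odd positions, gives both families common
  parameters.\<close>

lemma uniformly_definable_merge:
  assumes "uniformly_definable L M \<D>" "uniformly_definable L M \<E>"
  obtains P Q where "dpred L M P" "dpred L M Q"
    "\<And>C E. C \<in> \<D> \<Longrightarrow> E \<in> \<E> \<Longrightarrow> \<exists>e. range e \<subseteq> Univ M \<and> C = fiber M P e \<and> E = fiber M Q e"
proof -
  obtain P where P: "dpred L M P" "\<And>C. C \<in> \<D> \<Longrightarrow> \<exists>e. range e \<subseteq> Univ M \<and> C = fiber M P e"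
    using assms(1) unfolding uniformly_definable_def by blast
  obtain Q where Q: "dpred L M Q" "\<And>C. C \<in> \<E> \<Longrightarrow> \<exists>e. range e \<subseteq> Univ M \<and> C = fiber M Q e"
    using assms(2) unfolding uniformly_definable_def by blast
  let ?P = "\<lambda>e. P (case_nat (e 0) (\<lambda>j. e (Suc (2 * j))))"
  let ?Q = "\<lambda>e. Q (case_nat (e 0) (\<lambda>j. e (Suc (Suc (2 * j)))))"
  show thesis
  proof (rule that)
    show "dpred L M ?P" by (rule dpred_block[OF P(1)])
    show "dpred L M ?Q" by (rule dpred_block[OF Q(1)])
    fix C E assume "C \<in> \<D>" "E \<in> \<E>"
    then obtain e1 e2 where e: "range e1 \<subseteq> Univ M" "C = fiber M P e1" "range e2 \<subseteq> Univ M" "E = fiber M Q e2"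
      using P(2) Q(2) by blast
    define e where "e k = (if even k then e1 (k div 2) else e2 (k div 2))" for k
    have "range e \<subseteq> Univ M" using e(1,3) unfolding e_def by auto
    moreover have "C = fiber M ?P e" "E = fiber M ?Q e" unfolding e(2,4) fiber_def e_def by auto
    ultimately show "\<exists>e. range e \<subseteq> Univ M \<and> C = fiber M ?P e \<and> E = fiber M ?Q e" by blast
  qed
qed

section \<open>Supersimple groups of rank one\<close>

locale rank_one_group = rank_one_structure \<kappa> L M + group G
  for \<kappa> :: "'k rel" and L :: "('f, 'r) language" and M :: "('a, 'f, 'r) struct"
    and G :: "('a, 'b) monoid_scheme" (structure) +
  assumes carrier_eq: "carrier G = Univ M"
    and dpred_mult: "dpred L M (\<lambda>e. e 0 \<otimes> e 1 = e 2)"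
    and dpred_inv: "dpred L M (\<lambda>e. inv (e 0) = e 1)"
begin

abbreviation unif :: "'a set set \<Rightarrow> bool" where
  "unif \<equiv> uniformly_definable L M"

section \<open>Closure properties of uniformly definable families in the group\<close>

lemma unif_subset: "unif \<D> \<Longrightarrow> \<E> \<subseteq> \<D> \<Longrightarrow> unif \<E>"
  unfolding uniformly_definable_def by blast

lemma unif_carrier: "unif \<D> \<Longrightarrow> C \<in> \<D> \<Longrightarrow> C \<subseteq> carrier G"
  unfolding uniformly_definable_def carrier_eq fiber_def by blast

lemma unif_inter:
  assumes "unif \<D>" "unif \<E>"
  shows "unif {C \<inter> E | C E. C \<in> \<D> \<and> E \<in> \<E>}"
proof -
  obtain P Q where PQ: "dpred L M P" "dpred L M Q"
    "\<And>C E. C \<in> \<D> \<Longrightarrow> E \<in> \<E> \<Longrightarrow> \<exists>e. range e \<subseteq> Univ M \<and> C = fiber M P e \<and> E = fiber M Q e"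
    using uniformly_definable_merge[OF assms] by blast
  have "\<exists>e. range e \<subseteq> Univ M \<and> C \<inter> E = fiber M (\<lambda>e. P e \<and> Q e) e" if CE: "C \<in> \<D>" "E \<in> \<E>" for C E
  proof -
    obtain e where "range e \<subseteq> Univ M" "C = fiber M P e" "E = fiber M Q e" using PQ(3)[OF CE] by blast
    then show ?thesis by (intro exI[of _ e]) (auto simp: fiber_def)
  qed
  then show ?thesis unfolding uniformly_definable_def using dpred_conj[OF PQ(1,2)] by blast
qed

lemma unif_compl:
  assumes "unif \<D>"
  shows "unif {carrier G - C | C. C \<in> \<D>}"
proof -
  obtain P where P: "dpred L M P" "\<And>C. C \<in> \<D> \<Longrightarrow> \<exists>e. range e \<subseteq> Univ M \<and> C = fiber M P e"
    using assms unfolding uniformly_definable_def by blast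
  have "\<exists>e. range e \<subseteq> Univ M \<and> carrier G - C = fiber M (\<lambda>e. \<not> P e) e" if C: "C \<in> \<D>" for C
  proof -
    obtain e where "range e \<subseteq> Univ M" "C = fiber M P e" using P(2)[OF C] by blast
    then show ?thesis by (intro exI[of _ e]) (auto simp: fiber_def carrier_eq)
  qed
  then show ?thesis unfolding uniformly_definable_def using dpred_neg[OF P(1)] by blast
qed

lemma unif_singletons: "unif {{g} | g. g \<in> carrier G}"
proof -
  have "\<exists>e. range e \<subseteq> Univ M \<and> {g} = fiber M (\<lambda>e. e 0 = e 1) e" if "g \<in> carrier G" for g
    using that by (intro exI[of _ "\<lambda>_. g"]) (auto simp: fiber_def carrier_eq)
  then show ?thesis unfolding uniformly_definable_def using dpred_eq by blast
qed

lemma unif_mult: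
  assumes "unif \<D>" "unif \<E>"
  shows "unif {C <#> E | C E. C \<in> \<D> \<and> E \<in> \<E>}"
proof -
  obtain P Q where PQ: "dpred L M P" "dpred L M Q"
    "\<And>C E. C \<in> \<D> \<Longrightarrow> E \<in> \<E> \<Longrightarrow> \<exists>e. range e \<subseteq> Univ M \<and> C = fiber M P e \<and> E = fiber M Q e"
    using uniformly_definable_merge[OF assms] by blast
  \<comment> \<open>Assignments for \<open>R\<close> start with the second factor, the first factor
    and the product, in this order, and the parameters follow; \<open>?f i\<close> keeps value
    \<open>i\<close> and the parameters.\<close>
  let ?f = "\<lambda>i. case_nat i (\<lambda>j. j + 3)"
  let ?g = "case_nat 1 (case_nat 0 (\<lambda>_. 2))"
  define R where "R = (\<lambda>w. P (w \<circ> ?f 1) \<and> Q (w \<circ> ?f 0) \<and> w 1 \<otimes> w 0 = w 2)"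
  have "dpred L M (\<lambda>w. w 1 \<otimes> w 0 = w 2)"
    using dpred_subst[OF dpred_mult, of ?g] by (simp add: numeral_2_eq_2)
  then have "dpred L M R" unfolding R_def by (intro dpred_conj dpred_subst PQ(1,2))
  then have D: "dpred L M (\<lambda>v. \<exists>y\<in>Univ M. \<exists>z\<in>Univ M. R (case_nat z (case_nat y v)))"
    by (rule dpred_ex_case[OF dpred_ex_case])
  have "\<exists>e. range e \<subseteq> Univ M \<and>
      C <#> E = fiber M (\<lambda>v. \<exists>y\<in>Univ M. \<exists>z\<in>Univ M. R (case_nat z (case_nat y v))) e"
    if CE: "C \<in> \<D>" "E \<in> \<E>" for C E
  proof -
    obtain e where e: "range e \<subseteq> Univ M" "C = fiber M P e" "E = fiber M Q e" using PQ(3)[OF CE] by blast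
    have "case_nat z (case_nat y (case_nat x e)) \<circ> ?f 1 = case_nat y e"
      "case_nat z (case_nat y (case_nat x e)) \<circ> ?f 0 = case_nat z e" for x y z
      by (auto simp: numeral_3_eq_3 split: nat.split)
    then have "R (case_nat z (case_nat y (case_nat x e))) \<longleftrightarrow>
        P (case_nat y e) \<and> Q (case_nat z e) \<and> y \<otimes> z = x" for x y z
      unfolding R_def by (simp add: numeral_2_eq_2)
    moreover have "y \<otimes> z \<in> Univ M" if "y \<in> Univ M" "z \<in> Univ M" for y z
      using that carrier_eq m_closed by metis
    ultimately have "C <#> E = fiber M (\<lambda>v. \<exists>y\<in>Univ M. \<exists>z\<in>Univ M. R (case_nat z (case_nat y v))) e"
      unfolding e(2,3) fiber_def set_mult_def by fastforce
    then show ?thesis using e(1) by blast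
  qed
  then show ?thesis unfolding uniformly_definable_def using D by blast
qed

lemma unif_image:
  assumes "unif \<D>" and F: "dpred L M (\<lambda>e. F (e 0) = e 1)" "\<And>x. x \<in> Univ M \<Longrightarrow> F x \<in> Univ M"
  shows "unif {F ` C | C. C \<in> \<D>}"
proof -
  obtain P where P: "dpred L M P" "\<And>C. C \<in> \<D> \<Longrightarrow> \<exists>e. range e \<subseteq> Univ M \<and> C = fiber M P e"
    using assms(1) unfolding uniformly_definable_def by blast
  define R where "R = (\<lambda>w. P (w \<circ> case_nat 0 (\<lambda>j. j + 2)) \<and> F (w 0) = w 1)"
  have "dpred L M R" unfolding R_def by (intro dpred_conj dpred_subst P(1) F(1))
  then have D: "dpred L M (\<lambda>v. \<exists>y\<in>Univ M. R (case_nat y v))" by (rule dpred_ex_case)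
  have "\<exists>e. range e \<subseteq> Univ M \<and> F ` C = fiber M (\<lambda>v. \<exists>y\<in>Univ M. R (case_nat y v)) e" if C: "C \<in> \<D>" for C
  proof -
    obtain e where e: "range e \<subseteq> Univ M" "C = fiber M P e" using P(2)[OF C] by blast
    have "case_nat y (case_nat x e) \<circ> case_nat 0 (\<lambda>j. j + 2) = case_nat y e" for x y
      by (auto split: nat.split)
    then have "R (case_nat y (case_nat x e)) \<longleftrightarrow> P (case_nat y e) \<and> F y = x" for x y
      unfolding R_def by simp
    then have "F ` C = fiber M (\<lambda>v. \<exists>y\<in>Univ M. R (case_nat y v)) e"
      unfolding e(2) fiber_def using F(2) by fastforce
    then show ?thesis using e(1) by blast
  qed
  then show ?thesis unfolding uniformly_definable_def using D by blast
qed

lemma unif_inv: "unif \<D> \<Longrightarrow> unif {(\<lambda>x. inv x) ` C | C. C \<in> \<D>}"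
  by (rule unif_image[OF _ dpred_inv]) (simp_all add: carrier_eq[symmetric])

lemma unif_square: "unif \<D> \<Longrightarrow> unif {(\<lambda>x. x \<otimes> x) ` C | C. C \<in> \<D>}"
proof (rule unif_image)
  show "dpred L M (\<lambda>e. e 0 \<otimes> e 0 = e 1)"
    using dpred_subst[OF dpred_mult, of "case_nat 0 (case_nat 0 (\<lambda>_. 1))"] by (simp add: numeral_2_eq_2)
qed (simp_all add: carrier_eq[symmetric])

lemma unif_count:
  assumes "unif {C}" "unif {E}"
  shows "unif {{h \<in> carrier G. at_least n ((h <# C) \<inter> E)}}"
proof -
  obtain P Q where PQ: "dpred L M P" "dpred L M Q"
    "\<And>C' E'. C' \<in> {C} \<Longrightarrow> E' \<in> {E} \<Longrightarrow> \<exists>e. range e \<subseteq> Univ M \<and> C' = fiber M P e \<and> E' = fiber M Q e"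
    using uniformly_definable_merge[OF assms] by blast
  obtain e where e: "range e \<subseteq> Univ M" "C = fiber M P e" "E = fiber M Q e" using PQ(3) by blast
  \<comment> \<open>Positions \<open>0\<close>, \<open>1\<close>, \<open>2\<close> hold the element
    of \<open>C\<close>, its translate and the translating \<open>h\<close>.\<close>
  let ?g = "case_nat 2 (case_nat 0 (\<lambda>_. 1))"
  define R where "R = (\<lambda>w. P (w \<circ> case_nat 0 (\<lambda>j. j + 3)) \<and> w 2 \<otimes> w 0 = w 1)"
  define S where "S = (\<lambda>v. Q (v \<circ> case_nat 0 (\<lambda>j. j + 2)) \<and> (\<exists>z\<in>Univ M. R (case_nat z v)))"
  have "dpred L M (\<lambda>w. w 2 \<otimes> w 0 = w 1)"
    using dpred_subst[OF dpred_mult, of ?g] by (simp add: numeral_2_eq_2)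
  then have "dpred L M R" unfolding R_def by (intro dpred_conj dpred_subst PQ(1))
  then have "dpred L M S" unfolding S_def by (intro dpred_conj dpred_subst dpred_ex_case PQ(2))
  then have D: "dpred L M (\<lambda>u. at_least n {a \<in> Univ M. S (case_nat a u)})" by (rule dpred_at_least_case)
  have "{a \<in> Univ M. S (case_nat a (case_nat h e))} = (h <# C) \<inter> E" for h
  proof -
    have "case_nat z (case_nat a (case_nat h e)) \<circ> case_nat 0 (\<lambda>j. j + 3) = case_nat z e"
      "case_nat a (case_nat h e) \<circ> case_nat 0 (\<lambda>j. j + 2) = case_nat a e" for a z
      by (auto simp: numeral_3_eq_3 split: nat.split)
    then have "S (case_nat a (case_nat h e)) \<longleftrightarrow>
        Q (case_nat a e) \<and> (\<exists>z\<in>Univ M. P (case_nat z e) \<and> h \<otimes> z = a)" for a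
      unfolding S_def R_def by (simp add: numeral_2_eq_2)
    then show ?thesis unfolding e(2,3) fiber_def l_coset_def by blast
  qed
  then have "{h \<in> carrier G. at_least n ((h <# C) \<inter> E)} =
      fiber M (\<lambda>u. at_least n {a \<in> Univ M. S (case_nat a u)}) e"
    unfolding fiber_def carrier_eq by simp
  then show ?thesis unfolding uniformly_definable_def using D e(1) by blast
qed

lemma unif_meet:
  assumes "unif \<D>"
  shows "\<exists>N. \<forall>F::nat \<Rightarrow> 'a set. (\<forall>i<N. F i \<in> \<D> \<and> at_least N (F i)) \<longrightarrow>
      (\<exists>x\<in>carrier G. k \<le> card {i\<in>{..<N}. x \<in> F i})"
proof -
  obtain P where P: "dpred L M P" "\<And>C. C \<in> \<D> \<Longrightarrow> \<exists>e. range e \<subseteq> Univ M \<and> C = fiber M P e"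
    using assms unfolding uniformly_definable_def by blast
  obtain N where N: "\<forall>E. (\<forall>i<N. range (E i) \<subseteq> Univ M \<and> at_least N (fiber M P (E i))) \<longrightarrow>
    (\<exists>x\<in>Univ M. k \<le> card {i\<in>{..<N}. x \<in> fiber M P (E i)})" using fibers_meet[OF P(1)] ..
  have "\<exists>x\<in>carrier G. k \<le> card {i\<in>{..<N}. x \<in> F i}" if F: "\<forall>i<N. F i \<in> \<D> \<and> at_least N (F i)"
    for F :: "nat \<Rightarrow> 'a set"
  proof -
    have "\<forall>i. \<exists>e. i < N \<longrightarrow> range e \<subseteq> Univ M \<and> F i = fiber M P e" using F P(2) by blast
    from choice[OF this] obtain E where E: "\<forall>i. i < N \<longrightarrow> range (E i) \<subseteq> Univ M \<and> F i = fiber M P (E i)" ..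
    then have "\<forall>i<N. range (E i) \<subseteq> Univ M \<and> at_least N (fiber M P (E i))" using F by simp
    from mp[OF spec[OF N] this] obtain x where
      x: "x \<in> Univ M" "k \<le> card {i\<in>{..<N}. x \<in> fiber M P (E i)}" by (elim bexE)
    have "{i\<in>{..<N}. x \<in> fiber M P (E i)} = {i\<in>{..<N}. x \<in> F i}" using E by auto
    then show ?thesis using x carrier_eq by auto
  qed
  then show ?thesis by blast
qed

lemma definable_group: "infinite (carrier G) \<Longrightarrow> definable_group G unif"
  by unfold_locales
    (assumption | erule (1) unif_subset | erule (1) unif_carrier | rule unif_singletons
      | erule (1) unif_inter unif_mult unif_count | erule unif_compl unif_inv unif_square unif_meet)+

text \<open>An infinite definable set of roots of \<open>c\<close> would contain some
  \<open>y\<close> generic over \<open>A\<close> and some \<open>x\<close> generic over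
  \<open>A\<close> and \<open>y\<close>; these are independent and have the same square.\<close>

lemma finite_square_roots:
  assumes A: "A \<subseteq> Univ M" "|A| <o \<kappa>" and X: "unif {X}"
    and squares: "generically_distinct_squares L M G A X"
  shows "finite {x \<in> X. x \<otimes> x = c}"
proof (cases "c \<in> carrier G")
  case False
  then have "{x \<in> X. x \<otimes> x = c} = {}" using unif_carrier[OF X] by auto
  then show ?thesis by (metis finite.emptyI)
next
  case True
  have "unif {{x \<in> X. x \<otimes> x = c}}"
  proof -
    have "unif {{c}}" by (rule unif_subset[OF unif_singletons]) (use True in blast)
    from uniformly_definable_merge[OF X this] obtain P Q where PQ: "dpred L M P" "dpred L M Q"
      "\<And>C E. C \<in> {X} \<Longrightarrow> E \<in> {{c}} \<Longrightarrow> \<exists>e. range e \<subseteq> Univ M \<and> C = fiber M P e \<and> E = fiber M Q e"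
      by blast
    obtain e where e: "range e \<subseteq> Univ M" "X = fiber M P e" "{c} = fiber M Q e" using PQ(3) by blast
    let ?R = "\<lambda>w. Q (w \<circ> case_nat 0 (\<lambda>j. j + 2)) \<and> w 1 \<otimes> w 1 = w 0"
    have "dpred L M (\<lambda>w. w 1 \<otimes> w 1 = w 0)"
      using dpred_subst[OF dpred_mult, of "case_nat 1 (case_nat 1 (\<lambda>_. 0))"] by (simp add: numeral_2_eq_2)
    then have D: "dpred L M (\<lambda>v. P v \<and> (\<exists>z\<in>Univ M. ?R (case_nat z v)))"
      by (intro dpred_conj dpred_ex_case dpred_subst PQ(1,2))
    have "case_nat z (case_nat x e) \<circ> case_nat 0 (\<lambda>j. j + 2) = case_nat z e" for x z
      by (auto split: nat.split)
    moreover have "z \<in> Univ M \<and> Q (case_nat z e) \<longleftrightarrow> z = c" for z using e(3) unfolding fiber_def by blast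
    ultimately have "(\<exists>z\<in>Univ M. ?R (case_nat z (case_nat x e))) \<longleftrightarrow> x \<otimes> x = c" for x by auto
    then have "{x \<in> X. x \<otimes> x = c} = fiber M (\<lambda>v. P v \<and> (\<exists>z\<in>Univ M. ?R (case_nat z v))) e"
      unfolding e(2) fiber_def by auto
    then show ?thesis unfolding uniformly_definable_def using D e(1) by blast
  qed
  then obtain P e where Pe: "dpred L M P" "range e \<subseteq> Univ M" "{x \<in> X. x \<otimes> x = c} = fiber M P e"
    unfolding uniformly_definable_def by blast
  show ?thesis
  proof (rule ccontr)
    assume "infinite {x \<in> X. x \<otimes> x = c}"
    then have inf: "infinite (fiber M P e)" using Pe(3) by simp
    obtain y where y: "y \<in> fiber M P e" "generic L M A y"
      using generic_exists[OF A Pe(1,2) inf] by blast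
    have yU: "y \<in> Univ M" using y(1) unfolding fiber_def by blast
    have "insert y A \<subseteq> Univ M" using yU A(1) by blast
    moreover have "|insert y A| <o \<kappa>" using small_union_finite[OF A(2), of "{y}"] by simp
    ultimately obtain x where x: "x \<in> fiber M P e" "generic L M (insert y A) x"
      using generic_exists[OF _ _ Pe(1,2) inf] by blast
    have xU: "x \<in> Univ M" using x(1) unfolding fiber_def by blast
    have "generic L M A x" using generic_mono[OF x(2)] by blast
    moreover have "independent L M {x} A {y}" by (rule generic_independent[OF A(1) yU xU x(2)])
    moreover have "x \<in> X" "x \<otimes> x = c" "y \<in> X" "y \<otimes> y = c" using x(1) y(1) unfolding Pe(3)[symmetric] by auto
    moreover have "x [^] (2::nat) = x \<otimes> x" "y [^] (2::nat) = y \<otimes> y"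
      using xU yU carrier_eq by (simp_all add: numeral_2_eq_2)
    ultimately show False using squares y(2) unfolding generically_distinct_squares_def by metis
  qed
qed

lemma finite_bad_initial_points:
  assumes A: "A \<subseteq> Univ M" "|A| <o \<kappa>" and X: "unif {X}"
    and squares: "generically_distinct_squares L M G A X"
    and H: "subgroup H G" "unif {H}" "finite (rcosets H)"
  shows "finite (bad_initial_points G H X)"
proof (rule ccontr)
  let ?B = "bad_initial_points G H X"
  assume inf: "infinite ?B"
  have XG: "X \<subseteq> carrier G" using unif_carrier[OF X] by blast
  have BX: "?B \<subseteq> X" unfolding bad_initial_points_def by blast
  from finite_subset[OF subset_trans[OF this XG]] inf have "infinite (carrier G)" by blast
  then interpret D: definable_group G unif by (rule definable_group)
  have HG: "H \<subseteq> carrier G" using H(1) by (rule subgroup.subset)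
  \<comment> \<open>Inversion matches the left coset of \<open>x\<close> with the right coset of
    \<open>inv x\<close>, so the finiteness of \<open>rcosets H\<close> serves for left
    cosets.\<close>
  have "(\<lambda>x. H #> inv x) ` ?B \<subseteq> rcosets H" using BX XG HG rcosetsI by blast
  then have "finite ((\<lambda>x. H #> inv x) ` ?B)" using H(3) by (rule finite_subset)
  from pigeonhole_infinite[OF inf this] obtain c where
    c: "c \<in> ?B" "infinite {x \<in> ?B. H #> inv x = H #> inv c}" by blast
  have cG: "c \<in> carrier G" using c(1) BX XG by blast
  define D where "D = X \<inter> (c <# H)"
  have DG: "D \<subseteq> carrier G" using XG unfolding D_def by blast
  interpret square_set G unif D
  proof
    show "unif {D}" unfolding D_def by (intro D.definable_inter D.definable_translate X H(2) cG)
    show "finite {x \<in> D. x \<otimes> x = d}" for d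
      by (rule finite_subset[OF _ finite_square_roots[OF A X squares, of d]]) (auto simp: D_def)
  qed
  have "x \<in> D - good" if x: "x \<in> ?B" "H #> inv x = H #> inv c" for x
  proof -
    have xX: "x \<in> X" using BX x(1) by (rule subsetD)
    have xG: "x \<in> carrier G" using XG xX by (rule subsetD)
    have "inv c \<in> H #> inv x" unfolding x(2) by (rule rcos_self[OF inv_closed[OF cG] H(1)])
    then obtain h where h: "h \<in> H" "inv c = h \<otimes> inv x" unfolding r_coset_def by blast
    have hG: "h \<in> carrier G" using h(1) HG by blast
    have "inv c \<otimes> x = h" using h(2) hG xG by (simp add: m_assoc)
    then have xc: "inv c \<otimes> x \<in> H" using h(1) by simp
    then have xD: "x \<in> D" unfolding D_def using xX D.mem_l_coset[OF HG cG xG] by blast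
    let ?K = "{g \<in> H. x \<in> X \<and> x \<otimes> g \<in> X \<and> g \<otimes> x \<otimes> g \<in> X}"
    have fin: "finite ?K" using x(1) unfolding bad_initial_points_def by blast
    \<comment> \<open>For \<open>s = y\<^sup>2 = xz\<close> take
      \<open>g = x\<^sup>-\<^sup>1y\<close>, which lies in \<open>H\<close> because \<open>x\<close>
      and \<open>y\<close> share a left coset. Then \<open>xg = y\<close> and
      \<open>gxg = x\<^sup>-\<^sup>1y\<^sup>2 = z\<close> are in \<open>X\<close>, and a bad initial
      point admits only finitely many such \<open>g\<close>.\<close>
    have "(x <# D) \<inter> squares \<subseteq> (\<lambda>g. (x \<otimes> g) \<otimes> (x \<otimes> g)) ` ?K"
    proof
      fix s assume "s \<in> (x <# D) \<inter> squares"
      then obtain z y where zy: "z \<in> D" "s = x \<otimes> z" "y \<in> D" "s = y \<otimes> y"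
        unfolding l_coset_def squares_def by blast
      have G: "z \<in> carrier G" "y \<in> carrier G" using zy DG by blast+
      have yc: "inv c \<otimes> y \<in> H" using zy(3) D.mem_l_coset[OF HG cG G(2)] unfolding D_def by blast
      define g where "g = inv x \<otimes> y"
      have gG: "g \<in> carrier G" unfolding g_def using xG G by simp
      have xg: "x \<otimes> g = y" unfolding g_def using xG G by (simp add: m_assoc[symmetric])
      have "inv (inv c \<otimes> x) \<otimes> (inv c \<otimes> y) \<in> H"
        by (rule subgroup.m_closed[OF H(1) subgroup.m_inv_closed[OF H(1) xc] yc])
      moreover have "c \<otimes> (inv c \<otimes> y) = y" using cG G by (simp add: m_assoc[symmetric])
      then have "inv (inv c \<otimes> x) \<otimes> (inv c \<otimes> y) = g"
        unfolding g_def using cG xG G by (simp add: inv_mult_group m_assoc)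
      ultimately have "g \<in> H" by simp
      moreover have "g \<otimes> x \<otimes> g = g \<otimes> y" using xg xG gG by (simp add: m_assoc)
      moreover have "g \<otimes> y = inv x \<otimes> (x \<otimes> z)"
        unfolding g_def using zy(2,4) xG G by (simp add: m_assoc)
      moreover have "inv x \<otimes> (x \<otimes> z) = z" using xG G by (simp add: m_assoc[symmetric])
      ultimately have "g \<in> ?K" using zy(1,3) xX xg unfolding D_def by simp
      moreover have "s = (x \<otimes> g) \<otimes> (x \<otimes> g)" using zy(4) xg by simp
      ultimately show "s \<in> (\<lambda>g. (x \<otimes> g) \<otimes> (x \<otimes> g)) ` ?K" by blast
    qed
    from finite_subset[OF this finite_imageI[OF fin]] have "finite ((x <# D) \<inter> squares)" .
    then show ?thesis using xD unfolding good_def by blast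
  qed
  then have "{x \<in> ?B. H #> inv x = H #> inv c} \<subseteq> D - good" by blast
  from finite_subset[OF this finite_not_good] show False using c(2) by blast
qed

end

theorem theorem1p19:
  fixes \<kappa> :: "'k rel"
    and L :: "('f, 'r) language"
    and T :: "('f, 'r) fm set"
    and M :: "('a, 'f, 'r) struct"
    and G :: "('a, 'b) monoid_scheme"
    and A X :: "'a set"
  assumes "supersimple_group_rank_1 \<kappa> L T M G"
    and "small \<kappa> M A"
    and "definable_set_over L M A X"
    and "generically_distinct_squares L M G A X"
  shows "\<forall>H. subgroup H G \<and> definable_set_over L M (carrier G) H \<and> finite (rcosets\<^bsub>G\<^esub> H)
           \<longrightarrow> finite (bad_initial_points G H X)"
proof -
  have hyps: "is_model L T M" "sufficiently_saturated \<kappa> L M" "supersimple_rank_1 L M" "group G"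
    "carrier G = Univ M"
    "definable_over L M {} 3 {[x, y, x \<otimes>\<^bsub>G\<^esub> y] | x y. x \<in> carrier G \<and> y \<in> carrier G}"
    "definable_over L M {} 2 {[x, inv\<^bsub>G\<^esub> x] | x. x \<in> carrier G}"
    using assms(1) unfolding supersimple_group_rank_1_def by blast+
  have ne: "Univ M \<noteq> {}" using hyps(1) unfolding is_model_def is_structure_def by blast
  have mult: "dpred L M (\<lambda>e. e 0 \<otimes>\<^bsub>G\<^esub> e 1 = e 2)"
  proof -
    obtain \<phi> where \<phi>: "\<phi> \<in> formulas L 3" "{[x, y, x \<otimes>\<^bsub>G\<^esub> y] | x y. x \<in> carrier G \<and> y \<in> carrier G} =
        realizations M 3 (\<phi>, [])"
      using hyps(6) unfolding definable_over_def pformulas_def by auto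
    have "sat M e \<phi> \<longleftrightarrow> e 0 \<otimes>\<^bsub>G\<^esub> e 1 = e 2" if e: "range e \<subseteq> Univ M" for e
    proof -
      have U: "e i \<in> Univ M" for i using e by blast
      have "sat M e \<phi> = holds M \<phi> [e 0, e 1, e 2]"
        using \<phi>(1) by (intro holds_eq_sat[of _ L, symmetric]) (auto simp: less_Suc_eq numeral_2_eq_2 numeral_3_eq_3)
      also have "\<dots> \<longleftrightarrow> [e 0, e 1, e 2] \<in> realizations M 3 (\<phi>, [])"
        using U by (auto simp: realizations_def tuples_def)
      also have "\<dots> \<longleftrightarrow> e 0 \<otimes>\<^bsub>G\<^esub> e 1 = e 2"
        using U hyps(5) unfolding \<phi>(2)[symmetric] by auto
      finally show ?thesis .
    qed
    then show ?thesis using \<phi>(1) unfolding dpred_def formulas_def by blast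
  qed
  have inv: "dpred L M (\<lambda>e. inv\<^bsub>G\<^esub> (e 0) = e 1)"
  proof -
    obtain \<phi> where \<phi>: "\<phi> \<in> formulas L 2" "{[x, inv\<^bsub>G\<^esub> x] | x. x \<in> carrier G} = realizations M 2 (\<phi>, [])"
      using hyps(7) unfolding definable_over_def pformulas_def by (auto simp: numeral_2_eq_2)
    have "sat M e \<phi> \<longleftrightarrow> inv\<^bsub>G\<^esub> (e 0) = e 1" if e: "range e \<subseteq> Univ M" for e
    proof -
      have U: "e i \<in> Univ M" for i using e by blast
      have "sat M e \<phi> = holds M \<phi> [e 0, e 1]"
        using \<phi>(1) by (intro holds_eq_sat[of _ L, symmetric]) (auto simp: less_Suc_eq numeral_2_eq_2)
      also have "\<dots> \<longleftrightarrow> [e 0, e 1] \<in> realizations M 2 (\<phi>, [])"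
        using U by (auto simp: realizations_def tuples_def)
      also have "\<dots> \<longleftrightarrow> inv\<^bsub>G\<^esub> (e 0) = e 1"
        using U hyps(5) unfolding \<phi>(2)[symmetric] by auto
      finally show ?thesis .
    qed
    then show ?thesis using \<phi>(1) unfolding dpred_def formulas_def by blast
  qed
  interpret group G by (rule hyps(4))
  interpret rank_one_group \<kappa> L M G
    by (unfold_locales; rule ne hyps(2,3,5) mult inv)
  have A: "A \<subseteq> Univ M" "|A| <o \<kappa>" using assms(2) unfolding small_def by auto
  show ?thesis
  proof (intro allI impI)
    fix H assume "subgroup H G \<and> definable_set_over L M (carrier G) H \<and> finite (rcosets\<^bsub>G\<^esub> H)"
    then have H: "subgroup H G" "definable_set_over L M (carrier G) H" "finite (rcosets\<^bsub>G\<^esub> H)" by auto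
    have "unif {X}" by (rule definable_set_over_uniform[OF assms(3) A(1) ne])
    moreover have "unif {H}" by (rule definable_set_over_uniform[OF H(2) _ ne]) (simp add: hyps(5))
    ultimately show "finite (bad_initial_points G H X)"
      using finite_bad_initial_points[OF A _ assms(4) H(1) _ H(3)] by blast
  qed
qed

end
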